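(* For all $n\ge1$ and $k\ge1$, the poset $\widehat{\Pi_n^k}:=\Pi_n^k\cup\{\hat 1\}$ (a new maximum element $\hat1$ adjoined) is EL-shellable and hence Cohen–Macaulay. Consequently, for each $\mu\in\mathrm{WComp}_{n-1}$ with $\mathrm{supp}(\mu)\subseteq[k]$, the order complex $\Delta((\hat 0,[n]^\mu))$ has the homotopy type of a wedge of $(n-3)$-dimensional spheres.
   Context: A weak composition is a sequence $\mu=(\mu(1),\mu(2),\dots)$ of nonnegative integers with finite sum $|\mu|$; $\mathrm{WComp}_n$ is the set of those with $|\mu|=n$; $\mathrm{supp}(\mu)=\{j:\mu(j)\ne0\}$; addition is componentwise and $\mathbf{e}_r$ is the $r$-th unit vector. The poset $\Pi_n^k$ consists of weighted partitions $\{B_1^{\mu_1},\dots,B_t^{\mu_t}\}$ where $\{B_1,\dots,B_t\}$ is a set partition of $[n]$ and $\mu_i\in\mathrm{WComp}_{|B_i|-1}$ with $\mathrm{supp}(\mu_i)\subseteq[k]$; the cover relations are: merge two blocks $A,B$ with weights $a,b$ into one block $(A\cup B)^{a+b+\mathbf{e}_r}$ for some $r\in[k]$, leaving other blocks unchanged. Its minimum is $\hat0=\{\{1\}^0,\dots,\{n\}^0\}$ and its maximal elements are $[n]^\mu$, $\mu\in\mathrm{WComp}_{n-1}$, $\mathrm{supp}(\mu)\subseteq[k]$. $\Delta(P)$ denotes the order complex (simplicial complex of chains) of a poset $P$. *)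

theory Defs
  imports "HOL-Homology.Homology" "HOL-Library.Disjoint_Sets" "HOL-Library.Poly_Mapping"
begin

section \<open>Finite posets and EL-labelings\<close>

text \<open>
  A poset is given by its order relation \<^term>\<open>r\<close> with \<^prop>\<open>Partial_order r\<close>; its
  underlying set is \<^term>\<open>Field r\<close>, and the subposet induced on \<^term>\<open>A\<close>
  is \<^term>\<open>Restr r A\<close>.
\<close>

definition covers :: "'a rel \<Rightarrow> 'a \<Rightarrow> 'a \<Rightarrow> bool" where
  "covers r x y \<longleftrightarrow> (x, y) \<in> r \<and> x \<noteq> y \<and>
     \<not> (\<exists>z. (x, z) \<in> r \<and> (z, y) \<in> r \<and> z \<noteq> x \<and> z \<noteq> y)"

definition open_interval :: "'a rel \<Rightarrow> 'a \<Rightarrow> 'a \<Rightarrow> 'a set" where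
  "open_interval r x y = {z. (x, z) \<in> r \<and> (z, y) \<in> r \<and> z \<noteq> x \<and> z \<noteq> y}"

definition finite_bounded_poset :: "'a rel \<Rightarrow> bool" where
  "finite_bounded_poset r \<longleftrightarrow> Partial_order r \<and> finite (Field r) \<and>
     (\<exists>b\<in>Field r. \<forall>x\<in>Field r. (b, x) \<in> r) \<and>
     (\<exists>t\<in>Field r. \<forall>x\<in>Field r. (x, t) \<in> r)"

text \<open>The maximal chains of a closed interval of a finite poset, listed from bottom to top.\<close>

definition maximal_chains :: "'a rel \<Rightarrow> 'a \<Rightarrow> 'a \<Rightarrow> 'a list set" where
  "maximal_chains r x y =
     {c. c \<noteq> [] \<and> hd c = x \<and> last c = y \<and> successively (covers r) c}"

definition label_word :: "('a \<Rightarrow> 'a \<Rightarrow> 'l) \<Rightarrow> 'a list \<Rightarrow> 'l list" where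
  "label_word lam c = map2 lam c (tl c)"

definition increasing_word :: "'l rel \<Rightarrow> 'l list \<Rightarrow> bool" where
  "increasing_word s w \<longleftrightarrow> successively (\<lambda>a b. (a, b) \<in> s - Id) w"

text \<open>
  Edge labelings take values in a poset \<^term>\<open>s\<close> of labels, which need not be a chain;
  increasing means strictly increasing.
\<close>

definition EL_labeling :: "'l rel \<Rightarrow> ('a \<Rightarrow> 'a \<Rightarrow> 'l) \<Rightarrow> 'a rel \<Rightarrow> bool" where
  "EL_labeling s lam r \<longleftrightarrow> Partial_order s \<and>
     (\<forall>x y. covers r x y \<longrightarrow> lam x y \<in> Field s) \<and>
     (\<forall>(x, y)\<in>r. \<exists>c\<in>maximal_chains r x y.
        increasing_word s (label_word lam c) \<and>
        (\<forall>c'\<in>maximal_chains r x y. c' \<noteq> c \<longrightarrow>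
           \<not> increasing_word s (label_word lam c') \<and>
           (label_word lam c, label_word lam c') \<in> lexord (s - Id)))"

text \<open>
  A finite poset has finitely many cover relations, so any label poset may be cut down to
  a finite one and then transported to natural numbers carrying an arbitrary partial
  order \<^term>\<open>s\<close> (not the usual one).
\<close>

definition EL_shellable :: "'a rel \<Rightarrow> bool" where
  "EL_shellable r \<longleftrightarrow> finite_bounded_poset r \<and>
     (\<exists>(s :: nat rel) lam. EL_labeling s lam r)"

text \<open>Adjoining a new maximum element, represented by \<^const>\<open>None\<close>.\<close>

definition adjoin_top :: "'a rel \<Rightarrow> 'a option rel" where
  "adjoin_top r = {(Some x, Some y) | x y. (x, y) \<in> r} \<union>
     insert None (Some ` Field r) \<times> {None}"


section \<open>Simplicial complexes\<close>

text \<open>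
  An abstract simplicial complex is a downward closed set of finite sets containing the
  empty face.
\<close>

definition order_complex :: "'a rel \<Rightarrow> 'a set set" where
  "order_complex r = {C \<in> Chains r. finite C}"

definition link :: "'a set set \<Rightarrow> 'a set \<Rightarrow> 'a set set" where
  "link K \<sigma> = {\<tau>\<in>K. \<sigma> \<inter> \<tau> = {} \<and> \<sigma> \<union> \<tau> \<in> K}"

definition complex_dim :: "'a set set \<Rightarrow> int" where
  "complex_dim K = int (Max (card ` K)) - 1"

text \<open>
  Barycentric coordinates. For the finite complexes considered here the topology of
  pointwise convergence is the usual topology of the realization. The complex whose only
  face is the empty one has empty realization.
\<close>

definition geometric_realization :: "'a set set \<Rightarrow> ('a \<Rightarrow> real) topology" where
  "geometric_realization K = subtopology (powertop_real UNIV)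
     {f. (\<forall>v. 0 \<le> f v) \<and> {v. f v \<noteq> 0} \<in> K \<and> (\<Sum>v | f v \<noteq> 0. f v) = 1}"

text \<open>
  Integral homology; vanishing below the top dimension over the integers implies it over
  every field. The library's reduced homology of the empty space is trivial also in
  degree \<open>-1\<close>, which is harmless: degree \<open>-1\<close> is tested only for links
  of dimension at least \<open>0\<close>, and these have nonempty realization.
\<close>

definition cohen_macaulay_complex :: "'a set set \<Rightarrow> bool" where
  "cohen_macaulay_complex K \<longleftrightarrow>
     (\<forall>\<sigma>\<in>K. \<forall>i. i < complex_dim (link K \<sigma>) \<longrightarrow>
        trivial_group (reduced_homology_group i (geometric_realization (link K \<sigma>))))"

definition cohen_macaulay_poset :: "'a rel \<Rightarrow> bool" where
  "cohen_macaulay_poset r \<longleftrightarrow> cohen_macaulay_complex (order_complex r)"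


section \<open>Wedges of spheres\<close>

text \<open>
  The quotient of the disjoint union of the spaces \<^term>\<open>X i\<close>, together with one extra
  point \<^const>\<open>None\<close>, in which all base points \<^term>\<open>p i\<close> are identified
  with \<^const>\<open>None\<close>. The wedge of the empty family is thus a point.
\<close>

definition wedge_inclusion :: "('i \<Rightarrow> 'a) \<Rightarrow> 'i \<Rightarrow> 'a \<Rightarrow> ('i \<times> 'a) option" where
  "wedge_inclusion p i x = (if x = p i then None else Some (i, x))"

definition wedge_topology ::
    "'i set \<Rightarrow> ('i \<Rightarrow> 'a topology) \<Rightarrow> ('i \<Rightarrow> 'a) \<Rightarrow> ('i \<times> 'a) option topology" where
  "wedge_topology I X p = topology (\<lambda>U.
     U \<subseteq> insert None (\<Union>i\<in>I. wedge_inclusion p i ` topspace (X i)) \<and>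
     (\<forall>i\<in>I. openin (X i) {x \<in> topspace (X i). wedge_inclusion p i x \<in> U}))"

lemma openin_wedge_topology:
  "openin (wedge_topology I X p) U \<longleftrightarrow>
     U \<subseteq> insert None (\<Union>i\<in>I. wedge_inclusion p i ` topspace (X i)) \<and>
     (\<forall>i\<in>I. openin (X i) {x \<in> topspace (X i). wedge_inclusion p i x \<in> U})"
proof -
  have "istopology (\<lambda>U.
     U \<subseteq> insert None (\<Union>i\<in>I. wedge_inclusion p i ` topspace (X i)) \<and>
     (\<forall>i\<in>I. openin (X i) {x \<in> topspace (X i). wedge_inclusion p i x \<in> U}))"
    (is "istopology ?T")
    unfolding istopology_def
  proof (intro conjI allI impI)
    fix S T assume "?T S" "?T T"
    moreover have "{x \<in> topspace (X i). wedge_inclusion p i x \<in> S \<inter> T} =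
        {x \<in> topspace (X i). wedge_inclusion p i x \<in> S} \<inter>
        {x \<in> topspace (X i). wedge_inclusion p i x \<in> T}" for i
      by auto
    ultimately show "S \<inter> T \<subseteq> insert None (\<Union>i\<in>I. wedge_inclusion p i ` topspace (X i))"
      and "\<forall>i\<in>I. openin (X i) {x \<in> topspace (X i). wedge_inclusion p i x \<in> S \<inter> T}"
      by (blast, simp add: openin_Int)
  next
    fix \<K> assume *: "\<forall>K\<in>\<K>. ?T K"
    then show "\<Union>\<K> \<subseteq> insert None (\<Union>i\<in>I. wedge_inclusion p i ` topspace (X i))"
      by blast
    have "{x \<in> topspace (X i). wedge_inclusion p i x \<in> \<Union>\<K>} =
        (\<Union>K\<in>\<K>. {x \<in> topspace (X i). wedge_inclusion p i x \<in> K})" for i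
      by auto
    then show "\<forall>i\<in>I. openin (X i) {x \<in> topspace (X i). wedge_inclusion p i x \<in> \<Union>\<K>}"
      using * by (auto intro!: openin_Union)
  qed
  then show ?thesis
    by (simp add: wedge_topology_def)
qed

text \<open>
  The wedge of \<^term>\<open>m\<close> spheres of dimension \<^term>\<open>d\<close>. Spheres of negative dimension
  are empty by convention and have no base point; there the wedge is empty.
\<close>

definition wedge_of_spheres :: "int \<Rightarrow> nat \<Rightarrow> (nat \<times> (nat \<Rightarrow> real)) option topology" where
  "wedge_of_spheres d m =
     (if d < 0 then trivial_topology
      else wedge_topology {..<m} (\<lambda>_. nsphere (nat d)) (\<lambda>_ j. if j = 0 then 1 else 0))"


section \<open>Weighted partitions\<close>

text \<open>
  The parts of a weak composition are indexed from \<open>1\<close>, hence the condition at \<open>0\<close>.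
\<close>

definition WComp :: "nat \<Rightarrow> (nat \<Rightarrow>\<^sub>0 nat) set" where
  "WComp n = {\<mu>. 0 \<notin> Poly_Mapping.keys \<mu> \<and>
     (\<Sum>j\<in>Poly_Mapping.keys \<mu>. Poly_Mapping.lookup \<mu> j) = n}"

type_synonym weighted_partition = "(nat set \<times> (nat \<Rightarrow>\<^sub>0 nat)) set"

definition weighted_partitions :: "nat \<Rightarrow> nat \<Rightarrow> weighted_partition set" where
  "weighted_partitions n k =
     {\<alpha>. partition_on {1..n} (fst ` \<alpha>) \<and> inj_on fst \<alpha> \<and>
        (\<forall>(B, \<mu>)\<in>\<alpha>. \<mu> \<in> WComp (card B - 1) \<and> Poly_Mapping.keys \<mu> \<subseteq> {1..k})}"

definition merge_step :: "nat \<Rightarrow> weighted_partition rel" where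
  "merge_step k =
     {(\<alpha>, \<beta>). \<exists>A a B b. \<exists>r\<in>{1..k}. (A, a) \<in> \<alpha> \<and> (B, b) \<in> \<alpha> \<and> A \<noteq> B \<and>
        \<beta> = insert (A \<union> B, a + b + Poly_Mapping.single r 1) (\<alpha> - {(A, a), (B, b)})}"

definition weighted_partition_poset :: "nat \<Rightarrow> nat \<Rightarrow> weighted_partition rel" where
  "weighted_partition_poset n k =
     (Restr (merge_step k) (weighted_partitions n k))\<^sup>* \<inter>
     weighted_partitions n k \<times> weighted_partitions n k"

definition bottom_partition :: "nat \<Rightarrow> weighted_partition" where
  "bottom_partition n = (\<lambda>i. ({i}, 0)) ` {1..n}"

definition one_block :: "nat \<Rightarrow> (nat \<Rightarrow>\<^sub>0 nat) \<Rightarrow> weighted_partition" where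
  "one_block n \<mu> = {({1..n}, \<mu>)}"

end

(*
  Label the merge of two blocks with minima a < b in colour u by (a, b, u). In every interval
  the atoms have a least label; its label increases along the chain of successive least
  choices, and an increasing chain can only start with the least choice. So this chain is the
  unique increasing one and is lexicographically first, which gives the EL-labeling (with
  label (1, n+1, 1) on the edges into the new top).

  Listing the maximal chains lexicographically, a chain is new exactly in the faces containing
  its descents. These Boolean intervals [R, F] partition the order complex. Intervals with
  R different from F are collapsible, so only the m facets with R = F matter: up to homotopy
  they are attached to a cone over their boundaries, and pushing this cone to its apex yields
  a wedge of m boundaries of simplices. Attaching a d-dimensional facet along its boundary
  changes homology only from degree d - 1 on, by excision at the barycenter. Both apply to all
  links, because links of such complexes are of the same kind; the open interval below [n]^mu
  is the link of the chain formed by the bottom, [n]^mu and the new top.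
*)
theory Submission
  imports Defs
begin

section \<open>Simplicial complexes and their realizations\<close>

text \<open>The colours force the label order to be partial. If (a, b, u) were compared
  lexicographically, both (1,2,1), (1,3,2) and (1,2,2), (1,3,1) would increase on the way from the
  bottom to the block {1,2,3} with weight e_1 + e_2. Comparing b and u componentwise for equal a
  excludes the second chain. It still leaves a least label in every interval, because the colours
  open to a block depend only on the block of the upper element around it, not on the partner b.
  Inside an interval a merge never opens a new label and never leaves its own label open; this is
  why greedy labels keep increasing. Conversely, a non-least first merge leaves behind the pair of
  minima or the colour of the least label, and so a later label that is not larger. On the
  topological side there are no quotient or pasting arguments beyond the wedge itself. A realization
  is a set of barycentric coordinate functions with the pointwise topology, each map is one formula
  valid on the whole complex, and continuity is checked coordinate by coordinate. The price is a few
  explicit functions, such as \<open>slope\<close> and \<open>core\<close>, whose shape is dictated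
  by their boundary values.\<close>

abbreviation nz :: "('a \<Rightarrow> real) \<Rightarrow> 'a set" where
  "nz f \<equiv> {v. f v \<noteq> 0}"

definition simplicial :: "'a set set \<Rightarrow> bool" where
  "simplicial K \<longleftrightarrow> (\<forall>s\<in>K. finite s \<and> Pow s \<subseteq> K)"

definition points :: "'a set set \<Rightarrow> ('a \<Rightarrow> real) set" where
  "points K = {f. (\<forall>v. 0 \<le> f v) \<and> nz f \<in> K \<and> (\<Sum>v\<in>nz f. f v) = 1}"

abbreviation function_space :: "('a \<Rightarrow> real) set \<Rightarrow> ('a \<Rightarrow> real) topology" where
  "function_space P \<equiv> subtopology (powertop_real UNIV) P"

lemma geometric_realization_points: "geometric_realization K = function_space (points K)"
  by (simp add: geometric_realization_def points_def)

lemma simplicialD: "simplicial K \<Longrightarrow> s \<in> K \<Longrightarrow> t \<subseteq> s \<Longrightarrow> t \<in> K"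
  by (auto simp: simplicial_def)

lemma simplicial_finite: "simplicial K \<Longrightarrow> s \<in> K \<Longrightarrow> finite s"
  by (auto simp: simplicial_def)

text \<open>A sum over an infinite set is 0 by convention, so total weight 1 forces finite support,
  whatever \<open>K\<close> is.\<close>

lemma finite_nz: "f \<in> points K \<Longrightarrow> finite (nz f)"
  unfolding points_def using sum.infinite by fastforce

lemma points_nonneg: "f \<in> points K \<Longrightarrow> 0 \<le> f v"
  by (simp add: points_def)

lemma points_nz: "f \<in> points K \<Longrightarrow> nz f \<in> K"
  by (simp add: points_def)

lemma sum_nz:
  fixes f :: "'a \<Rightarrow> real"
  assumes "finite V" "nz f \<subseteq> V"
  shows "(\<Sum>v\<in>nz f. f v) = sum f V"
  using assms by (intro sum.mono_neutral_left) auto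

lemma points_sum: "f \<in> points K \<Longrightarrow> finite V \<Longrightarrow> nz f \<subseteq> V \<Longrightarrow> sum f V = 1"
  using sum_nz[of V f] by (simp add: points_def)

text \<open>The face \<open>s\<close> may be larger than the support: along a homotopy coordinates
  can vanish, and a common face is usually all that is known.\<close>

lemma pointsI:
  assumes "\<And>v. 0 \<le> f v" "nz f \<subseteq> s" "s \<in> K" "simplicial K" "sum f s = 1"
  shows "f \<in> points K"
proof -
  have "finite s" using assms simplicial_finite by blast
  then have "(\<Sum>v\<in>nz f. f v) = 1" using assms sum_nz by metis
  then show ?thesis unfolding points_def using assms simplicialD by blast
qed

lemma points_mono: "K \<subseteq> L \<Longrightarrow> points K \<subseteq> points L"
  by (auto simp: points_def)

lemma points_le_1: assumes "f \<in> points K" shows "f v \<le> 1"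
proof (cases "f v = 0")
  case False
  then have "f v \<le> (\<Sum>v\<in>nz f. f v)"
    using assms finite_nz[OF assms] by (intro member_le_sum) (auto simp: points_def)
  then show ?thesis using assms by (simp add: points_def)
qed simp

text \<open>A closed simplex is convex; a common face \<open>s\<close> of the two end points keeps
  the segment between them inside the realization.\<close>

lemma points_convex:
  assumes f: "f \<in> points K" and g: "g \<in> points K" and K: "simplicial K"
    and s: "s \<in> K" "nz f \<subseteq> s" "nz g \<subseteq> s" and t: "0 \<le> t" "t \<le> 1"
  shows "(\<lambda>v. (1 - t) * f v + t * g v) \<in> points K"
proof (rule pointsI[OF _ _ s(1) K])
  have "finite s" using K s simplicial_finite by blast
  then have "sum f s = 1" "sum g s = 1" using points_sum f g s by blast+
  then show "(\<Sum>v\<in>s. (1 - t) * f v + t * g v) = 1"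
    by (simp add: sum.distrib flip: sum_distrib_left)
  show "nz (\<lambda>v. (1 - t) * f v + t * g v) \<subseteq> s"
  proof (rule subsetI, rule ccontr)
    fix v assume v: "v \<in> nz (\<lambda>v. (1 - t) * f v + t * g v)" "v \<notin> s"
    then have "f v = 0" "g v = 0" using s by blast+
    then show False using v by simp
  qed
qed (use t points_nonneg[OF f] points_nonneg[OF g] in simp)

section \<open>Continuity by coordinates and straight-line homotopies\<close>

lemma continuous_map_function_space:
  "continuous_map X (function_space P) f \<longleftrightarrow>
     (\<forall>v. continuous_map X euclideanreal (\<lambda>x. f x v)) \<and> (\<forall>x\<in>topspace X. f x \<in> P)"
  by (auto simp: continuous_map_in_subtopology continuous_map_componentwise_UNIV)

lemma continuous_map_coordinate:
  "continuous_map (function_space P) euclideanreal (\<lambda>f. f v)"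
  by (blast intro: continuous_map_from_subtopology[OF continuous_map_product_projection])

text \<open>In the topology of pointwise convergence, joint continuity in time and point is checked
  one coordinate at a time. What each use has to supply is that the segments do not leave
  \<open>P\<close>.\<close>

lemma linear_homotopy:
  assumes f: "continuous_map X (function_space P) f" and g: "continuous_map X (function_space P) g"
    and P: "\<And>x t. x \<in> topspace X \<Longrightarrow> 0 \<le> t \<Longrightarrow> t \<le> 1 \<Longrightarrow> (\<lambda>v. (1 - t) * f x v + t * g x v) \<in> P"
  shows "homotopic_with (\<lambda>_. True) X (function_space P) f g"
proof -
  let ?I = "prod_topology (top_of_set {0..1::real}) X"
  let ?h = "\<lambda>(t, x) v. (1 - t) * f x v + t * g x v"
  have "continuous_map ?I (function_space P) ?h"
  proof -
    have "continuous_map ?I X snd" by (simp add: continuous_map_snd)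
    then have c: "continuous_map ?I euclideanreal (\<lambda>z. f (snd z) v)"
        "continuous_map ?I euclideanreal (\<lambda>z. g (snd z) v)" for v
      using f g continuous_map_compose[OF \<open>continuous_map ?I X snd\<close>, of euclideanreal "\<lambda>x. f x v"]
        continuous_map_compose[OF \<open>continuous_map ?I X snd\<close>, of euclideanreal "\<lambda>x. g x v"]
      unfolding continuous_map_function_space o_def by auto
    have "continuous_map ?I (top_of_set {0..1::real}) fst" by (simp add: continuous_map_fst)
    then have t: "continuous_map ?I euclideanreal fst"
      using continuous_map_in_subtopology by blast
    show ?thesis
      unfolding continuous_map_function_space case_prod_unfold
      by (intro conjI allI ballI continuous_intros c t) (auto simp: P)
  qed
  then show ?thesis
    unfolding homotopic_with_def by (intro exI[of _ ?h]) auto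
qed

lemma continuous_map_real_Min:
  assumes "finite R" "R \<noteq> {}" "\<And>v. v \<in> R \<Longrightarrow> continuous_map X euclideanreal (\<lambda>x. f x v)"
  shows "continuous_map X euclideanreal (\<lambda>x. Min (f x ` R))"
  using assms
proof (induction R rule: finite_ne_induct)
  case (singleton a)
  then show ?case by simp
next
  case (insert a R)
  then have "continuous_map X euclideanreal (\<lambda>x. min (f x a) (Min (f x ` R)))"
    by (intro continuous_map_real_min) auto
  moreover have "(\<lambda>x. Min (f x ` insert a R)) = (\<lambda>x. min (f x a) (Min (f x ` R)))"
    using insert by (auto simp: fun_eq_iff)
  ultimately show ?case by simp
qed

text \<open>A deformation retraction whose homotopy is the straight line between \<open>r f\<close>
  and \<open>f\<close>; only these lines have to stay in \<open>P\<close>.\<close>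

lemma retract_homotopy_equivalent:
  assumes QP: "Q \<subseteq> P" and r: "continuous_map (function_space P) (function_space Q) r"
    and fixed: "\<And>f. f \<in> Q \<Longrightarrow> r f = f"
    and line: "\<And>f t. f \<in> P \<Longrightarrow> 0 \<le> t \<Longrightarrow> t \<le> 1 \<Longrightarrow> (\<lambda>v. (1 - t) * r f v + t * f v) \<in> P"
  shows "function_space P homotopy_equivalent_space function_space Q"
proof -
  have i: "continuous_map (function_space Q) (function_space P) id"
    unfolding continuous_map_function_space using QP by (auto simp: continuous_map_coordinate)
  have "homotopic_with (\<lambda>_. True) (function_space P) (function_space P) (id \<circ> r) id"
  proof (rule linear_homotopy)
    show "continuous_map (function_space P) (function_space P) (id \<circ> r)"
      using continuous_map_compose[OF r i] .
  qed (auto simp: line)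
  moreover have "homotopic_with (\<lambda>_. True) (function_space Q) (function_space Q) (r \<circ> id) id"
    by (rule homotopic_with_equal) (use continuous_map_compose[OF i r] fixed in auto)
  ultimately show ?thesis
    unfolding homotopy_equivalent_space_def using r i by blast
qed

text \<open>
  The deformation moves the weight common to all vertices of \<open>R\<close> to a vertex of \<open>F - R\<close>.
\<close>

lemma collapse_homotopy_equivalent:
  fixes K :: "'a set set" and R F :: "'a set"
  assumes K: "simplicial K" and KI: "simplicial (K \<union> {s. R \<subseteq> s \<and> s \<subseteq> F})"
    and disj: "R \<notin> K" and R: "R \<noteq> {}" "R \<subset> F"
  shows "geometric_realization (K \<union> {s. R \<subseteq> s \<and> s \<subseteq> F})
    homotopy_equivalent_space geometric_realization K"
proof -
  let ?L = "K \<union> {s. R \<subseteq> s \<and> s \<subseteq> F}"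
  have FL: "F \<in> ?L" using R by auto
  have finF: "finite F" using FL KI simplicial_finite by blast
  then have finR: "finite R" using R finite_subset by blast
  obtain x where x: "x \<in> F" "x \<notin> R" using R by auto
  define m where "m f = Min (f ` R)" for f :: "'a \<Rightarrow> real"
  define r where "r f v = f v - (if v \<in> R then m f else 0) + (if v = x then card R * m f else 0)"
    for f :: "'a \<Rightarrow> real" and v
  have m0: "m f = 0" if f: "f \<in> points ?L" and "\<not> R \<subseteq> nz f" for f
  proof -
    obtain v where v: "v \<in> R" "f v = 0" using \<open>\<not> R \<subseteq> nz f\<close> by auto
    have "m f \<in> f ` R" "m f \<le> f v" unfolding m_def using finR R v by (auto intro: Min_in Min_le)
    then show ?thesis using points_nonneg[OF f] v by (metis (no_types) imageE order_antisym)
  qed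
  have r0: "r f = f" if "m f = 0" for f using that by (simp add: r_def fun_eq_iff)
  \<comment> \<open>\<open>R\<close> is no face of the simplicial complex \<open>K\<close>, so a
    support containing \<open>R\<close> can only be a face of the new interval.\<close>
  have inF: "nz f \<subseteq> F" if "f \<in> points ?L" "R \<subseteq> nz f" for f
    using points_nz[OF that(1)] that(2) disj simplicialD[OF K] by auto
  have key: "r f \<in> points ?L \<and> nz (r f) \<subseteq> F \<and> \<not> R \<subseteq> nz (r f)" if f: "f \<in> points ?L" and Rf: "R \<subseteq> nz f" for f
  proof -
    have "m f \<in> f ` R" unfolding m_def using finR R by auto
    then obtain w where w: "w \<in> R" "f w = m f" by auto
    have mle: "m f \<le> f v" if "v \<in> R" for v unfolding m_def using finR that by auto
    have m_nonneg: "0 \<le> m f" using w points_nonneg[OF f] by metis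
    have nzF: "nz (r f) \<subseteq> F" using inF[OF f Rf] x R by (auto simp: r_def split: if_splits)
    have "sum (r f) F = 1"
    proof -
      have "sum (r f) F = sum f F - (\<Sum>v\<in>F. if v \<in> R then m f else 0) + (\<Sum>v\<in>F. if v = x then card R * m f else 0)"
        unfolding r_def by (simp add: sum.distrib sum_subtractf)
      also have "(\<Sum>v\<in>F. if v \<in> R then m f else 0) = card R * m f"
      proof -
        have "F \<inter> R = R" using R by auto
        then show ?thesis using finF by (simp add: sum.If_cases)
      qed
      finally show ?thesis using points_sum[OF f finF inF[OF f Rf]] finF x by simp
    qed
    then have "r f \<in> points ?L"
      using points_nonneg[OF f] mle m_nonneg by (intro pointsI[OF _ nzF FL KI]) (auto simp: r_def)
    \<comment> \<open>The vertex \<open>w\<close> of \<open>R\<close> at which the minimum is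
      attained loses all its weight. The new support therefore misses part of \<open>R\<close> and
      is a face of \<open>K\<close>.\<close>
    moreover have "r f w = 0" using w x by (auto simp: r_def)
    ultimately show ?thesis using nzF w by blast
  qed
  have rK: "r f \<in> points K" if f: "f \<in> points ?L" for f
  proof (cases "R \<subseteq> nz f")
    case True
    from key[OF f this] show ?thesis by (auto simp: points_def)
  next
    case False
    then show ?thesis using r0[OF m0[OF f False]] f by (auto simp: points_def)
  qed
  show ?thesis unfolding geometric_realization_points
  proof (rule retract_homotopy_equivalent[where r = r])
    show "continuous_map (function_space (points ?L)) (function_space (points K)) r"
      unfolding continuous_map_function_space
    proof (intro conjI allI ballI)
      fix v
      have "continuous_map (function_space (points ?L)) euclideanreal m"
        unfolding m_def using finR R by (intro continuous_map_real_Min continuous_map_coordinate)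
      then show "continuous_map (function_space (points ?L)) euclideanreal (\<lambda>f. r f v)"
        unfolding r_def by (cases "v \<in> R"; cases "v = x"; simp)
          (intro continuous_intros continuous_map_coordinate; simp)+
    qed (simp add: rK)
    show "r f = f" if "f \<in> points K" for f
    proof -
      have "f \<in> points ?L" using that points_mono by blast
      moreover have "\<not> R \<subseteq> nz f" using that disj simplicialD[OF K points_nz] by blast
      ultimately show ?thesis using m0 r0 by blast
    qed
    show "(\<lambda>v. (1 - t) * r f v + t * f v) \<in> points ?L"
      if f: "f \<in> points ?L" and t: "0 \<le> t" "t \<le> 1" for f t
    proof (cases "R \<subseteq> nz f")
      case True
      then show ?thesis using points_convex[OF _ f KI FL _ inF t] key[OF f] f by blast
    next
      case False
      then show ?thesis using r0[OF m0[OF f False]] f by (simp add: algebra_simps)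
    qed
  qed (simp add: points_mono)
qed

text \<open>The map of realizations induced by a vertex map: weights over each fibre of
  \<open>h\<close> add up. The finite vertex set \<open>V\<close> keeps these sums finite even if
  \<open>h\<close> has infinite fibres.\<close>

definition push :: "'a set \<Rightarrow> ('a \<Rightarrow> 'b) \<Rightarrow> ('a \<Rightarrow> real) \<Rightarrow> 'b \<Rightarrow> real" where
  "push V h f w = (\<Sum>v\<in>{v\<in>V. h v = w}. f v)"

lemma push_inj: "finite V \<Longrightarrow> inj_on h V \<Longrightarrow> v \<in> V \<Longrightarrow> push V h f (h v) = f v"
proof -
  assume a: "finite V" "inj_on h V" "v \<in> V"
  then have "{u \<in> V. h u = h v} = {v}" by (auto dest: inj_onD)
  then show ?thesis by (simp add: push_def)
qed

lemma push_outside: "w \<notin> h ` V \<Longrightarrow> push V h f w = 0"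
  unfolding push_def by (intro sum.neutral) auto

text \<open>Nonnegative weights cannot cancel, so the support of the image is exactly the image of
  the support.\<close>

lemma push_points:
  assumes V: "finite V" "K \<subseteq> Pow V" and hK: "\<And>s. s \<in> K \<Longrightarrow> h ` s \<in> L" and f: "f \<in> points K"
  shows "push V h f \<in> points L" "nz (push V h f) = h ` nz f"
proof -
  have sub: "nz f \<subseteq> V" using points_nz[OF f] V by auto
  have nn: "0 \<le> push V h f w" for w unfolding push_def using points_nonneg[OF f] by (simp add: sum_nonneg)
  show nz: "nz (push V h f) = h ` nz f"
    using V sub points_nonneg[OF f] by (auto simp: push_def sum_nonneg_eq_0_iff)
  have "(\<Sum>w\<in>h ` V. push V h f w) = sum f V"
    unfolding push_def using V by (simp add: sum.group)
  also have "\<dots> = 1" using points_sum[OF f V(1) sub] .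
  finally have "(\<Sum>w\<in>nz (push V h f). push V h f w) = 1"
    using sum_nz[of "h ` V" "push V h f"] V image_mono[OF sub, of h] nz by simp
  then show "push V h f \<in> points L" using nn nz hK[OF points_nz[OF f]] by (simp add: points_def)
qed

lemma continuous_map_push:
  assumes V: "finite V" "K \<subseteq> Pow V" and hK: "\<And>s. s \<in> K \<Longrightarrow> h ` s \<in> L"
  shows "continuous_map (geometric_realization K) (geometric_realization L) (push V h)"
  unfolding geometric_realization_points continuous_map_function_space
proof (intro conjI allI ballI)
  show "continuous_map (function_space (points K)) euclideanreal (\<lambda>f. push V h f w)" for w
    unfolding push_def using V by (intro continuous_map_sum continuous_map_coordinate) auto
qed (use push_points[OF V hK] in simp)

text \<open>Pushing along \<open>h\<close> and along its inverse are mutually inverse. The vertex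
  type may change, which later makes room for a fresh vertex.\<close>

lemma relabel_homotopy_equivalent:
  assumes V: "finite V" "K \<subseteq> Pow V" and inj: "inj_on h V"
  shows "geometric_realization ((`) h ` K) homotopy_equivalent_space geometric_realization K"
proof -
  let ?L = "(`) h ` K" and ?g = "push (h ` V) (inv_into V h)" and ?f = "push V h"
  have f: "continuous_map (geometric_realization K) (geometric_realization ?L) ?f"
    by (rule continuous_map_push[OF V]) auto
  have fg: "inv_into V h ` h ` s = s" if "s \<in> K" for s using that V inv_into_image_cancel[OF inj, of s] by auto
  have g: "continuous_map (geometric_realization ?L) (geometric_realization K) ?g"
    using V fg by (intro continuous_map_push) auto
  have inj': "inj_on (inv_into V h) (h ` V)" by (rule inj_on_inv_into) simp
  have 1: "?g (?f x) = x" if "x \<in> points K" for x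
  proof
    fix v show "?g (?f x) v = x v"
    proof (cases "v \<in> V")
      case True
      then show ?thesis
        using push_inj[OF _ inj', of "h v" "?f x"] push_inj[OF V(1) inj True, of x] V inj by simp
    next
      case False
      then have "v \<notin> inv_into V h ` h ` V" using inj by (auto simp: inv_into_f_f)
      moreover have "x v = 0" using False points_nz[OF that] V by auto
      ultimately show ?thesis using push_outside by metis
    qed
  qed
  have 2: "?f (?g y) = y" if "y \<in> points ?L" for y
  proof
    fix w show "?f (?g y) w = y w"
    proof (cases "w \<in> h ` V")
      case True
      then obtain v where v: "v \<in> V" "w = h v" by auto
      then show ?thesis
        using push_inj[OF _ inj', of "h v" y] push_inj[OF V(1) inj v(1), of "?g y"] V inj by simp
    next
      case False
      moreover have "y w = 0" using False points_nz[OF that] V by blast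
      ultimately show ?thesis using push_outside by metis
    qed
  qed
  show ?thesis unfolding homotopy_equivalent_space_def
  proof (intro exI conjI)
    show "homotopic_with (\<lambda>_. True) (geometric_realization ?L) (geometric_realization ?L) (?f \<circ> ?g) id"
      by (rule homotopic_with_equal) (use continuous_map_compose[OF g f] 2 in \<open>auto simp: geometric_realization_points\<close>)
    show "homotopic_with (\<lambda>_. True) (geometric_realization K) (geometric_realization K) (?g \<circ> ?f) id"
      by (rule homotopic_with_equal) (use continuous_map_compose[OF f g] 1 in \<open>auto simp: geometric_realization_points\<close>)
  qed (fact f g)+
qed

section \<open>Spheres as simplex boundaries\<close>

abbreviation bd :: "'a set \<Rightarrow> 'a set set" where
  "bd F \<equiv> {s. s \<subset> F}"

text \<open>Vectors indexed by 0..d+1 are taken modulo constant vectors and positive scaling. A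
  nonzero class has one representative with last coordinate 0 and norm 1, a point of the sphere, and
  one with minimum 0 and sum 1, a point of the simplex boundary. This map and
  \<open>bd_to_sphere\<close> exchange the two representatives.\<close>

definition sphere_to_bd :: "nat \<Rightarrow> (nat \<Rightarrow> real) \<Rightarrow> nat \<Rightarrow> real" where
  "sphere_to_bd d x i = (if i \<le> Suc d
     then (x i - Min (x ` {..Suc d})) / (\<Sum>l\<le>Suc d. x l - Min (x ` {..Suc d})) else 0)"

definition bd_to_sphere :: "nat \<Rightarrow> (nat \<Rightarrow> real) \<Rightarrow> nat \<Rightarrow> real" where
  "bd_to_sphere d f i = (if i \<le> d
     then (f i - f (Suc d)) / sqrt (\<Sum>l\<le>d. (f l - f (Suc d))\<^sup>2) else 0)"

lemma topspace_nsphere_iff: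
  "x \<in> topspace (nsphere d) \<longleftrightarrow> (\<Sum>i\<le>d. (x i)\<^sup>2) = 1 \<and> (\<forall>i>d. x i = 0)"
  by (simp add: nsphere)

text \<open>If all coordinates equalled their minimum, they would equal the last one, which is 0 on
  the sphere, against norm 1.\<close>

lemma sphere_to_bd_denominator:
  assumes "x \<in> topspace (nsphere d)"
  shows "0 < (\<Sum>l\<le>Suc d. x l - Min (x ` {..Suc d}))"
proof (rule ccontr)
  define m where "m = Min (x ` {..Suc d})"
  have mle: "0 \<le> x l - m" if "l \<in> {..Suc d}" for l using that by (simp add: m_def)
  assume "\<not> ?thesis"
  then have "(\<Sum>l\<le>Suc d. x l - m) \<le> 0" unfolding m_def by (simp only: not_less)
  moreover have "0 \<le> (\<Sum>l\<le>Suc d. x l - m)" using mle by (rule sum_nonneg)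
  ultimately have "(\<Sum>l\<le>Suc d. x l - m) = 0" by (rule antisym)
  then have "x l - m = 0" if "l \<in> {..Suc d}" for l
    using sum_nonneg_0[of "{..Suc d}" "\<lambda>l. x l - m" l] mle that by (simp only: finite_atMost)
  note eq = this
  from eq[of "Suc d"] have "x l = x (Suc d)" if "l \<le> Suc d" for l using that eq[of l] by simp
  note eq = this
  have "x (Suc d) = 0" using assms by (simp add: topspace_nsphere_iff)
  then have "x l = 0" if "l \<le> d" for l using eq[of l] that by simp
  then show False using assms by (simp add: topspace_nsphere_iff)
qed

lemma sphere_to_bd_points:
  assumes x: "x \<in> topspace (nsphere d)"
  shows "sphere_to_bd d x \<in> points (bd {..Suc d})"
proof -
  let ?m = "Min (x ` {..Suc d})" and ?S = "\<Sum>l\<le>Suc d. x l - Min (x ` {..Suc d})"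
  have S: "0 < ?S" by (rule sphere_to_bd_denominator[OF x])
  have mle: "?m \<le> x l" if "l \<le> Suc d" for l using that by simp
  have "?m \<in> x ` {..Suc d}" by (intro Min_in) auto
  then obtain w where w: "w \<le> Suc d" "x w = ?m" by (metis atMost_iff imageE)
  have sub: "nz (sphere_to_bd d x) \<subseteq> {..Suc d} - {w}" using w by (auto simp: sphere_to_bd_def)
  have "sum (sphere_to_bd d x) {..Suc d} = (\<Sum>i\<le>Suc d. (x i - ?m) / ?S)"
    by (intro sum.cong) (simp_all add: sphere_to_bd_def)
  also have "\<dots> = 1" using S by (simp only: sum_divide_distrib[symmetric]) simp
  finally have "(\<Sum>i\<in>nz (sphere_to_bd d x). sphere_to_bd d x i) = 1"
    using sum_nz[of "{..Suc d}" "sphere_to_bd d x"] sub by auto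
  moreover have "0 \<le> sphere_to_bd d x v" for v
    using mle S unfolding sphere_to_bd_def by (auto intro!: divide_nonneg_pos)
  ultimately show ?thesis using sub w by (auto simp: points_def)
qed

text \<open>Otherwise \<open>f\<close> would be constant on the vertices; a boundary point has a
  zero coordinate, so \<open>f\<close> would vanish, against total weight 1.\<close>

lemma bd_to_sphere_denominator:
  assumes f: "f \<in> points (bd {..Suc d})"
  shows "0 < (\<Sum>l\<le>d. (f l - f (Suc d))\<^sup>2)"
proof (rule ccontr)
  assume "\<not> ?thesis"
  moreover have "0 \<le> (\<Sum>l\<le>d. (f l - f (Suc d))\<^sup>2)" by (intro sum_nonneg) simp
  ultimately have "(\<Sum>l\<le>d. (f l - f (Suc d))\<^sup>2) = 0" by linarith
  then have "\<forall>l\<in>{..d}. (f l - f (Suc d))\<^sup>2 = 0" by (subst (asm) sum_nonneg_eq_0_iff) auto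
  then have eq: "f l = f (Suc d)" if "l \<le> Suc d" for l using that by (cases "l = Suc d") auto
  have nz: "nz f \<subset> {..Suc d}" using points_nz[OF f] by simp
  then obtain w where "w \<le> Suc d" "f w = 0" by auto
  then have "f l = 0" if "l \<le> Suc d" for l using eq that by metis
  then show False using points_sum[OF f _ psubset_imp_subset[OF nz]] by simp
qed

lemma bd_to_sphere_in:
  assumes f: "f \<in> points (bd {..Suc d})"
  shows "bd_to_sphere d f \<in> topspace (nsphere d)"
proof -
  let ?N = "\<Sum>l\<le>d. (f l - f (Suc d))\<^sup>2"
  have N: "0 < ?N" by (rule bd_to_sphere_denominator[OF f])
  have "(\<Sum>i\<le>d. (bd_to_sphere d f i)\<^sup>2) = (\<Sum>i\<le>d. (f i - f (Suc d))\<^sup>2 / ?N)"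
    using N by (intro sum.cong) (simp_all add: bd_to_sphere_def power_divide less_imp_le)
  also have "\<dots> = 1" using N by (simp only: sum_divide_distrib[symmetric]) simp
  finally show ?thesis by (simp add: topspace_nsphere_iff bd_to_sphere_def)
qed

text \<open>Subtracting the last coordinate cancels the subtracted minimum, so only the scaling by
  \<open>?S\<close> is left, and the normalization removes it.\<close>

lemma sphere_to_bd_to_sphere:
  assumes x: "x \<in> topspace (nsphere d)"
  shows "bd_to_sphere d (sphere_to_bd d x) = x"
proof
  fix i
  let ?S = "\<Sum>l\<le>Suc d. x l - Min (x ` {..Suc d})"
  have S: "0 < ?S" by (rule sphere_to_bd_denominator[OF x])
  have x0: "x l = 0" if "d < l" for l using x that by (simp add: topspace_nsphere_iff)
  have d: "sphere_to_bd d x l - sphere_to_bd d x (Suc d) = x l / ?S" if "l \<le> d" for l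
  proof -
    define m S where "m = Min (x ` {..Suc d})" and "S = (\<Sum>l\<le>Suc d. x l - m)"
    have "(x l - m) / S - (0 - m) / S = x l / S" by (simp add: diff_divide_distrib)
    then show ?thesis using that x0[of "Suc d"] unfolding sphere_to_bd_def m_def[symmetric] S_def[symmetric] by simp
  qed
  then have "(\<Sum>l\<le>d. (sphere_to_bd d x l - sphere_to_bd d x (Suc d))\<^sup>2) = (\<Sum>l\<le>d. (x l)\<^sup>2 / ?S\<^sup>2)"
    by (intro sum.cong) (simp_all add: power_divide)
  also have "\<dots> = 1 / ?S\<^sup>2" using x by (simp only: sum_divide_distrib[symmetric] topspace_nsphere_iff)
  finally have "sqrt (\<Sum>l\<le>d. (sphere_to_bd d x l - sphere_to_bd d x (Suc d))\<^sup>2) = 1 / ?S"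
    using S by (simp add: real_sqrt_divide)
  then show "bd_to_sphere d (sphere_to_bd d x) i = x i"
    using d[of i] S x0[of i] unfolding bd_to_sphere_def by (cases "i \<le> d") simp_all
qed

lemma bd_to_sphere_to_bd:
  assumes f: "f \<in> points (bd {..Suc d})"
  shows "sphere_to_bd d (bd_to_sphere d f) = f"
proof
  fix i
  define N where "N = sqrt (\<Sum>l\<le>d. (f l - f (Suc d))\<^sup>2)"
  define x where "x = bd_to_sphere d f"
  have N: "0 < N" using bd_to_sphere_denominator[OF f] by (simp add: N_def)
  have x: "x l = (f l - f (Suc d)) / N" if "l \<le> Suc d" for l
    using that by (cases "l = Suc d") (auto simp: x_def bd_to_sphere_def N_def)
  have nz: "nz f \<subset> {..Suc d}" using points_nz[OF f] by simp
  then obtain w where w: "w \<le> Suc d" "f w = 0" by auto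
  \<comment> \<open>The minimum is attained at the vertex \<open>w\<close> where \<open>f\<close>
    vanishes, so subtracting it undoes the shift by the last coordinate.\<close>
  have min: "Min (x ` {..Suc d}) = - f (Suc d) / N"
  proof (rule Min_eqI)
    show "- f (Suc d) / N \<in> x ` {..Suc d}" using w x[OF w(1)] by (auto intro!: image_eqI[of _ _ w])
    show "- f (Suc d) / N \<le> y" if y: "y \<in> x ` {..Suc d}" for y
    proof -
      from y obtain l where l: "l \<le> Suc d" "y = x l" by auto
      show ?thesis unfolding l(2) x[OF l(1)] using N points_nonneg[OF f, of l]
        by (intro divide_right_mono) auto
    qed
  qed simp
  then have d: "x l - Min (x ` {..Suc d}) = f l / N" if "l \<le> Suc d" for l
    using x[OF that] by (simp add: diff_divide_distrib)
  have "(\<Sum>l\<le>Suc d. x l - Min (x ` {..Suc d})) = (\<Sum>l\<le>Suc d. f l / N)"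
    using d by (intro sum.cong) auto
  also have "\<dots> = 1 / N"
    using points_sum[OF f _ psubset_imp_subset[OF nz]] by (simp only: sum_divide_distrib[symmetric] finite_atMost)
  finally have S: "(\<Sum>l\<le>Suc d. x l - Min (x ` {..Suc d})) = 1 / N" .
  show "sphere_to_bd d (bd_to_sphere d f) i = f i"
    unfolding sphere_to_bd_def x_def[symmetric] S
    using d[of i] N nz by (cases "i \<le> Suc d") auto
qed

lemma homeomorphic_maps_sphere_bd:
  "homeomorphic_maps (nsphere d) (geometric_realization (bd {..Suc d})) (sphere_to_bd d) (bd_to_sphere d)"
  unfolding homeomorphic_maps_def
proof (intro conjI ballI)
  show "continuous_map (nsphere d) (geometric_realization (bd {..Suc d})) (sphere_to_bd d)"
    unfolding geometric_realization_points continuous_map_function_space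
  proof (intro conjI allI ballI)
    fix i
    have m: "continuous_map (nsphere d) euclideanreal (\<lambda>x. Min (x ` {..Suc d}))"
      by (intro continuous_map_real_Min continuous_map_nsphere_projection) auto
    have "continuous_map (nsphere d) euclideanreal
      (\<lambda>x. (x i - Min (x ` {..Suc d})) / (\<Sum>l\<le>Suc d. x l - Min (x ` {..Suc d})))"
      using sphere_to_bd_denominator[of _ d] unfolding less_le
      by (intro continuous_map_real_divide continuous_map_diff continuous_map_sum m
          continuous_map_nsphere_projection) (auto simp del: sum.atMost_Suc)
    then show "continuous_map (nsphere d) euclideanreal (\<lambda>x. sphere_to_bd d x i)"
      unfolding sphere_to_bd_def by (cases "i \<le> Suc d") simp_all
  qed (use sphere_to_bd_points in blast)
  have "continuous_map (geometric_realization (bd {..Suc d})) euclideanreal (\<lambda>f. bd_to_sphere d f i)" for i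
  proof (cases "i \<le> d")
    case True
    have "continuous_map (geometric_realization (bd {..Suc d})) euclideanreal
      (\<lambda>f. (f i - f (Suc d)) / sqrt (\<Sum>l\<le>d. (f l - f (Suc d))\<^sup>2))"
      unfolding geometric_realization_points
      using bd_to_sphere_denominator[of _ d] unfolding less_le
      by (intro continuous_map_real_divide continuous_map_diff continuous_map_sum continuous_map_sqrt
          continuous_map_real_pow continuous_map_coordinate) auto
    then show ?thesis using True by (simp add: bd_to_sphere_def)
  qed (simp add: bd_to_sphere_def)
  then show "continuous_map (geometric_realization (bd {..Suc d})) (nsphere d) (bd_to_sphere d)"
    using bd_to_sphere_in
    unfolding nsphere geometric_realization_points continuous_map_function_space by simp
qed (simp_all add: sphere_to_bd_to_sphere bd_to_sphere_to_bd geometric_realization_points)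

text \<open>A closed subset of a product of compact intervals. Compactness is what later turns a
  continuous bijection from the wedge into a homeomorphism.\<close>

lemma compact_space_nsphere: "compact_space (nsphere d)"
proof -
  let ?B = "\<lambda>i. if i \<le> d then {-1..1::real} else {0}"
  have "compactin (powertop_real UNIV) (PiE UNIV ?B)"
    by (subst compactin_PiE) auto
  moreover have "closedin (powertop_real UNIV) {x \<in> topspace (powertop_real UNIV). (\<Sum>i\<le>d. (x i)\<^sup>2) \<in> {1}}"
    by (intro closedin_continuous_map_preimage[where Y = euclideanreal] continuous_map_sum
        continuous_map_real_pow continuous_map_product_projection) auto
  ultimately have "compactin (powertop_real UNIV) (PiE UNIV ?B \<inter> {x. (\<Sum>i\<le>d. (x i)\<^sup>2) = 1})"
    using compact_Int_closedin by fastforce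
  also have "PiE UNIV ?B \<inter> {x. (\<Sum>i\<le>d. (x i)\<^sup>2) = 1} = {x. (\<Sum>i\<le>d. (x i)\<^sup>2) = 1 \<and> (\<forall>i>d. x i = 0)}"
  proof -
    have "\<bar>x i\<bar> \<le> 1" if "(\<Sum>i\<le>d. (x i)\<^sup>2) = 1" "i \<le> d" for x :: "nat \<Rightarrow> real" and i
    proof -
      have "(x i)\<^sup>2 \<le> (\<Sum>i\<le>d. (x i)\<^sup>2)" using that(2) by (intro member_le_sum) auto
      then show ?thesis using that(1) by (simp add: abs_square_le_1)
    qed
    then have b: "- 1 \<le> x i \<and> x i \<le> 1" if "(\<Sum>i\<le>d. (x i)\<^sup>2) = 1" "i \<le> d" for x :: "nat \<Rightarrow> real" and i
      using that by (metis abs_le_iff minus_le_iff)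
    show ?thesis
    proof (intro equalityI subsetI)
      fix x :: "nat \<Rightarrow> real"
      assume x: "x \<in> PiE UNIV ?B \<inter> {x. (\<Sum>i\<le>d. (x i)\<^sup>2) = 1}"
      have "x i = 0" if "i > d" for i
        using x that PiE_mem[of x UNIV ?B i] by simp
      then show "x \<in> {x. (\<Sum>i\<le>d. (x i)\<^sup>2) = 1 \<and> (\<forall>i>d. x i = 0)}" using x by blast
    qed (use b in \<open>auto simp: PiE_iff\<close>)
  qed
  finally show ?thesis unfolding nsphere by (rule compact_space_subtopology)
qed

lemma Hausdorff_geometric_realization: "Hausdorff_space (geometric_realization K)"
  unfolding geometric_realization_points
  by (rule Hausdorff_space_subtopology) (metis Hausdorff_space_euclidean Hausdorff_space_product_topology)

subsection \<open>Wedges of spheres\<close>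

text \<open>The base point is \<open>None\<close>, and petal j is the boundary of the simplex on
  \<open>None\<close> and the d+1 vertices \<open>Some (j, i)\<close>. The first part supplies the
  base point when m = 0.\<close>

definition wedge_complex :: "nat \<Rightarrow> nat \<Rightarrow> (nat \<times> nat) option set set" where
  "wedge_complex d m = {s. s \<subseteq> {None}} \<union>
     {s. \<exists>j<m. s \<subset> insert None (Some ` ({j} \<times> {1..Suc d}))}"

text \<open>Vertex 0 becomes the base point because \<open>sphere_to_bd\<close> sends the base point
  (1,0,...,0) of the sphere to that vertex.\<close>

abbreviation petal :: "nat \<Rightarrow> nat \<Rightarrow> (nat \<times> nat) option" where
  "petal j i \<equiv> (if i = 0 then None else Some (j, i))"

lemma inj_petal: "inj_on (petal j) A"
  by (auto simp: inj_on_def split: if_splits)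

lemma petal_image: "petal j ` {..Suc d} = insert None (Some ` ({j} \<times> {1..Suc d}))"
proof
  show "petal j ` {..Suc d} \<subseteq> insert None (Some ` ({j} \<times> {1..Suc d}))"
    by (rule image_subsetI) simp
  show "insert None (Some ` ({j} \<times> {1..Suc d})) \<subseteq> petal j ` {..Suc d}"
  proof
    fix w assume "w \<in> insert None (Some ` ({j} \<times> {1..Suc d}))"
    then consider "w = None" | i where "i \<in> {1..Suc d}" "w = Some (j, i)" by auto
    then show "w \<in> petal j ` {..Suc d}"
    proof cases
      case 1
      then show ?thesis by (intro image_eqI[of _ _ 0]) simp_all
    next
      case (2 i)
      then show ?thesis by (intro image_eqI[of _ _ i]) simp_all
    qed
  qed
qed

lemma petal_bd:
  assumes "j < m" "s \<in> bd {..Suc d}"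
  shows "petal j ` s \<in> wedge_complex d m"
proof -
  have "petal j ` s \<subset> petal j ` {..Suc d}"
    using assms(2) by (intro image_strict_mono[OF inj_petal]) simp
  then have "petal j ` s \<subset> insert None (Some ` ({j} \<times> {1..Suc d}))" by (simp only: petal_image)
  then show ?thesis using assms(1) unfolding wedge_complex_def by (intro UnI2 CollectI exI[of _ j] conjI)
qed

lemma topspace_wedge_topology:
  "topspace (wedge_topology I X p) = insert None (\<Union>i\<in>I. wedge_inclusion p i ` topspace (X i))"
    (is "topspace ?W = ?S")
proof
  show "topspace ?W \<subseteq> ?S"
    using openin_topspace[of ?W] unfolding openin_wedge_topology by blast
  have "{x \<in> topspace (X i). wedge_inclusion p i x \<in> ?S} = topspace (X i)" if "i \<in> I" for i
    using that by auto
  then have "openin ?W ?S" unfolding openin_wedge_topology by simp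
  then show "?S \<subseteq> topspace ?W" by (rule openin_subset)
qed

lemma continuous_map_wedge_inclusion:
  assumes "i \<in> I"
  shows "continuous_map (X i) (wedge_topology I X p) (wedge_inclusion p i)"
  unfolding continuous_map_def
proof (intro conjI allI impI)
  show "wedge_inclusion p i \<in> topspace (X i) \<rightarrow> topspace (wedge_topology I X p)"
    using assms by (auto simp: topspace_wedge_topology)
  show "openin (X i) {x \<in> topspace (X i). wedge_inclusion p i x \<in> U}"
    if "openin (wedge_topology I X p) U" for U
    using that[unfolded openin_wedge_topology] assms by (elim conjE bspec)
qed

lemma compact_space_wedge_topology:
  assumes "finite I" "\<And>i. i \<in> I \<Longrightarrow> compact_space (X i)"
  shows "compact_space (wedge_topology I X p)"
proof -
  let ?W = "wedge_topology I X p"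
  have 1: "compactin ?W (wedge_inclusion p i ` topspace (X i))" if "i \<in> I" for i
    using image_compactin[OF _ continuous_map_wedge_inclusion[OF that]] assms(2)[OF that]
    by (simp add: compact_space_def)
  have 2: "compactin ?W {None}" by (simp add: topspace_wedge_topology)
  have "compactin ?W (\<Union>(insert {None} ((\<lambda>i. wedge_inclusion p i ` topspace (X i)) ` I)))"
    using assms(1) 1 2 by (intro compactin_Union) auto
  then show ?thesis by (simp add: compact_space_def topspace_wedge_topology)
qed

text \<open>A continuous bijection from a compact space onto a Hausdorff space, so no inverse has to
  be written down or shown continuous.\<close>

lemma wedge_homeomorphic:
  "wedge_topology {..<m} (\<lambda>_. nsphere d) (\<lambda>_ j. if j = 0 then 1 else 0)
    homeomorphic_space geometric_realization (wedge_complex d m)"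
proof -
  define b :: "nat \<Rightarrow> real" where "b = (\<lambda>j. if j = 0 then 1 else 0)"
  let ?W = "wedge_topology {..<m} (\<lambda>_. nsphere d) (\<lambda>_. b)"
  let ?R = "geometric_realization (wedge_complex d m)"
  let ?V = "{..Suc d}"
  define q where "q j x = push ?V (petal j) (sphere_to_bd d x)" for j x
  define e :: "(nat \<times> nat) option \<Rightarrow> real" where "e = (\<lambda>w. if w = None then 1 else 0)"
  define g where "g z = (case z of None \<Rightarrow> e | Some (j, x) \<Rightarrow> q j x)" for z :: "(nat \<times> (nat \<Rightarrow> real)) option"
  have bS: "b \<in> topspace (nsphere d)" unfolding b_def by (rule in_topspace_nsphere)
  have Min_b: "Min (b ` {..Suc d}) = 0"
    by (rule Min_eqI) (auto simp: b_def intro!: image_eqI[of _ _ "Suc d"])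
  have sum_b: "(\<Sum>l\<le>Suc d. b l) = 1" unfolding b_def by simp
  have sb: "sphere_to_bd d b i = (if i = 0 then 1 else 0)" for i
    unfolding sphere_to_bd_def Min_b using sum_b by (simp add: b_def del: sum.atMost_Suc)
  have q: "q j x (petal j i) = sphere_to_bd d x i" if "i \<le> Suc d" for j x i
    unfolding q_def using that inj_petal by (intro push_inj) auto
  have q0: "q j x w = 0" if "w \<notin> petal j ` ?V" for j x w
    unfolding q_def using that by (rule push_outside)
  have qb: "q j b = e" for j
  proof
    fix w show "q j b w = e w"
    proof (cases "w \<in> petal j ` ?V")
      case True
      then obtain i where "w = petal j i" "i \<in> ?V" by (rule imageE)
      then show ?thesis using q[of i j b] sb by (simp add: e_def)
    next
      case False
      moreover have "w \<noteq> None" using False petal_image by auto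
      ultimately show ?thesis using q0 by (simp add: e_def)
    qed
  qed
  \<comment> \<open>Every \<open>q j\<close> sends the base point to \<open>e\<close>, so on each
    sphere the case distinction in \<open>g\<close> disappears, and continuity of \<open>g\<close>
    reduces to that of the \<open>q j\<close>.\<close>
  have g_incl: "g (wedge_inclusion (\<lambda>_. b) j x) = q j x" for j x
    by (simp add: g_def wedge_inclusion_def qb)
  have cq: "continuous_map (nsphere d) ?R (q j)" if "j < m" for j
  proof -
    have c: "continuous_map (geometric_realization (bd ?V)) ?R (push ?V (petal j))"
      using petal_bd[OF that] by (intro continuous_map_push) auto
    have "continuous_map (nsphere d) (geometric_realization (bd ?V)) (sphere_to_bd d)"
      using homeomorphic_maps_sphere_bd[of d] unfolding homeomorphic_maps_def by (elim conjE)
    from continuous_map_compose[OF this c] show ?thesis by (simp add: q_def[abs_def] o_def)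
  qed
  have e: "e \<in> points (wedge_complex d m)"
  proof -
    have "v \<in> nz e \<longleftrightarrow> v \<in> {None}" for v by (simp add: e_def)
    then have "nz e = {None}" by blast
    moreover have "{None} \<in> wedge_complex d m" by (simp add: wedge_complex_def)
    moreover have "e None = 1" "0 \<le> e v" for v by (simp_all add: e_def)
    ultimately show ?thesis by (simp add: points_def)
  qed
  have wc: "w = None \<or> (\<exists>j<m. \<exists>x\<in>topspace (nsphere d). w = wedge_inclusion (\<lambda>_. b) j x)"
    if "w \<in> topspace ?W" for w
    using that unfolding topspace_wedge_topology by blast
  have top1: "None \<in> topspace ?W"
    and top2: "\<And>j x. j < m \<Longrightarrow> x \<in> topspace (nsphere d) \<Longrightarrow> wedge_inclusion (\<lambda>_. b) j x \<in> topspace ?W"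
    unfolding topspace_wedge_topology by blast+
  have cg: "continuous_map ?W ?R g"
    unfolding continuous_map_def
  proof (intro conjI allI impI funcsetI)
    fix z assume "z \<in> topspace ?W"
    then consider "z = None" | j x where "j < m" "x \<in> topspace (nsphere d)" "z = wedge_inclusion (\<lambda>_. b) j x"
      using wc by blast
    then show "g z \<in> topspace ?R"
    proof cases
      case 1
      then show ?thesis using e by (simp add: g_def geometric_realization_points)
    next
      case 2
      then show ?thesis using g_incl cq by (simp add: continuous_map_def Pi_iff)
    qed
  next
    fix U assume U: "openin ?R U"
    show "openin ?W {x \<in> topspace ?W. g x \<in> U}"
      unfolding openin_wedge_topology
    proof (intro conjI ballI)
      fix j assume j: "j \<in> {..<m}"
      have "{x \<in> topspace (nsphere d). wedge_inclusion (\<lambda>_. b) j x \<in> {x \<in> topspace ?W. g x \<in> U}}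
        = {x \<in> topspace (nsphere d). q j x \<in> U}"
        using j by (auto simp: topspace_wedge_topology g_incl)
      then show "openin (nsphere d) {x \<in> topspace (nsphere d). wedge_inclusion (\<lambda>_. b) j x \<in> {x \<in> topspace ?W. g x \<in> U}}"
        using cq[of j] j U by (simp add: continuous_map_def)
    qed (auto simp: topspace_wedge_topology)
  qed
  have q_inj: "x = y" if "x \<in> topspace (nsphere d)" "y \<in> topspace (nsphere d)"
    "\<And>i. i \<le> Suc d \<Longrightarrow> q j x (petal j i) = q j y (petal j i)" for j x y
  proof -
    have "sphere_to_bd d x i = sphere_to_bd d y i" for i
      using that(3)[of i] q[of i] by (cases "i \<le> Suc d") (auto simp: sphere_to_bd_def)
    then have "sphere_to_bd d x = sphere_to_bd d y" by auto
    then show ?thesis using sphere_to_bd_to_sphere that by metis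
  qed
  \<comment> \<open>Away from the base point some weight lies on a vertex belonging to a single
    petal; this separates points of different petals.\<close>
  have supp: "\<exists>i. i \<noteq> 0 \<and> i \<le> Suc d \<and> q j x (Some (j, i)) \<noteq> 0"
    if x: "x \<in> topspace (nsphere d)" "x \<noteq> b" for j x
  proof (rule ccontr)
    assume no: "\<not> ?thesis"
    have z: "sphere_to_bd d x i = 0" if "i \<noteq> 0" for i
      using no that q[of i j x] by (cases "i \<le> Suc d") (auto simp: sphere_to_bd_def)
    have "sum (sphere_to_bd d x) {..Suc d} = 1"
      using points_nz[OF sphere_to_bd_points[OF x(1)]] sphere_to_bd_points[OF x(1)]
      by (intro points_sum[of _ "bd {..Suc d}"]) (simp_all add: psubset_imp_subset)
    moreover have "sum (sphere_to_bd d x) {..Suc d} = sum (sphere_to_bd d x) {0}"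
      using z by (intro sum.mono_neutral_right) auto
    ultimately have "sphere_to_bd d x = sphere_to_bd d b" using z sb by auto
    then show False using sphere_to_bd_to_sphere x bS by metis
  qed
  have inj: "inj_on g (topspace ?W)"
  proof (rule inj_onI)
    have cross: "j = l" if jl: "x \<in> topspace (nsphere d)" "x \<noteq> b" "q j x = q l y" for j l x y
    proof (rule ccontr)
      assume "j \<noteq> l"
      obtain i where i: "i \<noteq> 0" "q j x (Some (j, i)) \<noteq> 0" using supp[OF jl(1,2)] by blast
      have "Some (j, i) \<notin> petal l ` ?V" using \<open>j \<noteq> l\<close> petal_image by auto
      then show False using q0[of "Some (j, i)" l y] i jl(3) by simp
    qed
    have same: "x = y" if "q j x = q j y" "x \<in> topspace (nsphere d)" "y \<in> topspace (nsphere d)" for j x y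
      by (rule q_inj[OF that(2,3), of j]) (simp add: that(1))
    fix y z assume y: "y \<in> topspace ?W" and z: "z \<in> topspace ?W" and eq: "g y = g z"
    have form: "w = None \<or> (\<exists>j x. x \<in> topspace (nsphere d) \<and> x \<noteq> b \<and> w = Some (j, x))" if "w \<in> topspace ?W" for w
      using wc[OF that] unfolding wedge_inclusion_def by (metis (full_types))
    have gS: "g (Some (j, x)) = q j x" for j x by (simp add: g_def)
    have gN: "g None = q j b" for j by (simp add: g_def qb)
    show "y = z"
    proof (cases y)
      case None
      show ?thesis
      proof (cases z)
        case (Some a)
        then obtain j x where "x \<in> topspace (nsphere d)" "x \<noteq> b" "z = Some (j, x)" using form[OF z] by auto
        moreover have "q j b = q j x" using eq None gS gN[of j] calculation by simp
        ultimately show ?thesis using same[of j b x] bS by simp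
      qed (simp add: None)
    next
      case (Some a)
      then obtain j x where jx: "x \<in> topspace (nsphere d)" "x \<noteq> b" "y = Some (j, x)" using form[OF y] by auto
      show ?thesis
      proof (cases z)
        case None
        have "q j x = q j b" using eq None gS gN[of j] jx by simp
        then show ?thesis using same[of j x b] bS jx by simp
      next
        case (Some a)
        then obtain l x' where lx: "x' \<in> topspace (nsphere d)" "x' \<noteq> b" "z = Some (l, x')" using form[OF z] by auto
        then have qq: "q j x = q l x'" using eq jx gS by simp
        then have "j = l" using cross[OF jx(1,2)] by blast
        then show ?thesis using same[of j x x'] qq jx lx by simp
      qed
    qed
  qed
  have surj: "g ` topspace ?W = topspace ?R"
  proof
    show "g ` topspace ?W \<subseteq> topspace ?R" using cg by (auto simp: continuous_map_def)
    show "topspace ?R \<subseteq> g ` topspace ?W"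
    proof
      fix f assume "f \<in> topspace ?R"
      then have f: "f \<in> points (wedge_complex d m)" by (simp add: geometric_realization_points)
      from points_nz[OF f] consider "nz f \<subseteq> {None}"
        | j where "j < m" "nz f \<subset> petal j ` ?V"
        unfolding wedge_complex_def petal_image by blast
      then show "f \<in> g ` topspace ?W"
      proof cases
        case 1
        have "f None = 1" using points_sum[OF f _ 1] by simp
        have "f w = e w" for w
          using \<open>f None = 1\<close> 1 by (cases "w = None") (auto simp: e_def)
        then have "f = g None" by (simp add: g_def fun_eq_iff)
        then show ?thesis using top1 by blast
      next
        case 2
        define h where "h i = (if i \<le> Suc d then f (petal j i) else 0)" for i
        have img: "petal j ` nz h = nz f"
        proof
          show "petal j ` nz h \<subseteq> nz f" by (rule image_subsetI) (simp add: h_def split: if_splits)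
          show "nz f \<subseteq> petal j ` nz h"
          proof
            fix w assume w: "w \<in> nz f"
            with 2(2) have "w \<in> petal j ` ?V" by blast
            then obtain i where "w = petal j i" "i \<in> ?V" by (rule imageE)
            then show "w \<in> petal j ` nz h" using w by (intro image_eqI[of _ _ i]) (simp_all add: h_def)
          qed
        qed
        have hs: "nz h \<subseteq> ?V" by (rule subsetI) (simp add: h_def split: if_splits)
        have "nz h \<noteq> ?V" using img 2(2) by (metis psubset_eq)
        then have hb: "nz h \<in> bd ?V" using hs by simp
        have "sum h (nz h) = sum f (petal j ` nz h)"
          unfolding sum.reindex[OF inj_petal] by (intro sum.cong) (simp_all add: h_def split: if_splits)
        also have "\<dots> = 1" using img f by (simp add: points_def)
        finally have hp: "h \<in> points (bd ?V)"
          using hb points_nonneg[OF f] by (simp add: points_def h_def)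
        define x where "x = bd_to_sphere d h"
        have xs: "x \<in> topspace (nsphere d)" using bd_to_sphere_in[OF hp] by (simp add: x_def)
        have "f = q j x"
        proof
          fix w show "f w = q j x w"
          proof (cases "w \<in> petal j ` ?V")
            case True
            then obtain i where "w = petal j i" "i \<in> ?V" by (rule imageE)
            then have i: "i \<le> Suc d" "w = petal j i" by simp_all
            then have "q j x w = h i" using q[of i j x] bd_to_sphere_to_bd[OF hp] by (simp add: x_def)
            then show ?thesis using i by (simp add: h_def)
          next
            case False
            moreover have "w \<notin> nz f" using False psubset_imp_subset[OF 2(2)] by blast
            ultimately show ?thesis using q0[OF False, of x] by simp
          qed
        qed
        then have "f = g (wedge_inclusion (\<lambda>_. b) j x)" by (simp add: g_incl)
        then show ?thesis using top2[OF 2(1) xs] by blast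
      qed
    qed
  qed
  have "homeomorphic_map ?W ?R g"
    by (rule continuous_imp_homeomorphic_map[OF cg _ Hausdorff_geometric_realization surj inj])
      (simp add: compact_space_wedge_topology compact_space_nsphere)
  then show ?thesis unfolding b_def[symmetric] by (rule homeomorphic_map_imp_homeomorphic_space)
qed

section \<open>Capped cones\<close>

lemma pointsI':
  assumes "\<And>v. 0 \<le> f v" "nz f \<in> K" "finite V" "nz f \<subseteq> V" "sum f V = 1"
  shows "f \<in> points K"
  using assms sum_nz[OF assms(3,4)] by (simp add: points_def)

lemma push_comp:
  assumes "finite V" "finite U" "h ` V \<subseteq> U"
  shows "push U p (push V h f) = push V (\<lambda>v. p (h v)) f"
proof
  fix w
  have "push U p (push V h f) w = (\<Sum>u\<in>{u \<in> U. p u = w}. \<Sum>v\<in>{v \<in> {v \<in> V. p (h v) = w}. h v = u}. f v)"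
    unfolding push_def by (intro sum.cong) auto
  also have "\<dots> = push V (\<lambda>v. p (h v)) f w"
    unfolding push_def by (rule sum.group) (use assms in auto)
  finally show "push U p (push V h f) w = push V (\<lambda>v. p (h v)) f w" .
qed

lemma push_id:
  assumes "finite V" "nz f \<subseteq> V" "\<And>v. v \<in> V \<Longrightarrow> h v = v"
  shows "push V h f = f"
proof
  fix w
  have "{v \<in> V. h v = w} = (if w \<in> V then {w} else {})" using assms(3) by auto
  then show "push V h f w = f w" using assms(2) unfolding push_def by auto
qed

text \<open>The facets \<open>G j\<close> are to be capped by the cone over \<open>K\<close>. Their
  common cardinality prevents one facet from containing another, so that at most one of the
  functions \<open>t j\<close> below is nonzero at any point.\<close>

locale capped_complex =
  fixes K :: "'a set set" and apex :: 'a and G :: "nat \<Rightarrow> 'a set" and m c :: nat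
  assumes K: "simplicial K" "finite (\<Union>K)" "{} \<in> K"
    and apex_K: "\<And>s. s \<in> K \<Longrightarrow> apex \<notin> s" and apex_G: "\<And>j. j < m \<Longrightarrow> apex \<notin> G j"
    and finG: "\<And>j. j < m \<Longrightarrow> finite (G j)" and cardG: "\<And>j. j < m \<Longrightarrow> card (G j) = c"
    and bdG: "\<And>j. j < m \<Longrightarrow> bd (G j) \<subseteq> K" and G_K: "\<And>j. j < m \<Longrightarrow> G j \<notin> K"
    and injG: "inj_on G {..<m}" and c: "0 < c"
begin

definition L :: "'a set set" where
  "L = K \<union> insert apex ` K \<union> G ` {..<m}"

definition V :: "'a set" where
  "V = insert apex (\<Union>K \<union> \<Union>(G ` {..<m}))"

lemma finV: "finite V"
  unfolding V_def using K finG by auto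

lemma L_V: "L \<subseteq> Pow V"
  unfolding L_def V_def by auto

lemma KL: "s \<in> K \<Longrightarrow> s \<in> L" "s \<in> K \<Longrightarrow> insert apex s \<in> L" and GL: "j < m \<Longrightarrow> G j \<in> L"
  by (auto simp: L_def)

lemma simplicial_L: "simplicial L"
  unfolding simplicial_def
proof (intro ballI conjI subsetI)
  fix s assume s: "s \<in> L"
  then show "finite s" using L_V finV finite_subset[of s V] by blast
  fix t assume "t \<in> Pow s"
  then have t: "t \<subseteq> s" by simp
  from s consider "s \<in> K" | r where "r \<in> K" "s = insert apex r" | j where "j < m" "s = G j"
    by (auto simp: L_def)
  then show "t \<in> L"
  proof cases
    case 1
    then show ?thesis using KL simplicialD[OF K(1) _ t] by blast
  next
    case 2
    then have "t - {apex} \<in> K" using t by (intro simplicialD[OF K(1) 2(1)]) auto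
    then have "t - {apex} \<in> L" "insert apex (t - {apex}) \<in> L" using KL by blast+
    then show ?thesis by (cases "apex \<in> t") (simp_all add: insert_absorb)
  next
    case 3
    show ?thesis
    proof (cases "t = s")
      case False
      then have "t \<in> bd (G j)" using t 3 by auto
      then show ?thesis using bdG[OF 3(1)] KL by blast
    qed (use s in simp)
  qed
qed

lemma G_nonempty: "j < m \<Longrightarrow> G j \<noteq> {}"
  using cardG c by force

text \<open>The largest multiple of the barycenter of \<open>G j\<close> that can be split off from
  \<open>g\<close> on \<open>G j\<close>; the factor \<open>c\<close> makes it 1 at the barycenter
  itself, whose coordinates are 1/c.\<close>

definition t :: "nat \<Rightarrow> ('a \<Rightarrow> real) \<Rightarrow> real" where
  "t j g = real c * Min (g ` G j)"

lemma t_le: "j < m \<Longrightarrow> v \<in> G j \<Longrightarrow> t j g / c \<le> g v"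
  using c finG by (simp add: t_def)

lemma t_attained: assumes "j < m" obtains v where "v \<in> G j" "g v = t j g / c"
proof -
  have "Min (g ` G j) \<in> g ` G j" using finG G_nonempty assms by (intro Min_in) auto
  then obtain v where "v \<in> G j" "g v = Min (g ` G j)" by (metis imageE)
  then show thesis using that c by (simp add: t_def)
qed

lemma t_nonneg: assumes "j < m" "g \<in> points X" shows "0 \<le> t j g"
proof -
  obtain w where "w \<in> G j" "g w = t j g / c" using t_attained[OF assms(1)] .
  then have "0 \<le> t j g / c" using points_nonneg[OF assms(2)] by metis
  then show ?thesis using c by (simp add: zero_le_divide_iff)
qed

lemma t_zero:
  assumes "j < m" "g \<in> points X" "\<not> G j \<subseteq> nz g"
  shows "t j g = 0"
proof -
  obtain v where v: "v \<in> G j" "g v = 0" using assms(3) by auto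
  have "t j g / c \<le> 0" using t_le[OF assms(1) v(1), of g] v by simp
  then have "t j g \<le> 0" using c by (simp add: divide_le_0_iff)
  then show ?thesis using t_nonneg[OF assms(1,2)] by simp
qed

text \<open>A face of the cone containing \<open>G j\<close> would put \<open>G j\<close> into
  \<open>K\<close>, so all \<open>t j\<close> vanish on the cone. Inside facet \<open>j\<close> the
  other \<open>t i\<close> vanish, since a facet of the same size is not contained in
  \<open>G j\<close>.\<close>

lemma points_L_cases:
  assumes g: "g \<in> points L"
  obtains (cone) "nz g \<in> K \<union> insert apex ` K" "\<And>j. j < m \<Longrightarrow> t j g = 0"
  | (cap) j where "j < m" "nz g = G j" "\<And>i. i < m \<Longrightarrow> i \<noteq> j \<Longrightarrow> t i g = 0" "0 \<le> t j g" "t j g \<le> 1"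
proof -
  consider "nz g \<in> K \<union> insert apex ` K" | j where "j < m" "nz g = G j"
    using points_nz[OF g] by (auto simp: L_def)
  then show thesis
  proof cases
    case 1
    have "\<not> G j \<subseteq> nz g" if j: "j < m" for j
    proof
      assume sub: "G j \<subseteq> nz g"
      obtain s where s: "s \<in> K" "nz g \<subseteq> insert apex s" using 1 by auto
      then have "G j \<subseteq> s" using sub apex_G[OF j] by auto
      then show False using G_K[OF j] simplicialD[OF K(1) s(1)] by blast
    qed
    then show thesis using cone 1 t_zero[OF _ g] by blast
  next
    case (2 j)
    have 3: "t i g = 0" if i: "i < m" "i \<noteq> j" for i
    proof (rule t_zero[OF i(1) g])
      show "\<not> G i \<subseteq> nz g"
      proof
        assume "G i \<subseteq> nz g"
        then have "G i = G j" using 2 i finG cardG by (intro card_subset_eq) auto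
        then show False using injG i 2 by (auto dest: inj_onD)
      qed
    qed
    have 1: "sum g (G j) = 1" using points_sum[OF g finG[OF 2(1)]] 2 by simp
    have "(\<Sum>v\<in>G j. t j g / c) \<le> sum g (G j)" by (rule sum_mono) (use t_le[OF 2(1)] in simp)
    then have 4: "t j g \<le> 1" using 1 cardG[OF 2(1)] c by simp
    show thesis using cap[OF 2 3 t_nonneg[OF 2(1) g] 4] .
  qed
qed

text \<open>A point of a facet is split into its barycenter part, of weight u, and a remainder, of
  weight 1 - u. At time s the remainder is multiplied by \<open>slope s u\<close>, the barycenter
  receives \<open>core s u\<close>, and the apex gets what is missing from 1. The threshold is u =
  s/2: above it the apex gets nothing, below it the core is empty. At s = 0 this is the identity.
  The factor 2 before \<open>max\<close> is chosen so that \<open>slope 1 0 = 0\<close>, which sends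
  all boundary and cone points to the apex at time 1.\<close>

definition slope :: "real \<Rightarrow> real \<Rightarrow> real" where
  "slope s u = 2 / (2 - s) - 2 * max 0 (s - 2 * u)"

definition core :: "real \<Rightarrow> real \<Rightarrow> real" where
  "core s u = max 0 (2 * u - s) / (2 - s)"

text \<open>
  A facet \<open>G j\<close> is stretched from its barycenter over the whole cap
  \<open>G j\<close> together with the cone over its boundary, while the cone over \<open>K\<close> shrinks to the apex.
  The quantity \<open>t j g\<close> runs from \<open>0\<close> on the boundary of \<open>G j\<close> to \<open>1\<close> at the barycenter.
\<close>

definition stretch :: "real \<Rightarrow> ('a \<Rightarrow> real) \<Rightarrow> 'a \<Rightarrow> real" where
  "stretch s g v = (let a = slope s (\<Sum>j<m. t j g) in
     if v = apex then 1 - a * (1 - g apex) + (\<Sum>j<m. a * t j g - core s (t j g))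
     else a * g v + (\<Sum>j<m. if v \<in> G j then (core s (t j g) - a * t j g) / c else 0))"

text \<open>The subtracted term is at most 2 s, and s (2 - s) \<le> 1 is the inequality (s - 1)^2
  \<ge> 0.\<close>

lemma slope_nonneg: assumes "0 \<le> s" "s \<le> 1" "0 \<le> u" shows "0 \<le> slope s u"
proof -
  have "(s - 1)\<^sup>2 \<ge> 0" by simp
  then have "s \<le> 1 / (2 - s)" using assms by (simp add: field_simps power2_eq_square)
  moreover have "max 0 (s - 2 * u) \<le> s" using assms by simp
  moreover define r where "r = 1 / (2 - s)"
  moreover have "2 / (2 - s) = 2 * r" by (simp add: r_def)
  ultimately show ?thesis unfolding slope_def by simp
qed

lemma core_nonneg: "s \<le> 1 \<Longrightarrow> 0 \<le> core s u"
  by (simp add: core_def)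

text \<open>Above the threshold the whole weight stays on the facet, leaving 0 for the apex.\<close>

lemma slope_core_far: assumes "s \<le> 1" "s \<le> 2 * u" shows "slope s u * (1 - u) + core s u = 1"
proof -
  have "2 / (2 - s) * (1 - u) + (2 * u - s) / (2 - s) = (2 - s) / (2 - s)"
    by (simp add: add_divide_distrib[symmetric] algebra_simps)
  then show ?thesis using assms unfolding slope_def core_def by simp
qed

text \<open>Below the threshold the weight left for the apex is nonnegative. It would be 0 exactly
  at u = s/2, where this case meets the other one.\<close>

lemma slope_core_near:
  assumes "0 \<le> s" "s \<le> 1" "2 * u < s" "0 \<le> u"
  shows "slope s u * (1 - u) \<le> 1" "core s u = 0"
proof -
  define q where "q = s / 2"
  have q: "0 < 1 - q" "0 < 1 - u" "q - u > 0" "q \<le> 1/2" using assms by (auto simp: q_def)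
  have "(q - u) * (1 - 4 * ((1 - q) * (1 - u))) \<le> 0"
  proof (rule mult_nonneg_nonpos)
    have "1/2 * (1/2) \<le> (1 - q) * (1 - u)" using q by (intro mult_mono) auto
    then show "1 - 4 * ((1 - q) * (1 - u)) \<le> 0" by simp
  qed (use q in simp)
  moreover have "2 / (2 - s) = 1 / (1 - q)" by (simp add: q_def field_simps)
  moreover have "max 0 (s - 2 * u) = 2 * (q - u)" using assms by (simp add: q_def)
  \<comment> \<open>The excess over 1 vanishes at the threshold u = q, so q - u factors out; the
    cofactor is nonpositive because 1 - q and 1 - u are at least 1/2.\<close>
  moreover have "(1 / (1 - q) - 4 * (q - u)) * (1 - u)
      = (q - u) * (1 - 4 * ((1 - q) * (1 - u))) / (1 - q) + 1"
    using q by (simp add: field_simps)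
  ultimately show "slope s u * (1 - u) \<le> 1"
    unfolding slope_def using q by (simp add: divide_nonpos_pos)
  show "core s u = 0" using assms by (simp add: core_def)
qed

lemma stretch_cone:
  assumes "\<And>j. j < m \<Longrightarrow> t j g = 0" "0 \<le> s"
  shows "stretch s g v = (if v = apex then 1 - slope s 0 * (1 - g apex) else slope s 0 * g v)"
  unfolding stretch_def using assms by (simp add: core_def cong: if_cong)

lemma stretch_cap:
  assumes j: "j < m" "nz g = G j" "\<And>i. i < m \<Longrightarrow> i \<noteq> j \<Longrightarrow> t i g = 0" and s: "0 \<le> s"
  shows "stretch s g v = (if v = apex then 1 - (slope s (t j g) * (1 - t j g) + core s (t j g))
     else if v \<in> G j then slope s (t j g) * (g v - t j g / c) + core s (t j g) / c else 0)"
proof -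
  have T: "(\<Sum>i<m. t i g) = t j g"
    using j by (subst sum.remove[of _ j]) (auto intro!: sum.neutral)
  have A: "(\<Sum>i<m. a * t i g - core s (t i g)) = a * t j g - core s (t j g)" for a
    using j s by (subst sum.remove[of _ j]) (auto intro!: sum.neutral simp: core_def)
  have B: "(\<Sum>i<m. if v \<in> G i then (core s (t i g) - a * t i g) / c else 0)
      = (if v \<in> G j then (core s (t j g) - a * t j g) / c else 0)" for a
    using j s by (subst sum.mono_neutral_right[of "{..<m}" "{j}"]) (auto simp: core_def)
  have "g apex = 0" using j apex_G[OF j(1)] by auto
  moreover have "g v = 0" if "v \<notin> G j" using that j(2) by auto
  ultimately show ?thesis unfolding stretch_def T A B Let_def
    by (auto simp: algebra_simps diff_divide_distrib)
qed

lemma stretch_points: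
  assumes g: "g \<in> points L" and s: "0 \<le> s" "s \<le> 1"
  shows "stretch s g \<in> points L"
  using g
proof (cases rule: points_L_cases)
  case cone
  let ?a = "slope s 0"
  have eq: "stretch s g v = (if v = apex then 1 - ?a * (1 - g apex) else ?a * g v)" for v
    by (rule stretch_cone) (use cone s in auto)
  have a: "0 \<le> ?a" "?a \<le> 1"
  proof -
    show "0 \<le> ?a" using slope_nonneg[of s 0] s by simp
    have "(2 - s) * (2 * s) \<ge> s" using mult_mono[of 1 "2 - s" s "2 * s"] s by simp
    then have "2 / (2 - s) \<le> 1 + 2 * s" using s by (simp add: field_simps)
    then show "?a \<le> 1" using s by (simp add: slope_def)
  qed
  obtain r where r: "r \<in> K" "nz g \<subseteq> insert apex r" using cone(1) by blast
  have fin: "finite r" and ar: "apex \<notin> r" using r(1) simplicial_finite[OF K(1)] apex_K by auto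
  show ?thesis
  proof (rule pointsI[OF _ _ KL(2)[OF r(1)] simplicial_L])
    show "0 \<le> stretch s g v" for v
      unfolding eq using a points_nonneg[OF g] points_le_1[OF g, of apex]
      by (auto intro!: mult_le_one)
    show "nz (stretch s g) \<subseteq> insert apex r" unfolding eq using r(2) by auto
    have "sum g (insert apex r) = 1" using points_sum[OF g _ r(2)] fin by simp
    then have "sum g r = 1 - g apex" using fin ar by simp
    moreover have "sum (stretch s g) r = (\<Sum>v\<in>r. ?a * g v)"
      using ar by (intro sum.cong) (auto simp: eq)
    ultimately have "sum (stretch s g) r = ?a * (1 - g apex)" by (simp flip: sum_distrib_left)
    then show "sum (stretch s g) (insert apex r) = 1" using fin ar by (simp add: eq)
  qed
next
  case (cap j)
  let ?T = "t j g" and ?a = "slope s (t j g)" and ?b = "core s (t j g)"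
  have eq: "stretch s g v = (if v = apex then 1 - (?a * (1 - ?T) + ?b)
      else if v \<in> G j then ?a * (g v - ?T / c) + ?b / c else 0)" for v
    by (rule stretch_cap) (use cap s in auto)
  have a0: "0 \<le> ?a" and b0: "0 \<le> ?b" using slope_nonneg core_nonneg s cap by auto
  have le1: "?a * (1 - ?T) + ?b \<le> 1"
    using slope_core_far[OF s(2), of ?T] slope_core_near[OF s _ cap(4)] by (cases "s \<le> 2 * ?T") auto
  have fin: "finite (G j)" and ar: "apex \<notin> G j" using finG apex_G cap by auto
  show ?thesis
  proof (rule pointsI'[where V = "insert apex (G j)"])
    show "0 \<le> stretch s g v" for v
      unfolding eq using a0 b0 le1 t_le[OF cap(1), of v g] c by auto
    show sub: "nz (stretch s g) \<subseteq> insert apex (G j)" unfolding eq by auto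
    show "nz (stretch s g) \<in> L"
    proof (cases "s \<le> 2 * ?T")
      case True
      then have "stretch s g apex = 0" using slope_core_far[OF s(2)] by (simp add: eq)
      then have "nz (stretch s g) \<subseteq> G j" using sub by auto
      then show ?thesis using simplicialD[OF simplicial_L GL[OF cap(1)]] by blast
    next
      case False
      \<comment> \<open>At a vertex where \<open>g\<close> is minimal on \<open>G j\<close> the
        remainder vanishes, and the core is empty here. Hence the support stays in the cone over a
        proper face of \<open>G j\<close>.\<close>
      obtain v where v: "v \<in> G j" "g v = ?T / c" using t_attained[OF cap(1)] .
      have "?b = 0" using slope_core_near[OF s _ cap(4)] False by simp
      then have "stretch s g v = 0" using v ar by (auto simp: eq)
      then have "nz (stretch s g) \<subseteq> insert apex (G j - {v})" using sub by auto
      moreover have "G j - {v} \<in> K" using bdG[OF cap(1)] v(1) by auto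
      ultimately show ?thesis using KL(2) simplicialD[OF simplicial_L] by blast
    qed
    have "sum (stretch s g) (G j) = (\<Sum>v\<in>G j. ?a * g v - ?a * (?T / c) + ?b / c)"
      using ar by (intro sum.cong) (auto simp: eq algebra_simps)
    also have "\<dots> = ?a * sum g (G j) - c * (?a * (?T / c)) + c * (?b / c)"
      using cardG[OF cap(1)] by (simp add: sum.distrib sum_subtractf sum_distrib_left)
    also have "\<dots> = ?a * (1 - ?T) + ?b"
      using points_sum[OF g fin] cap(2) c by (simp add: algebra_simps)
    finally show "sum (stretch s g) (insert apex (G j)) = 1" using fin ar by (simp add: eq)
  qed (use fin in simp)
qed

lemma continuous_t: "j < m \<Longrightarrow> continuous_map (geometric_realization L) euclideanreal (t j)"
  unfolding t_def[abs_def] geometric_realization_points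
  by (intro continuous_intros continuous_map_real_Min continuous_map_coordinate finG G_nonempty)

text \<open>Because at most one \<open>t j\<close> is nonzero, summing over j gives a single formula
  for cone and caps alike, so continuity needs no pasting along the boundaries.\<close>

lemma stretch_homotopic:
  "homotopic_with (\<lambda>_. True) (geometric_realization L) (geometric_realization L) id (stretch 1)"
proof -
  let ?I = "prod_topology (top_of_set {0..1::real}) (geometric_realization L)"
  have "continuous_map ?I (top_of_set {0..1::real}) fst" by (simp add: continuous_map_fst)
  then have cs: "continuous_map ?I euclideanreal fst"
    using continuous_map_in_subtopology by blast
  have snd: "continuous_map ?I (geometric_realization L) snd" by (simp add: continuous_map_snd)
  have ct: "continuous_map ?I euclideanreal (\<lambda>z. t j (snd z))" if "j < m" for j
    using continuous_map_compose[OF snd continuous_t[OF that]] by (simp add: o_def)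
  have cg: "continuous_map ?I euclideanreal (\<lambda>z. snd z v)" for v
    using continuous_map_compose[OF snd, of euclideanreal "\<lambda>g. g v"]
      continuous_map_coordinate[of "points L" v] by (simp add: o_def geometric_realization_points)
  have nz: "2 - fst z \<noteq> 0" if "z \<in> topspace ?I" for z using that by auto
  have cslope: "continuous_map ?I euclideanreal (\<lambda>z. slope (fst z) (\<Sum>j<m. t j (snd z)))"
    unfolding slope_def by (intro continuous_intros cs ct continuous_map_real_max nz) auto
  have ccore: "continuous_map ?I euclideanreal (\<lambda>z. core (fst z) (t j (snd z)))" if "j < m" for j
    unfolding core_def by (intro continuous_intros cs ct that continuous_map_real_max nz)
  have "continuous_map ?I euclideanreal (\<lambda>z. stretch (fst z) (snd z) v)" for v
  proof (cases "v = apex")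
    case True
    then show ?thesis unfolding stretch_def Let_def if_P[OF True]
      by (intro continuous_intros cslope ccore ct cg) auto
  next
    case False
    have "continuous_map ?I euclideanreal (\<lambda>z. if v \<in> G j then
        (core (fst z) (t j (snd z)) - slope (fst z) (\<Sum>j<m. t j (snd z)) * t j (snd z)) / c else 0)"
      if "j < m" for j
    proof (cases "v \<in> G j")
      case True
      then show ?thesis unfolding if_P[OF True] using c that
        by (intro continuous_intros cslope ccore ct) auto
    qed simp
    note * = this
    show ?thesis unfolding stretch_def Let_def if_not_P[OF False]
      by (intro continuous_map_add continuous_map_sum continuous_map_real_mult cslope cg *) auto
  qed
  then have "continuous_map ?I (geometric_realization L) (\<lambda>z. stretch (fst z) (snd z))"
    using stretch_points unfolding geometric_realization_points continuous_map_function_space by simp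
  moreover have "stretch 0 g = g" if g: "g \<in> points L" for g
  proof
    fix v
    have t0: "0 \<le> t j g" if "j < m" for j using t_nonneg[OF that g] .
    then have T0: "0 \<le> (\<Sum>j<m. t j g)" by (intro sum_nonneg) simp
    then have "slope 0 (\<Sum>j<m. t j g) = 1" by (simp add: slope_def)
    moreover have "core 0 (t j g) = t j g" if "j < m" for j using t0[OF that] by (simp add: core_def)
    ultimately show "stretch 0 g v = g v" unfolding stretch_def by (simp cong: if_cong)
  qed
  ultimately show ?thesis
    by (subst homotopic_with, simp)
      (intro exI[of _ "\<lambda>z. stretch (fst z) (snd z)"], simp add: geometric_realization_points)
qed

text \<open>The time-one stretching with a private copy \<open>Some (j, i)\<close> of the vertices
  for each facet, so that vertices shared by several facets are separated. It is continuous across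
  the boundaries because the coefficients \<open>slope 1 0\<close> and \<open>core 1 0\<close>
  vanish: everything outside the open facets goes to the base point.\<close>

definition unfold_caps :: "(nat \<Rightarrow> nat \<Rightarrow> 'a) \<Rightarrow> ('a \<Rightarrow> real) \<Rightarrow> (nat \<times> nat) option \<Rightarrow> real" where
  "unfold_caps e g w = (case w of
     None \<Rightarrow> 1 - (\<Sum>j<m. slope 1 (t j g) * (sum g (G j) - t j g) + core 1 (t j g))
   | Some (j, i) \<Rightarrow> if j < m \<and> i \<in> {1..c}
       then slope 1 (t j g) * (g (e j i) - t j g / c) + core 1 (t j g) / c else 0)"

lemma slope_core_1_0: "slope 1 0 = 0" "core 1 0 = 0"
  by (simp_all add: slope_def core_def)

lemma unfold_caps_cone:
  assumes "\<And>j. j < m \<Longrightarrow> t j g = 0"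
  shows "unfold_caps e g = (\<lambda>w. if w = None then 1 else 0)"
  using assms unfolding unfold_caps_def
  by (auto simp: fun_eq_iff slope_core_1_0 split: option.split)

lemma unfold_caps_cap:
  assumes j: "j < m" "nz g = G j" "\<And>i. i < m \<Longrightarrow> i \<noteq> j \<Longrightarrow> t i g = 0" and g: "g \<in> points L"
  shows "unfold_caps e g w = (case w of None \<Rightarrow> 1 - (slope 1 (t j g) * (1 - t j g) + core 1 (t j g))
   | Some (l, i) \<Rightarrow> if l = j \<and> i \<in> {1..c}
       then slope 1 (t j g) * (g (e j i) - t j g / c) + core 1 (t j g) / c else 0)"
proof -
  have "sum g (G j) = 1" using points_sum[OF g finG[OF j(1)]] j by simp
  then have "(\<Sum>i<m. slope 1 (t i g) * (sum g (G i) - t i g) + core 1 (t i g))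
      = slope 1 (t j g) * (1 - t j g) + core 1 (t j g)"
    using j by (subst sum.mono_neutral_right[of "{..<m}" "{j}"]) (auto simp: slope_core_1_0)
  then show ?thesis using j unfolding unfold_caps_def
    by (auto simp: slope_core_1_0 split: option.split)
qed

end

definition petal_facet :: "nat \<Rightarrow> nat \<Rightarrow> (nat \<times> nat) option set" where
  "petal_facet c j = Some ` ({j} \<times> {1..c})"

definition petal_base :: "nat \<Rightarrow> nat \<Rightarrow> (nat \<times> nat) option set set" where
  "petal_base c m = insert {} {s. \<exists>j<m. s \<subset> petal_facet c j}"

lemma petal_facet_simps:
  "finite (petal_facet c j)" "card (petal_facet c j) = c" "None \<notin> petal_facet c j"
  "0 < c \<Longrightarrow> petal_facet c j = petal_facet c l \<longleftrightarrow> j = l"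
proof -
  show "finite (petal_facet c j)" by (simp add: petal_facet_def)
  show "card (petal_facet c j) = c" unfolding petal_facet_def by (subst card_image) auto
  show "None \<notin> petal_facet c j" by (auto simp: petal_facet_def)
  assume "0 < c"
  then have "Some (j, 1) \<in> petal_facet c l \<longleftrightarrow> j = l" for j l by (auto simp: petal_facet_def)
  then show "petal_facet c j = petal_facet c l \<longleftrightarrow> j = l" by blast
qed

text \<open>The wedge is presented as a capped complex too, so that the stretching homotopy is
  available on both sides of the equivalence.\<close>

lemma capped_petals:
  assumes "0 < c"
  shows "capped_complex (petal_base c m) None (petal_facet c) m c"
proof
  show "simplicial (petal_base c m)"
    unfolding simplicial_def
  proof (intro ballI conjI subsetI)
    fix s assume s: "s \<in> petal_base c m"
    then show "finite s" unfolding petal_base_def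
      using petal_facet_simps(1) by (auto intro: finite_subset[OF psubset_imp_subset])
    fix r assume "r \<in> Pow s"
    then show "r \<in> petal_base c m" using s unfolding petal_base_def by auto
  qed
  have "\<Union>(petal_base c m) \<subseteq> (\<Union>j<m. petal_facet c j)" unfolding petal_base_def by auto
  then show "finite (\<Union>(petal_base c m))"
    using petal_facet_simps(1) by (elim finite_subset) auto
  show "{} \<in> petal_base c m" by (simp add: petal_base_def)
  show "None \<notin> s" if "s \<in> petal_base c m" for s
    using that petal_facet_simps(3) unfolding petal_base_def by auto
  show "petal_facet c j \<notin> petal_base c m" if "j < m" for j
  proof
    assume "petal_facet c j \<in> petal_base c m"
    moreover have "petal_facet c j \<noteq> {}" using petal_facet_simps(2)[of c j] assms by auto
    ultimately obtain l where "petal_facet c j \<subset> petal_facet c l" by (auto simp: petal_base_def)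
    then have "card (petal_facet c j) < card (petal_facet c l)"
      by (intro psubset_card_mono petal_facet_simps(1))
    then show False by (simp add: petal_facet_simps(2))
  qed
  show "bd (petal_facet c j) \<subseteq> petal_base c m" if "j < m" for j
    using that by (auto simp: petal_base_def)
  show "inj_on (petal_facet c) {..<m}" using petal_facet_simps(4)[OF assms] by (auto intro: inj_onI)
qed (use assms petal_facet_simps in auto)

text \<open>The boundary of a simplex is the facet opposite the vertex \<open>None\<close> together
  with the cone from \<open>None\<close> over the boundary of that facet.\<close>

lemma petal_complex:
  "wedge_complex d m = petal_base (Suc d) m \<union> insert None ` petal_base (Suc d) m \<union> petal_facet (Suc d) ` {..<m}"
    (is "_ = ?R")
proof -
  have N: "None \<notin> petal_facet (Suc d) j" for j by (auto simp: petal_facet_def)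
  have W: "wedge_complex d m = {s. s \<subseteq> {None}} \<union> {s. \<exists>j<m. s \<subset> insert None (petal_facet (Suc d) j)}"
    by (simp add: wedge_complex_def petal_facet_def)
  show ?thesis
  proof (intro equalityI subsetI)
    fix s assume "s \<in> wedge_complex d m"
    then consider "s \<subseteq> {None}" | j where "j < m" "s \<subset> insert None (petal_facet (Suc d) j)"
      unfolding W by blast
    then show "s \<in> ?R"
    proof cases
      case 1
      then have "s = {} \<or> s = insert None {}" by auto
      then show ?thesis by (auto simp: petal_base_def)
    next
      case (2 j)
      show ?thesis
      proof (cases "None \<in> s")
        case True
        then have "s - {None} \<subset> petal_facet (Suc d) j" using 2 N[of j] by auto
        then have "s - {None} \<in> petal_base (Suc d) m" using 2 by (auto simp: petal_base_def)
        moreover have "s = insert None (s - {None})" using True by auto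
        ultimately show ?thesis by blast
      next
        case False
        then have "s \<subseteq> petal_facet (Suc d) j" using 2 by auto
        then show ?thesis using 2 by (auto simp: petal_base_def)
      qed
    qed
  next
    fix s assume "s \<in> ?R"
    then consider r where "r \<in> petal_base (Suc d) m" "s = r \<or> s = insert None r" | j where "j < m" "s = petal_facet (Suc d) j"
      by blast
    then show "s \<in> wedge_complex d m"
    proof cases
      case (1 r)
      then consider "r = {}" | j where "j < m" "r \<subset> petal_facet (Suc d) j" by (auto simp: petal_base_def)
      then show ?thesis
      proof cases
        case 2
        from psubset_imp_ex_mem[OF 2(2)] obtain x where x: "x \<in> petal_facet (Suc d) j" "x \<notin> r" by auto
        then have "x \<noteq> None" using N[of j] by (cases "x = None") simp_all
        then have "x \<notin> s" using x 1(2) by auto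
        moreover have "s \<subseteq> insert None (petal_facet (Suc d) j)" using 1(2) 2(2) by auto
        ultimately have "s \<subset> insert None (petal_facet (Suc d) j)" using x(1) by auto
        then show ?thesis using 2 unfolding W by blast
      qed (use 1 in \<open>auto simp: W\<close>)
    next
      case (2 j)
      then have "s \<subset> insert None (petal_facet (Suc d) j)" using N[of j] by auto
      then show ?thesis using 2 unfolding W by blast
    qed
  qed
qed

context capped_complex
begin

text \<open>The vertex map behind \<open>fold\<close> sends \<open>None\<close> to the apex and
  \<open>Some (j, i)\<close> to \<open>e j i\<close>. Both composites of \<open>fold\<close> and
  \<open>unfold_caps e\<close> are time-one stretchings, of \<open>L\<close> and of the wedge, and
  these are homotopic to the identity.\<close>

lemma realization_wedge_complex:
  assumes e: "\<And>j. j < m \<Longrightarrow> bij_betw (e j) {1..c} (G j)"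
  shows "geometric_realization L homotopy_equivalent_space geometric_realization (wedge_complex (c - 1) m)"
proof -
  interpret W: capped_complex "petal_base c m" None "petal_facet c" m c
    by (rule capped_petals[OF c])
  have LW: "W.L = wedge_complex (c - 1) m"
    using petal_complex[of "c - 1" m] c by (simp add: W.L_def)
  define fold where "fold = push W.V (\<lambda>w. case w of None \<Rightarrow> apex | Some (j, i) \<Rightarrow> e j i)"
  let ?p = "\<lambda>w. case w of None \<Rightarrow> apex | Some (j, i) \<Rightarrow> e j i"
  let ?u = "unfold_caps e"
  have eG: "e j i \<in> G j" if "j < m" "i \<in> {1..c}" for j i using e[OF that(1)] that(2) by (auto simp: bij_betw_def)
  have pG: "?p ` petal_facet c j = G j" if "j < m" for j
  proof -
    have "petal_facet c j = (\<lambda>i. Some (j, i)) ` {1..c}" by (auto simp: petal_facet_def)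
    then have "?p ` petal_facet c j = e j ` {1..c}" by (simp add: image_image)
    then show ?thesis using e[OF that] by (simp add: bij_betw_def)
  qed
  have p_inj: "inj_on ?p (petal_facet c j)" if "j < m" for j
  proof (rule inj_onI)
    fix u v assume uv: "u \<in> petal_facet c j" "v \<in> petal_facet c j" "?p u = ?p v"
    obtain i l where "u = Some (j, i)" "v = Some (j, l)" "i \<in> {1..c}" "l \<in> {1..c}"
      using uv(1,2) by (auto simp: petal_facet_def)
    then show "u = v" using uv(3) bij_betw_imp_inj_on[OF e[OF that]] by (auto dest: inj_onD)
  qed
  have p_base: "?p ` s \<in> K" if s: "s \<in> petal_base c m" for s
  proof -
    consider "s = {}" | j where "j < m" "s \<subset> petal_facet c j" using s by (auto simp: petal_base_def)
    then show ?thesis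
    proof cases
      case 1
      then show ?thesis using K by simp
    next
      case (2 j)
      then have "?p ` s \<subset> ?p ` petal_facet c j" using p_inj by (intro image_strict_mono)
      then have "?p ` s \<in> bd (G j)" by (simp only: pG[OF 2(1)] mem_Collect_eq)
      then show ?thesis using bdG[OF 2(1)] by (rule subsetD[rotated])
    qed
  qed
  have pL: "?p ` s \<in> L" if s: "s \<in> W.L" for s
  proof -
    consider r where "r \<in> petal_base c m" "s = r \<or> s = insert None r" | j where "j < m" "s = petal_facet c j"
      using s unfolding W.L_def by blast
    then show ?thesis
    proof cases
      case (1 r)
      then have "?p ` s = ?p ` r \<or> ?p ` s = insert apex (?p ` r)" by auto
      then show ?thesis using p_base[OF 1(1)] KL by metis
    next
      case (2 j)
      then show ?thesis using pG GL by simp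
    qed
  qed
  have fold_c: "continuous_map (geometric_realization W.L) (geometric_realization L) fold"
    unfolding fold_def by (rule continuous_map_push[OF W.finV W.L_V pL])
  have fold_points: "fold w \<in> points L" "nz (fold w) = ?p ` nz w" if "w \<in> points W.L" for w
    unfolding fold_def using push_points[OF W.finV W.L_V pL that] by auto
  have u_cap: "?u g \<in> points W.L \<and> fold (?u g) = stretch 1 g" if g: "g \<in> points L" for g
    using g
  proof (cases rule: points_L_cases)
    case cone
    have u: "?u g = (\<lambda>w. if w = None then 1 else 0)" using unfold_caps_cone cone(2) by blast
    then have "w \<in> nz (?u g) \<longleftrightarrow> w \<in> {None}" for w by simp
    then have nzu: "nz (?u g) = {None}" by blast
    moreover have "{None} \<in> W.L" by (simp add: LW wedge_complex_def)
    moreover have "?u g None = 1" "0 \<le> ?u g w" for w using u by simp_all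
    ultimately have pt: "?u g \<in> points W.L" by (simp add: points_def)
    have s: "stretch 1 g v = (if v = apex then 1 else 0)" for v
      using stretch_cone[of g 1 v] cone(2) by (simp add: slope_core_1_0)
    have nzf: "nz (fold (?u g)) = {apex}" using fold_points(2)[OF pt] nzu by simp
    then have "fold (?u g) apex = 1" using points_sum[OF fold_points(1)[OF pt], of "{apex}"] by simp
    moreover have "fold (?u g) v = 0" if "v \<noteq> apex" for v using nzf that by blast
    ultimately have "fold (?u g) = stretch 1 g" using s by (auto simp: fun_eq_iff)
    then show ?thesis using pt by simp
  next
    case (cap j)
    let ?S = "insert apex (G j)" and ?f = "stretch 1 g"
    \<comment> \<open>A section of the vertex map over one cap and the apex. It exhibits
      \<open>unfold_caps\<close> on this cap as a relabelling of the stretched point, which folding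
      undoes.\<close>
    define h where "h v = (if v = apex then None else Some (j, inv_into {1..c} (e j) v))" for v
    have hG: "h ` G j = petal_facet c j"
    proof -
      have "h ` G j = (\<lambda>v. Some (j, inv_into {1..c} (e j) v)) ` G j"
        using apex_G[OF cap(1)] by (intro image_cong) (auto simp: h_def)
      also have "\<dots> = (\<lambda>i. Some (j, i)) ` inv_into {1..c} (e j) ` G j" by (simp add: image_image)
      also have "inv_into {1..c} (e j) ` G j = {1..c}"
        using bij_betw_imp_surj_on[OF bij_betw_inv_into[OF e[OF cap(1)]]] .
      finally show ?thesis by (auto simp: petal_facet_def)
    qed
    have ph: "?p (h v) = v" if "v \<in> ?S" for v
      using that bij_betw_inv_into_right[OF e[OF cap(1)]] by (auto simp: h_def)
    have h_inj: "inj_on h ?S" by (rule inj_on_inverseI[of _ ?p]) (rule ph)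
    have hS: "h ` ?S = insert None (petal_facet c j)" unfolding image_insert hG by (simp add: h_def)
    have fp: "?f \<in> points L" using stretch_points[OF g] by simp
    have eq: "?f v = (if v = apex then 1 - (slope 1 (t j g) * (1 - t j g) + core 1 (t j g))
     else if v \<in> G j then slope 1 (t j g) * (g v - t j g / c) + core 1 (t j g) / c else 0)" for v
      by (rule stretch_cap) (use cap in auto)
    have nzS: "nz ?f \<subseteq> ?S" unfolding eq by auto
    have fp': "?f \<in> points (L \<inter> Pow ?S)" using fp nzS by (simp add: points_def)
    have finS: "finite ?S" using finG[OF cap(1)] by simp
    have hL: "h ` s \<in> W.L" if s: "s \<in> L \<inter> Pow ?S" for s
    proof -
      \<comment> \<open>A facet together with the apex is never a face of \<open>L\<close>. So every
        face of \<open>L\<close> within \<open>?S\<close> is a proper subset and lands in the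
        boundary of the petal simplex.\<close>
      have "?S \<notin> L"
      proof
        assume "?S \<in> L"
        then consider r where "r \<in> K" "?S = r \<or> ?S = insert apex r" | l where "l < m" "?S = G l"
          unfolding L_def by blast
        then show False
        proof cases
          case 1
          then have "G j \<subseteq> insert apex r" by auto
          then have "G j \<subseteq> r" using apex_G[OF cap(1)] by auto
          then show False using G_K[OF cap(1)] simplicialD[OF K(1) 1(1)] by blast
        next
          case 2
          then show False using apex_G by blast
        qed
      qed
      then have "s \<subset> ?S" using s by auto
      then have "h ` s \<subset> h ` ?S" using h_inj by (intro image_strict_mono)
      then have "\<exists>j<m. h ` s \<subset> insert None (Some ` ({j} \<times> {1..Suc (c - 1)}))"
        using hS cap(1) c by (intro exI[of _ j]) (simp add: petal_facet_def)
      then show ?thesis unfolding LW wedge_complex_def by blast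
    qed
    have u: "?u g = push ?S h ?f"
    proof
      fix w
      have ueq: "?u g w = (case w of None \<Rightarrow> 1 - (slope 1 (t j g) * (1 - t j g) + core 1 (t j g))
         | Some (l, i) \<Rightarrow> if l = j \<and> i \<in> {1..c}
           then slope 1 (t j g) * (g (e j i) - t j g / c) + core 1 (t j g) / c else 0)"
        by (rule unfold_caps_cap) (use cap g in auto)
      show "?u g w = push ?S h ?f w"
      proof (cases "w \<in> h ` ?S")
        case True
        then obtain v where v: "w = h v" "v \<in> ?S" by (rule imageE)
        have "push ?S h ?f w = ?f v" unfolding v(1) by (rule push_inj[OF finS h_inj v(2)])
        moreover have "?u g (h v) = ?f v"
        proof (cases "v = apex")
          case False
          then have vG: "v \<in> G j" using v by simp
          have "inv_into {1..c} (e j) v \<in> {1..c}"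
            using bij_betwE[OF bij_betw_inv_into[OF e[OF cap(1)]]] vG by blast
          moreover have "e j (inv_into {1..c} (e j) v) = v" using ph[OF v(2)] False by (simp add: h_def)
          ultimately show ?thesis using ueq v(1) False vG unfolding eq by (simp add: h_def)
        qed (use ueq v(1) in \<open>simp add: h_def eq\<close>)
        ultimately show ?thesis using v(1) by simp
      next
        case False
        then have "w \<notin> insert None (petal_facet c j)" by (simp only: hS not_False_eq_True)
        then have "?u g w = 0" unfolding ueq by (auto simp: petal_facet_def split: option.split)
        then show ?thesis using push_outside[OF False] by simp
      qed
    qed
    have "?u g \<in> points W.L" unfolding u by (rule push_points(1)[OF finS _ hL fp']) auto
    moreover have "fold (?u g) = stretch 1 g"
    proof -
      have "h ` ?S \<subseteq> W.V" unfolding hS using cap(1) by (auto simp: W.V_def)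
      then have "fold (?u g) = push ?S (\<lambda>v. ?p (h v)) ?f"
        unfolding fold_def u by (rule push_comp[OF finS W.finV])
      also have "\<dots> = ?f" using ph by (rule push_id[OF finS nzS])
      finally show ?thesis .
    qed
    ultimately show ?thesis by blast
  qed
  have u_c: "continuous_map (geometric_realization L) (geometric_realization W.L) ?u"
    unfolding geometric_realization_points continuous_map_function_space
  proof (intro conjI allI ballI)
    let ?X = "function_space (points L)"
    have ct: "continuous_map ?X euclideanreal (t j)" if "j < m" for j
      using continuous_t[OF that] by (simp add: geometric_realization_points)
    have cs: "continuous_map ?X euclideanreal (\<lambda>g. slope 1 (t j g))"
         "continuous_map ?X euclideanreal (\<lambda>g. core 1 (t j g))" if "j < m" for j
      unfolding slope_def core_def by (intro continuous_intros ct that continuous_map_real_max; simp)+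
    show "continuous_map ?X euclideanreal (\<lambda>g. ?u g w)" for w
    proof (cases w)
      case None
      then show ?thesis unfolding unfold_caps_def
        by simp (intro continuous_map_diff continuous_map_add continuous_map_sum continuous_map_real_mult
            continuous_map_coordinate ct cs finG; simp)
    next
      case (Some ji)
      obtain j i where ji: "ji = (j, i)" by fastforce
      show ?thesis
      proof (cases "j < m \<and> i \<in> {1..c}")
        case True
        have "continuous_map ?X euclideanreal (\<lambda>g. slope 1 (t j g) * (g (e j i) - t j g / c) + core 1 (t j g) / c)"
          using True c by (intro continuous_map_diff continuous_map_add continuous_map_real_mult continuous_map_real_divide
            continuous_map_coordinate ct cs) auto
        then show ?thesis using True unfolding unfold_caps_def Some ji by simp
      next
        case False
        then show ?thesis unfolding unfold_caps_def Some ji by (auto simp del: atLeastAtMost_iff)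
      qed
    qed
  qed (use u_cap in auto)
  have uf: "?u (fold w) = W.stretch 1 w" if w: "w \<in> points W.L" for w
    using w
  proof (cases rule: W.points_L_cases)
    case cone
    have s: "W.stretch 1 w v = (if v = None then 1 else 0)" for v
      using W.stretch_cone[of w 1 v] cone(2) by (simp add: W.slope_core_1_0)
    have "nz (fold w) \<in> K \<union> insert apex ` K"
    proof -
      from cone(1) obtain r where r: "r \<in> petal_base c m" "nz w = r \<or> nz w = insert None r" by blast
      from r(2) have "nz (fold w) = ?p ` r \<or> nz (fold w) = insert apex (?p ` r)"
      proof
        assume "nz w = insert None r"
        moreover have "?p ` insert None r = insert apex (?p ` r)" by simp
        ultimately show ?thesis using fold_points(2)[OF w] by metis
      qed (use fold_points(2)[OF w] in metis)
      then show ?thesis using p_base[OF r(1)] by auto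
    qed
    note base = this
    have "t j (fold w) = 0" if j: "j < m" for j
      using fold_points(1)[OF w]
    proof (cases rule: points_L_cases)
      case (cap l)
      then have "G l \<in> K \<union> insert apex ` K" using base by simp
      then show ?thesis using G_K[OF cap(1)] apex_G[OF cap(1)] by blast
    qed (use j in blast)
    then have "?u (fold w) = (\<lambda>w. if w = None then 1 else 0)" by (rule unfold_caps_cone)
    then show ?thesis using s by (simp add: fun_eq_iff)
  next
    case (cap j)
    let ?g = "fold w"
    have gp: "?g \<in> points L" by (rule fold_points(1)[OF w])
    have nzg: "nz ?g = G j" using fold_points(2)[OF w] cap(2) pG[OF cap(1)] by simp
    \<comment> \<open>Different petals may be folded onto common vertices, but the support of
      \<open>w\<close> is a single petal facet, where the vertex map is injective; only one summand
      of the fibre sum survives.\<close>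
    have val: "?g (?p u) = w u" if u: "u \<in> petal_facet c j" for u
    proof -
      have "?g (?p u) = (\<Sum>v\<in>{v \<in> W.V. ?p v = ?p u}. w v)" by (simp add: fold_def push_def)
      also have "\<dots> = (\<Sum>v\<in>{u}. w v)"
      proof (rule sum.mono_neutral_right)
        show "finite {v \<in> W.V. ?p v = ?p u}" using W.finV by simp
        show "{u} \<subseteq> {v \<in> W.V. ?p v = ?p u}" using u cap(1) by (auto simp: W.V_def)
        show "\<forall>v\<in>{v \<in> W.V. ?p v = ?p u} - {u}. w v = 0"
        proof (intro ballI, rule ccontr)
          fix v assume v: "v \<in> {v \<in> W.V. ?p v = ?p u} - {u}" "w v \<noteq> 0"
          then have "v \<in> petal_facet c j" using cap(2) by auto
          then show False using v u p_inj[OF cap(1)] by (auto dest: inj_onD)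
        qed
      qed
      finally show ?thesis by simp
    qed
    have tg: "t j ?g = W.t j w"
    proof -
      have "?g ` G j = (\<lambda>u. ?g (?p u)) ` petal_facet c j" unfolding pG[OF cap(1), symmetric] by (simp add: image_image)
      also have "\<dots> = w ` petal_facet c j" using val by (intro image_cong) auto
      finally show ?thesis by (simp add: t_def W.t_def)
    qed
    have t0: "t i ?g = 0" if i: "i < m" "i \<noteq> j" for i
      using gp
    proof (cases rule: points_L_cases)
      case (cap l)
      then have "l = j" using nzg injG \<open>j < m\<close> by (auto dest: inj_onD)
      then show ?thesis using cap i by blast
    qed (use i in blast)
    show ?thesis
    proof
      fix x
      have ueq: "?u ?g x = (case x of None \<Rightarrow> 1 - (slope 1 (t j ?g) * (1 - t j ?g) + core 1 (t j ?g))
         | Some (l, i) \<Rightarrow> if l = j \<and> i \<in> {1..c}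
           then slope 1 (t j ?g) * (?g (e j i) - t j ?g / c) + core 1 (t j ?g) / c else 0)"
        by (rule unfold_caps_cap[OF cap(1) nzg t0 gp])
      have seq: "W.stretch 1 w x = (if x = None then 1 - (W.slope 1 (W.t j w) * (1 - W.t j w) + W.core 1 (W.t j w))
        else if x \<in> petal_facet c j then W.slope 1 (W.t j w) * (w x - W.t j w / c) + W.core 1 (W.t j w) / c else 0)"
        by (rule W.stretch_cap) (use cap in auto)
      show "?u ?g x = W.stretch 1 w x"
      proof (cases x)
        case None
        then show ?thesis unfolding ueq seq tg by simp
      next
        case (Some li)
        obtain l i where li: "li = (l, i)" by fastforce
        have mem: "x \<in> petal_facet c j \<longleftrightarrow> l = j \<and> i \<in> {1..c}" by (auto simp: Some li petal_facet_def)
        show ?thesis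
        proof (cases "l = j \<and> i \<in> {1..c}")
          case True
          then have "?g (e j i) = w x" using val[of x] mem by (simp add: Some li)
          then show ?thesis using True mem unfolding ueq seq tg by (simp add: Some li)
        next
          case False
          have "W.stretch 1 w x = 0" unfolding seq using False mem Some by (simp only: if_False option.distinct)
          moreover have "?u ?g x = 0"
            unfolding ueq by (simp only: Some li option.case prod.case if_not_P[OF False])
          ultimately show ?thesis by simp
        qed
      qed
    qed
  qed
  show ?thesis unfolding homotopy_equivalent_space_def LW[symmetric]
  proof (intro exI conjI)
    show "homotopic_with (\<lambda>_. True) (geometric_realization L) (geometric_realization L) (fold \<circ> ?u) id"
    proof (rule homotopic_with_trans)
      show "homotopic_with (\<lambda>_. True) (geometric_realization L) (geometric_realization L) (fold \<circ> ?u) (stretch 1)"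
        by (rule homotopic_with_equal) (use continuous_map_compose[OF u_c fold_c] u_cap in \<open>auto simp: geometric_realization_points\<close>)
      show "homotopic_with (\<lambda>_. True) (geometric_realization L) (geometric_realization L) (stretch 1) id"
        using stretch_homotopic homotopic_with_sym by blast
    qed
    show "homotopic_with (\<lambda>_. True) (geometric_realization W.L) (geometric_realization W.L) (?u \<circ> fold) id"
    proof (rule homotopic_with_trans)
      show "homotopic_with (\<lambda>_. True) (geometric_realization W.L) (geometric_realization W.L) (?u \<circ> fold) (W.stretch 1)"
        by (rule homotopic_with_equal) (use continuous_map_compose[OF fold_c u_c] uf in \<open>auto simp: geometric_realization_points\<close>)
      show "homotopic_with (\<lambda>_. True) (geometric_realization W.L) (geometric_realization W.L) (W.stretch 1) id"
        using W.stretch_homotopic homotopic_with_sym by blast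
    qed
  qed (fact u_c fold_c)+
qed

end

section \<open>Shellings\<close>

text \<open>
  Every facet \<open>F\<close> contributes the faces between its restriction \<open>R\<close> and \<open>F\<close>; the remaining
  faces of \<open>F\<close> belong to the earlier facets. All facets have \<open>c\<close> vertices.
\<close>

inductive shelling :: "nat \<Rightarrow> 'a set set \<Rightarrow> bool" for c where
  simplex: "finite F \<Longrightarrow> card F = c \<Longrightarrow> shelling c (Pow F)"
| attach: "shelling c K \<Longrightarrow> finite F \<Longrightarrow> card F = c \<Longrightarrow> R \<subseteq> F \<Longrightarrow> R \<noteq> {} \<Longrightarrow> R \<notin> K \<Longrightarrow>
    (\<And>s. s \<subseteq> F \<Longrightarrow> \<not> R \<subseteq> s \<Longrightarrow> s \<in> K) \<Longrightarrow> shelling c (K \<union> {s. R \<subseteq> s \<and> s \<subseteq> F})"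

lemma simplicial_Un_interval:
  assumes K: "simplicial K" and F: "finite F" and low: "\<And>s. s \<subseteq> F \<Longrightarrow> \<not> R \<subseteq> s \<Longrightarrow> s \<in> K"
  shows "simplicial (K \<union> {s. R \<subseteq> s \<and> s \<subseteq> F})"
  unfolding simplicial_def
proof (intro ballI conjI subsetI)
  fix s assume s: "s \<in> K \<union> {s. R \<subseteq> s \<and> s \<subseteq> F}"
  then show "finite s" using F simplicial_finite[OF K] finite_subset[of s F] by blast
  fix r assume "r \<in> Pow s"
  then have r: "r \<subseteq> s" by simp
  show "r \<in> K \<union> {s. R \<subseteq> s \<and> s \<subseteq> F}"
  proof (cases "s \<in> K")
    case True
    then show ?thesis using r simplicialD[OF K] by blast
  next
    case False
    then have "r \<subseteq> F" using s r by auto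
    then show ?thesis using low[of r] by (cases "R \<subseteq> r") simp_all
  qed
qed

lemma shelling_complex:
  assumes "shelling c K"
  shows "simplicial K" "finite (\<Union>K)" "{} \<in> K"
  using assms
proof (induction rule: shelling.induct)
  case (simplex F)
  show "simplicial (Pow F)" using simplex unfolding simplicial_def by (auto intro: finite_subset)
  show "finite (\<Union>(Pow F))" using simplex by simp
  show "{} \<in> Pow F" by simp
next
  case (attach K F R)
  show "simplicial (K \<union> {s. R \<subseteq> s \<and> s \<subseteq> F})"
    by (rule simplicial_Un_interval[OF attach.IH(1) attach.hyps(2,7)])
  have "\<Union>(K \<union> {s. R \<subseteq> s \<and> s \<subseteq> F}) \<subseteq> \<Union>K \<union> F" by auto
  then show "finite (\<Union>(K \<union> {s. R \<subseteq> s \<and> s \<subseteq> F}))"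
    using attach.IH(2) attach.hyps(2) finite_subset by blast
  show "{} \<in> K \<union> {s. R \<subseteq> s \<and> s \<subseteq> F}" using attach.IH(3) by simp
qed

lemma shelling_dim:
  assumes "shelling c K"
  shows "s \<in> K \<Longrightarrow> card s \<le> c" "\<exists>s\<in>K. card s = c"
  using assms
proof (induction rule: shelling.induct)
  case (attach K F R)
  { case 1
    then show ?case using attach card_mono[of F s] by auto }
  { case 2
    then show ?case using attach by auto }
qed (auto intro: card_mono)

lemma shelling_image:
  assumes "shelling c K" "inj f"
  shows "shelling c ((`) f ` K)"
  using assms(1)
proof (induction rule: shelling.induct)
  case (simplex F)
  then show ?case using assms(2) by (auto simp: image_Pow_surj card_image inj_on_subset intro!: shelling.simplex)
next
  case (attach K F R)
  have inj: "f ` s \<subseteq> f ` r \<longleftrightarrow> s \<subseteq> r" for s r using assms(2) by (rule inj_image_subset_iff)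
  have "(`) f ` {s. R \<subseteq> s \<and> s \<subseteq> F} = {s. f ` R \<subseteq> s \<and> s \<subseteq> f ` F}"
  proof (intro equalityI subsetI)
    fix s assume s: "s \<in> {s. f ` R \<subseteq> s \<and> s \<subseteq> f ` F}"
    then obtain r where r: "s = f ` r" "r \<subseteq> F" by (auto simp: subset_image_iff)
    then have "R \<subseteq> r" using s inj by auto
    then show "s \<in> (`) f ` {s. R \<subseteq> s \<and> s \<subseteq> F}" using r by auto
  qed auto
  moreover have "shelling c ((`) f ` K \<union> {s. f ` R \<subseteq> s \<and> s \<subseteq> f ` F})"
  proof (rule shelling.attach)
    show "card (f ` F) = c" using attach assms(2) by (simp add: card_image inj_on_subset)
    show "f ` R \<notin> (`) f ` K"
    proof
      assume "f ` R \<in> (`) f ` K"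
      then obtain s where "s \<in> K" "f ` R = f ` s" by auto
      then show False using attach.hyps inj_image_eq_iff[OF assms(2)] by auto
    qed
    show "s \<in> (`) f ` K" if sF: "s \<subseteq> f ` F" "\<not> f ` R \<subseteq> s" for s
    proof -
      obtain r where r: "r \<subseteq> F" "s = f ` r" using sF(1) by (auto simp: subset_image_iff)
      then have "\<not> R \<subseteq> r" using sF(2) inj by simp
      then show ?thesis using attach.hyps(7) r by blast
    qed
  qed (use attach in auto)
  ultimately show ?case by (simp add: image_Un)
qed

lemma simplicial_cone:
  assumes "simplicial M" "simplicial K" "K \<subseteq> M"
  shows "simplicial (M \<union> insert x ` K)"
  unfolding simplicial_def
proof (intro ballI conjI subsetI)
  fix s assume s: "s \<in> M \<union> insert x ` K"
  then show "finite s" using assms simplicial_finite by auto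
  fix r assume "r \<in> Pow s"
  then have r: "r \<subseteq> s" by simp
  show "r \<in> M \<union> insert x ` K"
  proof (cases "s \<in> M")
    case True
    then show ?thesis using r simplicialD[OF assms(1)] by blast
  next
    case False
    then obtain q where q: "q \<in> K" "s = insert x q" using s by auto
    have "r - {x} \<in> K" using q r by (intro simplicialD[OF assms(2) q(1)]) auto
    then show ?thesis using assms(3) by (cases "x \<in> r") (auto intro: image_eqI[of _ _ "r - {x}"])
  qed
qed

text \<open>
  The homology facets, those equal to their restriction, are put last; the rest of the complex
  is contractible, which is expressed by saying that coning it off changes nothing.
\<close>

definition contractible_core :: "nat \<Rightarrow> 'a set set \<Rightarrow> 'a set set \<Rightarrow> 'a set set \<Rightarrow> bool" where
  "contractible_core c K K' \<F> \<longleftrightarrow>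
    K = K' \<union> \<F> \<and> simplicial K' \<and> {} \<in> K' \<and> finite \<F> \<and> K' \<inter> \<F> = {} \<and>
    (\<forall>F\<in>\<F>. finite F \<and> card F = c \<and> bd F \<subseteq> K') \<and>
    (\<forall>M x. simplicial M \<longrightarrow> K' \<subseteq> M \<longrightarrow> (\<forall>s\<in>M. x \<notin> s) \<longrightarrow>
       geometric_realization (M \<union> insert x ` K') homotopy_equivalent_space geometric_realization M)"

lemma contractible_coreD:
  assumes "contractible_core c K K' \<F>"
  shows "K = K' \<union> \<F>" "simplicial K'" "{} \<in> K'" "finite \<F>" "K' \<inter> \<F> = {}"
    and "F \<in> \<F> \<Longrightarrow> finite F" "F \<in> \<F> \<Longrightarrow> card F = c" "F \<in> \<F> \<Longrightarrow> bd F \<subseteq> K'"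
    and "simplicial M \<Longrightarrow> K' \<subseteq> M \<Longrightarrow> (\<And>s. s \<in> M \<Longrightarrow> x \<notin> s) \<Longrightarrow>
       geometric_realization (M \<union> insert x ` K') homotopy_equivalent_space geometric_realization M"
  using assms unfolding contractible_core_def by simp_all

text \<open>The cone is built interval by interval. For R different from F, coning the new interval
  adds all faces between \<open>insert x R\<close> and \<open>insert x F\<close>, which is again a
  collapsible interval. The ambient complex \<open>M\<close> has to be arbitrary because it must
  finally contain the homology facets as well.\<close>

lemma shelling_decomposition:
  fixes K :: "'a set set"
  assumes "shelling c K" "0 < c"
  shows "\<exists>K' \<F>. contractible_core c K K' \<F>"
  using assms(1)
proof (induction rule: shelling.induct)
  case (simplex F)
  have "geometric_realization (M \<union> insert x ` Pow F) homotopy_equivalent_space geometric_realization M"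
    if M: "simplicial M" "Pow F \<subseteq> M" "\<forall>s\<in>M. x \<notin> s" for M and x :: 'a
  proof -
    have x: "x \<notin> F" "F \<noteq> {}" using M simplex assms(2) by auto
    \<comment> \<open>Coning off a full simplex adds one interval with free face {x}; it is
      collapsible because \<open>F\<close> is nonempty, which is where 0 < c enters.\<close>
    have eq: "insert x ` Pow F = {s. {x} \<subseteq> s \<and> s \<subseteq> insert x F}"
    proof (intro equalityI subsetI)
      fix s assume s: "s \<in> {s. {x} \<subseteq> s \<and> s \<subseteq> insert x F}"
      then have "s - {x} \<in> Pow F" "s = insert x (s - {x})" by auto
      then show "s \<in> insert x ` Pow F" by blast
    qed auto
    have F: "simplicial (Pow F)" using simplex unfolding simplicial_def by (auto intro: finite_subset)
    show ?thesis unfolding eq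
    proof (rule collapse_homotopy_equivalent[OF M(1)])
      show "simplicial (M \<union> {s. {x} \<subseteq> s \<and> s \<subseteq> insert x F})"
        unfolding eq[symmetric] by (rule simplicial_cone[OF M(1) F M(2)])
    next
      show "{x} \<notin> M" using M(3) by blast
      show "{x} \<subset> insert x F" using x by auto
    qed simp
  qed
  note cone = this
  have simp: "simplicial (Pow F)" using simplex unfolding simplicial_def by (auto intro: finite_subset)
  show ?case
  proof (rule exI[of _ "Pow F"], rule exI[of _ "{}"], unfold contractible_core_def, intro conjI allI impI)
    fix M x assume "simplicial M" "Pow F \<subseteq> M" "\<forall>s\<in>M. x \<notin> s"
    then show "geometric_realization (M \<union> insert x ` Pow F) homotopy_equivalent_space geometric_realization M"
      by (rule cone)
  qed (simp_all add: simp)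
next
  case (attach K F R)
  let ?I = "{s. R \<subseteq> s \<and> s \<subseteq> F}"
  obtain K' \<F> where core: "contractible_core c K K' \<F>" using attach.IH by (elim exE)
  note KF = contractible_coreD(1-5)[OF core] and fac = contractible_coreD(6-8)[OF core]
    and cone = contractible_coreD(9)[OF core]
  \<comment> \<open>Homology facets have c vertices, hence are never proper faces of
    \<open>F\<close>: attaching along the core alone is legitimate although they have been set
    aside.\<close>
  have low: "s \<in> K'" if "s \<subseteq> F" "\<not> R \<subseteq> s" for s
  proof -
    have "s \<in> K" using attach.hyps(7) that .
    moreover have "s \<notin> \<F>"
    proof
      assume "s \<in> \<F>"
      moreover have "s \<subset> F" using that attach.hyps(4) by auto
      then have "card s < card F" using attach.hyps(2) by (rule psubset_card_mono[rotated])
      ultimately show False using fac attach.hyps(3) by auto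
    qed
    ultimately show ?thesis using KF by blast
  qed
  show ?case
  proof (cases "R = F")
    case True
    then have I: "?I = {F}" by auto
    have bdF: "bd F \<subseteq> K'" using low True by auto
    have F: "F \<notin> K'" using True attach.hyps KF by auto
    show ?thesis unfolding I
    proof (rule exI[of _ K'], rule exI[of _ "insert F \<F>"], unfold contractible_core_def, intro conjI allI impI)
      show "\<forall>F'\<in>insert F \<F>. finite F' \<and> card F' = c \<and> bd F' \<subseteq> K'"
        using fac attach.hyps(2,3) bdF by simp
      show "K \<union> {F} = K' \<union> insert F \<F>" using KF(1) by simp
      show "K' \<inter> insert F \<F> = {}" using KF(5) F by simp
      fix M x assume "simplicial M" "K' \<subseteq> M" "\<forall>s\<in>M. x \<notin> s"
      then show "geometric_realization (M \<union> insert x ` K') homotopy_equivalent_space geometric_realization M"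
        by (intro cone) simp_all
    qed (simp_all add: KF)
  next
    case False
    let ?K = "K' \<union> ?I"
    have simp_K: "simplicial ?K"
      by (rule simplicial_Un_interval[OF KF(2) attach.hyps(2) low])
    have "geometric_realization (M \<union> insert x ` ?K) homotopy_equivalent_space geometric_realization M"
      if M: "simplicial M" "?K \<subseteq> M" "\<forall>s\<in>M. x \<notin> s" for M and x :: 'a
    proof -
      let ?C = "M \<union> insert x ` K'"
      have x: "x \<notin> F" "x \<notin> R" using M(2,3) attach.hyps(4) by auto
      have eq: "insert x ` ?I = {s. insert x R \<subseteq> s \<and> s \<subseteq> insert x F}"
      proof (intro equalityI subsetI)
        fix s assume s: "s \<in> {s. insert x R \<subseteq> s \<and> s \<subseteq> insert x F}"
        then have "s - {x} \<in> ?I" "s = insert x (s - {x})" using x by auto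
        then show "s \<in> insert x ` ?I" by blast
      qed auto
      have U: "M \<union> insert x ` ?K = ?C \<union> {s. insert x R \<subseteq> s \<and> s \<subseteq> insert x F}"
        unfolding image_Un eq by blast
      have C: "simplicial ?C" using M by (intro simplicial_cone[OF M(1) KF(2)]) auto
      have "geometric_realization (M \<union> insert x ` ?K) homotopy_equivalent_space geometric_realization ?C"
        unfolding U
      proof (rule collapse_homotopy_equivalent[OF C])
        show "simplicial (?C \<union> {s. insert x R \<subseteq> s \<and> s \<subseteq> insert x F})"
          unfolding U[symmetric] by (rule simplicial_cone[OF M(1) simp_K M(2)])
        show "insert x R \<notin> ?C"
        proof
          assume "insert x R \<in> ?C"
          then obtain s where s: "s \<in> K'" "insert x R = insert x s" using M(3) by auto
          then have "x \<notin> s" using M(2,3) by auto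
          then have "R = s" using s(2) x(2) by auto
          then show False using s(1) attach.hyps(6) KF(1) by auto
        qed
        show "insert x R \<subset> insert x F" using False attach.hyps(4) x by auto
      qed auto
      also have "geometric_realization ?C homotopy_equivalent_space geometric_realization M"
        using M by (intro cone) auto
      finally show ?thesis .
    qed
    note con = this
    have U: "K \<union> ?I = ?K \<union> \<F>" "?K \<inter> \<F> = {}"
    proof -
      show "K \<union> ?I = ?K \<union> \<F>" using KF(1) by auto
      have "s \<notin> \<F>" if "R \<subseteq> s" for s
      proof
        assume "s \<in> \<F>"
        then have "R \<in> K" using that KF(1) simplicialD[OF shelling_complex(1)[OF attach.hyps(1)]] by blast
        then show False using attach.hyps(6) by simp
      qed
      then show "?K \<inter> \<F> = {}" using KF(5) by auto
    qed
    have fac': "\<forall>F\<in>\<F>. finite F \<and> card F = c \<and> bd F \<subseteq> ?K"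
      using fac by (simp add: le_supI1)
    show ?thesis
    proof (rule exI[of _ ?K], rule exI[of _ \<F>], unfold contractible_core_def, intro conjI allI impI)
      fix M x assume "simplicial M" "?K \<subseteq> M" "\<forall>s\<in>M. x \<notin> s"
      then show "geometric_realization (M \<union> insert x ` ?K) homotopy_equivalent_space geometric_realization M"
        by (rule con)
    qed (fact U simp_K KF fac' | simp add: KF)+
  qed
qed

text \<open>With c = 0 nothing can be attached: \<open>F\<close> is empty, while \<open>R\<close>
  would have to be nonempty.\<close>

lemma shelling_0: "shelling 0 K \<Longrightarrow> K = {{}}"
  by (induction rule: shelling.induct) auto

lemma realization_empty: "geometric_realization {{}} = trivial_topology"
  unfolding geometric_realization_def by (auto simp: subtopology_trivial_iff)

theorem shelling_wedge_of_spheres: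
  fixes K :: "'a set set"
  assumes K: "shelling c K"
  shows "\<exists>m. geometric_realization K homotopy_equivalent_space wedge_of_spheres (int c - 1) m"
proof (cases "c = 0")
  case True
  then have "K = {{}}" using shelling_0 K by metis
  then show ?thesis using True by (simp add: realization_empty wedge_of_spheres_def homeomorphic_imp_homotopy_equivalent_space homeomorphic_empty_space_eq)
next
  case False
  \<comment> \<open>The embedding into the option type frees the vertex \<open>None\<close> to serve
    as apex.\<close>
  let ?K = "(`) Some ` K"
  have shK: "shelling c ?K" by (rule shelling_image[OF K inj_Some])
  obtain K' \<F> where core: "contractible_core c ?K K' \<F>" using shelling_decomposition[OF shK] False by blast
  note KF = contractible_coreD(1-5)[OF core] and fac = contractible_coreD(6-8)[OF core]
    and cone = contractible_coreD(9)[OF core]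
  have none: "\<forall>s\<in>?K. None \<notin> s" by auto
  have fin: "finite (\<Union>?K)" by (rule shelling_complex(2)[OF shK])
  obtain G where G: "bij_betw G {0..<card \<F>} \<F>" using ex_bij_betw_nat_finite[OF KF(4)] by blast
  let ?m = "card \<F>"
  have GF: "G j \<in> \<F>" if "j < ?m" for j using bij_betwE[OF G] that by simp
  interpret C: capped_complex K' None G ?m c
  proof
    show "finite (\<Union>K')" using fin unfolding KF(1) by simp
    show "None \<notin> s" if "s \<in> K'" for s using none that unfolding KF(1) by blast
    show "None \<notin> G j" if "j < ?m" for j using none GF[OF that] unfolding KF(1) by blast
    show "G j \<notin> K'" if "j < ?m" for j using KF(5) GF[OF that] by blast
    show "inj_on G {..<?m}" using bij_betw_imp_inj_on[OF G] by (simp add: lessThan_atLeast0)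
  qed (use KF fac GF False in auto)
  have "\<exists>e. bij_betw e {1..c} (G j)" if "j < ?m" for j
    using fac[OF GF[OF that]] by (intro finite_same_card_bij) auto
  then obtain e where "\<And>j. j < ?m \<Longrightarrow> bij_betw (e j) {1..c} (G j)" by metis
  note W = C.realization_wedge_complex[OF this]
  have "G ` {..<?m} = \<F>" using bij_betw_imp_surj_on[OF G] by (simp add: lessThan_atLeast0)
  \<comment> \<open>The capped complex is the original one with its core coned off, which by
    construction of the core does not change the homotopy type.\<close>
  then have L: "C.L = ?K \<union> insert None ` K'" unfolding C.L_def KF(1) by auto
  have d: "nat (int c - 1) = c - 1" using False by simp
  have "geometric_realization K homotopy_equivalent_space geometric_realization ?K"
    using relabel_homotopy_equivalent[of "\<Union>K" K Some] shelling_complex(2)[OF K]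
    by (subst homotopy_equivalent_space_sym) auto
  also have "geometric_realization ?K homotopy_equivalent_space geometric_realization C.L"
    unfolding L using cone[OF shelling_complex(1)[OF shK], of None] KF(1) none
    by (subst homotopy_equivalent_space_sym) simp
  also have "geometric_realization C.L homotopy_equivalent_space geometric_realization (wedge_complex (c - 1) ?m)"
    by (rule W)
  also have "geometric_realization (wedge_complex (c - 1) ?m) homotopy_equivalent_space wedge_of_spheres (int c - 1) ?m"
    using wedge_homeomorphic[of ?m "c - 1"] False d unfolding wedge_of_spheres_def
    by (subst homotopy_equivalent_space_sym) (simp add: homeomorphic_imp_homotopy_equivalent_space)
  finally show ?thesis by blast
qed

section \<open>Homology of shellable complexes\<close>

lemma trivial_group_exact:
  assumes "exact_seq ([G3, G2, G1], [g, f])" "trivial_group G1" "trivial_group G3"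
  shows "trivial_group G2"
proof -
  have gf: "group_hom G1 G2 f" "group_hom G2 G3 g" and ker: "kernel G2 G3 g = f ` carrier G1"
    using assms(1) by (auto simp: group_hom_def group_hom_axioms_def)
  have "carrier G2 \<subseteq> f ` carrier G1"
  proof
    fix x assume x: "x \<in> carrier G2"
    then have "g x \<in> carrier G3" using gf(2) group_hom.hom_closed by fastforce
    then have "x \<in> kernel G2 G3 g" using x assms(3) by (simp add: kernel_def trivial_group_def)
    then show "x \<in> f ` carrier G1" using ker by simp
  qed
  also have "f ` carrier G1 = {\<one>\<^bsub>G2\<^esub>}"
    using assms(2) group_hom.hom_one[OF gf(1)] by (simp add: trivial_group_def)
  finally show ?thesis
    using gf(2) group.trivial_group_alt group_hom.axioms(1) by blast
qed

lemma trivial_reduced_homology_homotopy_equivalent: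
  assumes "X homotopy_equivalent_space Y" "trivial_group (reduced_homology_group i Y)"
  shows "trivial_group (reduced_homology_group i X)"
  using isomorphic_group_triviality[OF homotopy_equivalent_space_imp_isomorphic_reduced_homology_groups[OF assms(1)]]
    assms(2) by simp

lemma contractible_simplex:
  assumes F: "finite F" "F \<noteq> {}"
  shows "contractible_space (geometric_realization (Pow F))"
proof -
  obtain x where x: "x \<in> F" using F by auto
  define e where "e v = (if v = x then 1 else 0 :: real)" for v
  have sP: "simplicial (Pow F)" using F unfolding simplicial_def by (auto intro: finite_subset)
  have FP: "F \<in> Pow F" by simp
  have e: "e \<in> points (Pow F)"
    by (rule pointsI[OF _ _ FP sP]) (use x F in \<open>auto simp: e_def\<close>)
  have "homotopic_with (\<lambda>_. True) (function_space (points (Pow F))) (function_space (points (Pow F))) id (\<lambda>_. e)"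
  proof (rule linear_homotopy)
    fix f :: "'a \<Rightarrow> real" and t :: real
    assume f: "f \<in> topspace (function_space (points (Pow F)))" and t: "0 \<le> t" "t \<le> 1"
    then have fP: "f \<in> points (Pow F)" by simp
    show "(\<lambda>v. (1 - t) * id f v + t * e v) \<in> points (Pow F)"
      using points_convex[OF fP e sP FP _ _ t] points_nz[OF e] points_nz[OF fP] by simp
  qed (use e in \<open>simp_all add: continuous_map_function_space continuous_map_coordinate\<close>)
  then show ?thesis unfolding contractible_space_def geometric_realization_points by blast
qed

section \<open>Attaching a facet along its boundary\<close>

locale attached_facet =
  fixes K :: "'a set set" and F :: "'a set"
  assumes K: "simplicial K" and F: "finite F" "F \<noteq> {}" "F \<notin> K" and bdF: "bd F \<subseteq> K"
begin

definition m :: "('a \<Rightarrow> real) \<Rightarrow> real" where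
  "m f = Min (f ` F)"

definition P :: "('a \<Rightarrow> real) set" where
  "P = points (K \<union> {F})"

abbreviation c :: real where "c \<equiv> real (card F)"

text \<open>With a + c * b = 1 this is a homothety about the barycenter of \<open>F\<close>. On the
  open facet all projections and homotopies below are of this form, so their effect is read off from
  \<open>m_affine\<close>.\<close>

definition affine :: "real \<Rightarrow> real \<Rightarrow> ('a \<Rightarrow> real) \<Rightarrow> 'a \<Rightarrow> real" where
  "affine a b f v = (if v \<in> F then a * f v + b else 0)"

lemma c_pos: "0 < c"
  using F by (simp add: card_gt_0_iff)

lemma m_affine: assumes "0 \<le> a" shows "m (affine a b f) = a * m f + b"
proof -
  have "m f \<in> f ` F" unfolding m_def using F by (intro Min_in) auto
  then obtain w where w: "w \<in> F" "f w = m f" by (metis imageE)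
  show ?thesis unfolding m_def[of "affine a b f"]
  proof (rule Min_eqI)
    show "a * m f + b \<in> affine a b f ` F" using w by (intro image_eqI[of _ _ w]) (auto simp: affine_def)
    show "a * m f + b \<le> y" if y: "y \<in> affine a b f ` F" for y
    proof -
      from y obtain v where v: "v \<in> F" "y = a * f v + b" by (auto simp: affine_def)
      have "m f \<le> f v" unfolding m_def using F v by simp
      then show ?thesis using v assms by (simp add: mult_left_mono)
    qed
  qed (use F in simp)
qed

lemma simplicial_KF: "simplicial (K \<union> {F})"
  unfolding simplicial_def
proof (intro ballI conjI subsetI)
  fix s assume s: "s \<in> K \<union> {F}"
  then show "finite s" using F simplicial_finite[OF K] by auto
  fix r assume "r \<in> Pow s"
  then show "r \<in> K \<union> {F}" using s simplicialD[OF K, of s r] bdF by (cases "r = F") auto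
qed

lemma m_le: "f \<in> P \<Longrightarrow> v \<in> F \<Longrightarrow> m f \<le> f v"
  unfolding m_def using F by simp

lemma m_nonneg: assumes "f \<in> P" shows "0 \<le> m f"
proof -
  have "m f \<in> f ` F" unfolding m_def using F by (intro Min_in) auto
  then show ?thesis using points_nonneg assms unfolding P_def by (metis imageE)
qed

lemma nz_F: assumes "f \<in> P" "0 < m f" shows "nz f = F"
proof -
  have "F \<subseteq> nz f" using m_le[OF assms(1)] assms(2) by fastforce
  moreover have "nz f \<in> K \<union> {F}" using assms(1) points_nz unfolding P_def by blast
  ultimately show ?thesis using F simplicialD[OF K] by blast
qed

lemma nz_K: assumes "f \<in> P" "m f = 0" shows "nz f \<in> K"
proof -
  have "m f \<in> f ` F" unfolding m_def using F by (intro Min_in) auto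
  then have "nz f \<noteq> F" using assms(2) by auto
  then show ?thesis using assms(1) points_nz unfolding P_def by blast
qed

lemma affine_points:
  assumes f: "f \<in> P" "nz f \<subseteq> F" and ab: "0 \<le> a" "0 \<le> a * m f + b" "a + c * b = 1"
  shows "affine a b f \<in> P"
  unfolding P_def
proof (rule pointsI[where s = F, OF _ _ _ simplicial_KF])
  fix v
  have "a * m f + b \<le> a * f v + b" if "v \<in> F" using m_le[OF f(1) that] ab(1) by (simp add: mult_left_mono)
  then show "0 \<le> affine a b f v" using ab(2) unfolding affine_def by fastforce
next
  have "sum f F = 1" using points_sum f F unfolding P_def by blast
  then have "(\<Sum>v\<in>F. a * f v + b) = a + c * b" by (simp add: sum.distrib flip: sum_distrib_left)
  then show "sum (affine a b f) F = 1" using ab(3) by (simp add: affine_def)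
qed (auto simp: affine_def)

text \<open>The excisive pair: \<open>A\<close> is the complement of the barycenter, the only point
  with c * m f = 1, and \<open>B\<close> is the open facet.\<close>

definition A where "A = {f \<in> P. c * m f < 1}"
definition B where "B = {f \<in> P. 0 < m f}"

text \<open>Radial projection from the barycenter to the boundary: the barycenter part, of weight c
  * m f, is removed and the rest rescaled. Where \<open>m\<close> vanishes nothing is
  changed.\<close>

definition r :: "('a \<Rightarrow> real) \<Rightarrow> 'a \<Rightarrow> real" where
  "r f v = (f v - (if v \<in> F then m f else 0)) / (1 - c * m f)"

lemma r_boundary: "m f = 0 \<Longrightarrow> r f = f"
  by (simp add: r_def fun_eq_iff)

lemma r_affine:
  assumes "f \<in> P" "0 < m f"
  shows "r f = affine (1 / (1 - c * m f)) (- m f / (1 - c * m f)) f"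
proof
  fix v
  have "f v = 0" if "v \<notin> F" using nz_F[OF assms] that by auto
  then show "r f v = affine (1 / (1 - c * m f)) (- m f / (1 - c * m f)) f v"
    by (simp add: r_def affine_def diff_divide_distrib)
qed

lemma r_interior:
  assumes f: "f \<in> A" "0 < m f"
  shows "r f \<in> P" "m (r f) = 0" "nz (r f) \<in> bd F"
proof -
  have fP: "f \<in> P" and lt: "c * m f < 1" using f by (auto simp: A_def)
  have p: "0 < 1 / (1 - c * m f)" using lt by simp
  show "m (r f) = 0" unfolding r_affine[OF fP f(2)] using p by (subst m_affine) (auto simp: add_divide_distrib[symmetric])
  show rP: "r f \<in> P" unfolding r_affine[OF fP f(2)]
  proof (rule affine_points[OF fP])
    show "1 / (1 - c * m f) + c * (- m f / (1 - c * m f)) = 1" using lt by (simp add: field_simps)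
  qed (use nz_F[OF fP f(2)] p in auto)
  have "nz (r f) \<in> K" by (rule nz_K[OF rP \<open>m (r f) = 0\<close>])
  moreover have "nz (r f) \<subseteq> F" unfolding r_affine[OF fP f(2)] by (auto simp: affine_def)
  ultimately show "nz (r f) \<in> bd F" using F by auto
qed

lemma continuous_m: "continuous_map (function_space Q) euclideanreal m"
  unfolding m_def[abs_def] using F by (intro continuous_map_real_Min continuous_map_coordinate)

lemma continuous_r:
  assumes "Q \<subseteq> A"
  shows "continuous_map (function_space Q) euclideanreal (\<lambda>f. r f v)"
proof -
  have "1 - c * m f \<noteq> 0" if "f \<in> topspace (function_space Q)" for f
    using assms that by (auto simp: A_def)
  then show ?thesis unfolding r_def
    by (cases "v \<in> F") (simp, intro continuous_intros continuous_m continuous_map_coordinate, simp)+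
qed

lemma A_equiv: "function_space A homotopy_equivalent_space geometric_realization K"
  unfolding geometric_realization_points
proof (rule retract_homotopy_equivalent[where r = r])
  have m0: "m f = 0" if "f \<in> points K" for f
  proof -
    have "f \<in> P" using that points_mono[of K "K \<union> {F}"] by (auto simp: P_def)
    moreover have "nz f \<noteq> F" using points_nz[OF that] F by auto
    ultimately show ?thesis using nz_F m_nonneg[of f] by fastforce
  qed
  show KA: "points K \<subseteq> A"
    using m0 points_mono[of K "K \<union> {F}"] by (auto simp: A_def P_def)
  show "r f = f" if "f \<in> points K" for f using r_boundary m0[OF that] by blast
  have rK: "r f \<in> points K" if f: "f \<in> A" for f
  proof (cases "0 < m f")
    case True
    then have "nz (r f) \<in> K" using r_interior(3)[OF f] bdF by blast
    then show ?thesis using r_interior(1)[OF f True] by (simp add: P_def points_def)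
  next
    case False
    have fP: "f \<in> P" using f by (simp add: A_def)
    then have "m f = 0" using False m_nonneg[of f] by simp
    then show ?thesis using nz_K[OF fP] r_boundary[of f] fP by (simp add: P_def points_def)
  qed
  show "continuous_map (function_space A) (function_space (points K)) r"
    unfolding continuous_map_function_space using continuous_r[of A] rK by simp
  show "(\<lambda>v. (1 - t) * r f v + t * f v) \<in> A" if f: "f \<in> A" and t: "0 \<le> t" "t \<le> 1" for f t
  proof (cases "0 < m f")
    case True
    have fP: "f \<in> P" and lt: "c * m f < 1" using f by (auto simp: A_def)
    let ?g = "(\<lambda>v. (1 - t) * r f v + t * f v)"
    define d where "d = 1 - c * m f"
    have d: "0 < d" using lt by (simp add: d_def)
    let ?a = "(1 - t) / d + t" and ?b = "- (1 - t) * m f / d"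
    have g: "?g = affine ?a ?b f"
    proof
      fix v
      have "f v = 0" if "v \<notin> F" using nz_F[OF fP True] that by auto
      then show "?g v = affine ?a ?b f v" unfolding r_affine[OF fP True] d_def[symmetric]
        by (simp add: affine_def algebra_simps diff_divide_distrib)
    qed
    have a: "0 \<le> ?a" using t d by simp
    have am: "?a * m f + ?b = t * m f" by (simp add: algebra_simps add_divide_distrib diff_divide_distrib)
    have "?g \<in> P" unfolding g
    proof (rule affine_points[OF fP _ a])
      have "?a + c * ?b = (1 - t) * ((1 - c * m f) / d) + t"
        by (simp add: algebra_simps add_divide_distrib diff_divide_distrib)
      then show "?a + c * ?b = 1" using d by (simp add: d_def[symmetric])
    qed (use am t True nz_F[OF fP True] in auto)
    moreover have "m ?g = t * m f" unfolding g using a am by (simp add: m_affine)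
    moreover have "c * (t * m f) < 1"
    proof -
      have "t * (c * m f) \<le> 1 * (c * m f)" using t c_pos True by (intro mult_right_mono) auto
      then show ?thesis using lt by (simp add: ac_simps)
    qed
    ultimately show ?thesis by (simp add: A_def)
  next
    case False
    then have "m f = 0" using m_nonneg[of f] f by (simp add: A_def)
    then show ?thesis using r_boundary[of f] f by (simp add: algebra_simps)
  qed
qed

definition bary :: "'a \<Rightarrow> real" where
  "bary v = (if v \<in> F then 1 / c else 0)"

lemma bary: "bary \<in> P" "m bary = 1 / c"
proof -
  show "bary \<in> P" unfolding P_def
    by (rule pointsI[where s = F, OF _ _ _ simplicial_KF]) (use F in \<open>auto simp: bary_def split: if_splits\<close>)
  have "bary ` F = {1 / c}" using F by (auto simp: bary_def)
  then show "m bary = 1 / c" by (simp add: m_def)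
qed

lemma B_contractible: "contractible_space (function_space B)"
proof -
  have "bary \<in> B" using bary c_pos by (simp add: B_def)
  moreover have "(\<lambda>v. (1 - t) * f v + t * bary v) \<in> B" if f: "f \<in> B" and t: "0 \<le> t" "t \<le> 1" for f t
  proof -
    have fP: "f \<in> P" and mf: "0 < m f" using f by (auto simp: B_def)
    have g: "(\<lambda>v. (1 - t) * f v + t * bary v) = affine (1 - t) (t / c) f"
      using nz_F[OF fP mf] by (auto simp: fun_eq_iff affine_def bary_def)
    have "0 < (1 - t) * m f + t / c"
    proof (cases "t = 1")
      case False
      then have "0 < (1 - t) * m f" using t mf by simp
      then show ?thesis using t c_pos by (simp add: add_pos_nonneg)
    qed (use c_pos in simp)
    then show ?thesis unfolding g B_def
      using t c_pos by (simp add: m_affine) (rule affine_points[OF fP], simp_all add: nz_F[OF fP mf])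
  qed
  ultimately have "homotopic_with (\<lambda>_. True) (function_space B) (function_space B) id (\<lambda>_. bary)"
    by (intro linear_homotopy) (simp_all add: continuous_map_function_space continuous_map_coordinate)
  then show ?thesis unfolding contractible_space_def by blast
qed

lemma AB_equiv: "function_space (A \<inter> B) homotopy_equivalent_space geometric_realization (bd F)"
proof -
  \<comment> \<open>The midpoint between a boundary point and the barycenter, which lies in both
    \<open>A\<close> and \<open>B\<close>; \<open>r\<close> projects it back.\<close>
  define q where "q g v = (g v + bary v) / 2" for g :: "'a \<Rightarrow> real" and v
  have bdP: "g \<in> P \<and> nz g \<subseteq> F \<and> m g = 0" if "g \<in> points (bd F)" for g
  proof -
    have gP: "g \<in> P" using that points_mono[of "bd F" "K \<union> {F}"] bdF by (auto simp: P_def)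
    have nz: "nz g \<subset> F" using points_nz[OF that] by simp
    then have "m g = 0" using nz_F[OF gP] m_nonneg[OF gP] by fastforce
    then show ?thesis using gP nz by auto
  qed
  have qa: "q g = affine (1/2) (1 / (2 * c)) g" if "nz g \<subseteq> F" for g
  proof
    fix v
    have "g v = 0" if "v \<notin> F" using \<open>nz g \<subseteq> F\<close> that by auto
    then show "q g v = affine (1/2) (1 / (2 * c)) g v"
      by (simp add: q_def affine_def bary_def add_divide_distrib)
  qed
  have mq: "m (q g) = 1 / (2 * c)" and qAB: "q g \<in> A \<inter> B" if "g \<in> points (bd F)" for g
  proof -
    have g: "g \<in> P" "nz g \<subseteq> F" "m g = 0" using bdP[OF that] by auto
    show mq: "m (q g) = 1 / (2 * c)" using g by (simp add: qa m_affine)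
    have "q g \<in> P" unfolding qa[OF g(2)] by (rule affine_points) (use g c_pos in auto)
    then show "q g \<in> A \<inter> B" using mq c_pos by (simp add: A_def B_def)
  qed
  have rq: "r (q g) = g" if g: "g \<in> points (bd F)" for g
  proof
    fix v
    have "g v = 0" if "v \<notin> F" using bdP[OF g] that by auto
    then show "r (q g) v = g v"
      unfolding r_def mq[OF g] using c_pos by (simp add: q_def bary_def field_simps)
  qed
  have rbd: "r f \<in> points (bd F)" if "f \<in> A \<inter> B" for f
    using that r_interior[of f] by (simp add: B_def P_def points_def)
  have rc: "continuous_map (function_space (A \<inter> B)) (function_space (points (bd F))) r"
    unfolding continuous_map_function_space using continuous_r[of "A \<inter> B"] rbd by simp
  have qc: "continuous_map (function_space (points (bd F))) (function_space (A \<inter> B)) q"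
    unfolding continuous_map_function_space
  proof (intro conjI allI ballI)
    show "continuous_map (function_space (points (bd F))) euclideanreal (\<lambda>g. q g v)" for v
      unfolding q_def by (intro continuous_intros continuous_map_coordinate) auto
  qed (use qAB in simp)
  have line: "(\<lambda>v. (1 - t) * (q \<circ> r) f v + t * id f v) \<in> A \<inter> B"
    if f: "f \<in> A \<inter> B" and t: "0 \<le> t" "t \<le> 1" for f t
  proof -
    have fP: "f \<in> P" and mf: "0 < m f" and lt: "c * m f < 1" using f by (auto simp: A_def B_def)
    define d where "d = 1 - c * m f"
    have d: "0 < d" using lt by (simp add: d_def)
    let ?g = "\<lambda>v. (1 - t) * (q \<circ> r) f v + t * id f v"
    let ?a = "(1 - t) / (2 * d) + t" and ?b = "(1 - t) * (1 / (2 * c) - m f / (2 * d))"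
    have g: "?g = affine ?a ?b f"
    proof
      fix v
      have "f v = 0" if "v \<notin> F" using nz_F[OF fP mf] that by auto
      then show "?g v = affine ?a ?b f v"
        using d c_pos by (simp add: q_def r_def bary_def affine_def d_def[symmetric]) (simp add: field_simps)
    qed
    have a: "0 \<le> ?a" using t d by simp
    have am: "?a * m f + ?b = t * m f + (1 - t) / (2 * c)" by (simp add: algebra_simps)
    have pos: "0 < t * m f + (1 - t) / (2 * c)"
    proof (cases "t = 0")
      case False
      then have "0 < t * m f" using t mf by simp
      then show ?thesis using t c_pos by (simp add: add_pos_nonneg)
    qed (use c_pos in simp)
    have "?g \<in> P" unfolding g
    proof (rule affine_points[OF fP _ a])
      have "?a + c * ?b = (1 - t) * ((1 - c * m f) / (2 * d) + 1 / 2) + t"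
        using c_pos d by (simp add: field_simps)
      then show "?a + c * ?b = 1" using d by (simp add: d_def[symmetric])
    qed (use am pos nz_F[OF fP mf] in auto)
    moreover have mg: "m ?g = t * m f + (1 - t) / (2 * c)" unfolding g using a am by (simp add: m_affine)
    moreover have "c * (t * m f + (1 - t) / (2 * c)) < 1"
    proof -
      have "c * (t * m f + (1 - t) / (2 * c)) = t * (c * m f) + (1 - t) * (1/2)"
        using c_pos by (simp add: field_simps)
      also have "\<dots> < 1"
        using convex_bound_lt[OF lt, of "1/2" t "1 - t"] t by simp
      finally show ?thesis .
    qed
    ultimately show ?thesis using pos by (simp add: A_def B_def)
  qed
  show ?thesis
    unfolding homotopy_equivalent_space_def geometric_realization_points
  proof (intro exI conjI)
    show "homotopic_with (\<lambda>_. True) (function_space (A \<inter> B)) (function_space (A \<inter> B)) (q \<circ> r) id"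
      by (rule linear_homotopy[OF continuous_map_compose[OF rc qc]])
        (use line in \<open>simp_all add: continuous_map_function_space continuous_map_coordinate\<close>)
    show "homotopic_with (\<lambda>_. True) (function_space (points (bd F))) (function_space (points (bd F))) (r \<circ> q) id"
      by (rule homotopic_with_equal) (use continuous_map_compose[OF qc rc] rq in auto)
  qed (fact rc qc)+
qed

lemma AB_sphere:
  assumes "card F = Suc (Suc d)"
  shows "function_space (A \<inter> B) homotopy_equivalent_space nsphere d"
proof -
  obtain h where h: "bij_betw h {..Suc d} F"
    using finite_same_card_bij[of "{..Suc d}" F] F assms by auto
  have "(`) h ` bd {..Suc d} = bd F"
  proof (intro equalityI subsetI)
    fix s assume "s \<in> (`) h ` bd {..Suc d}"
    then obtain r where "s = h ` r" "r \<in> bd {..Suc d}" by (rule imageE)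
    then have "s \<subset> h ` {..Suc d}" using image_strict_mono[OF bij_betw_imp_inj_on[OF h], of r] by simp
    then show "s \<in> bd F" using bij_betw_imp_surj_on[OF h] by simp
  next
    fix s assume s: "s \<in> bd F"
    then have "s \<subseteq> h ` {..Suc d}" using bij_betw_imp_surj_on[OF h] by auto
    then obtain r where r: "r \<subseteq> {..Suc d}" "s = h ` r" by (rule subset_imageE)
    then have "r \<noteq> {..Suc d}" using s bij_betw_imp_surj_on[OF h] by (cases "r = {..Suc d}") simp_all
    then have "r \<in> bd {..Suc d}" using r(1) by (simp add: psubset_eq)
    then show "s \<in> (`) h ` bd {..Suc d}" unfolding r(2) by (rule imageI)
  qed
  then have "geometric_realization (bd F) homotopy_equivalent_space geometric_realization (bd {..Suc d})"
    using relabel_homotopy_equivalent[of "{..Suc d}" "bd {..Suc d}" h] bij_betw_imp_inj_on[OF h] by auto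
  also have "\<dots> homotopy_equivalent_space nsphere d"
    using homeomorphic_maps_sphere_bd[of d] homeomorphic_imp_homotopy_equivalent_space
    by (subst homotopy_equivalent_space_sym) (auto simp: homeomorphic_space_def)
  finally show ?thesis using AB_equiv homotopy_eqv_trans by blast
qed

text \<open>Excising the closed set \<open>P - B\<close> identifies the relative group of (P, A)
  with that of (B, A \<inter> B). As \<open>B\<close> is contractible, this is reduced homology of a
  d-sphere in degree i - 1 < d, hence trivial. Exactness then squeezes the group of the whole space
  between two trivial ones.\<close>

lemma reduced_homology_attach:
  assumes card: "card F = Suc (Suc d)" and i: "i < int (Suc d)"
    and triv: "trivial_group (reduced_homology_group i (geometric_realization K))"
  shows "trivial_group (reduced_homology_group i (geometric_realization (K \<union> {F})))"
proof -
  let ?X = "function_space P"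
  have X: "geometric_realization (K \<union> {F}) = ?X" by (simp add: geometric_realization_points P_def)
  have AP: "A \<subseteq> P" "B \<subseteq> P" by (auto simp: A_def B_def)
  have subA: "subtopology ?X A = function_space A" and subB: "subtopology ?X B = function_space B"
    and subAB: "subtopology (function_space B) (A \<inter> B) = function_space (A \<inter> B)"
    using AP by (simp_all add: subtopology_subtopology inf.absorb2 inf.absorb1)
  have "openin ?X {f \<in> topspace ?X. c * m f \<in> {..<1}}"
    by (rule openin_continuous_map_preimage[where Y = euclideanreal]) (intro continuous_intros continuous_m, simp)
  then have opA: "openin ?X A" by (simp add: A_def)
  have "closedin ?X {f \<in> topspace ?X. m f \<in> {..0}}"
    by (rule closedin_continuous_map_preimage[where Y = euclideanreal]) (intro continuous_m, simp)
  moreover have "{f \<in> topspace ?X. m f \<in> {..0}} = P - B" by (auto simp: B_def)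
  ultimately have clU: "closedin ?X (P - B)" by simp
  have UA: "P - B \<subseteq> A"
  proof
    fix f assume f: "f \<in> P - B"
    then have "m f = 0" using m_nonneg[of f] by (simp add: B_def)
    then show "f \<in> A" using f by (simp add: A_def)
  qed
  have "?X closure_of (P - B) \<subseteq> ?X interior_of A"
    using closure_of_closedin[OF clU] interior_of_openin[OF opA] UA by simp
  from homology_excision_axiom[OF this AP(1), of i]
  have "relative_homology_group i (subtopology ?X (P - (P - B))) (A - (P - B)) \<cong>
      relative_homology_group i (subtopology ?X P) A" by (rule is_isoI)
  moreover have "P - (P - B) = B" "A - (P - B) = A \<inter> B" "subtopology ?X P = ?X"
    using AP by (auto simp: subtopology_subtopology)
  ultimately have exc: "relative_homology_group i (function_space B) (A \<inter> B) \<cong> relative_homology_group i ?X A"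
    using subB by simp
  have sph: "function_space (A \<inter> B) homotopy_equivalent_space nsphere d" by (rule AB_sphere[OF card])
  have "A \<inter> B \<noteq> {}"
  proof
    assume "A \<inter> B = {}"
    moreover obtain f where "continuous_map (nsphere d) (function_space (A \<inter> B)) f"
      using sph unfolding homotopy_equivalent_space_def by blast
    ultimately show False using in_topspace_nsphere[of d] by (auto simp: continuous_map_def)
  qed
  then have "topspace (function_space B) \<inter> (A \<inter> B) \<noteq> {}" by auto
  from isomorphic_group_relative_homology_of_contractible[OF B_contractible this, of i]
  have "relative_homology_group i (function_space B) (A \<inter> B) \<cong> reduced_homology_group (i - 1) (function_space (A \<inter> B))"
    unfolding subAB .
  moreover have "trivial_group (reduced_homology_group (i - 1) (function_space (A \<inter> B)))"
    by (rule trivial_reduced_homology_homotopy_equivalent[OF sph]) (rule reduced_homology_group_nsphere(2), use i in simp)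
  ultimately have "trivial_group (relative_homology_group i (function_space B) (A \<inter> B))"
    using isomorphic_group_triviality group_relative_homology_group group_reduced_homology_group by blast
  then have rel: "trivial_group (relative_homology_group i ?X A)"
    using isomorphic_group_triviality[OF exc] by simp
  have "trivial_group (reduced_homology_group i (subtopology ?X A))"
    unfolding subA by (rule trivial_reduced_homology_homotopy_equivalent[OF A_equiv triv])
  then show ?thesis unfolding X
    using trivial_group_exact[OF homology_exactness_reduced_3] rel by blast
qed

end

lemma shelling_homology:
  assumes "shelling c K" "i < int c - 1"
  shows "trivial_group (reduced_homology_group i (geometric_realization K))"
  using assms
proof (induction rule: shelling.induct)
  case (simplex F)
  show ?case
  proof (cases "F = {}")
    case True
    then show ?thesis using simplex by (intro trivial_reduced_homology_group) simp
  next
    case False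
    then show ?thesis
      using trivial_reduced_homology_group_contractible_space[OF contractible_simplex[OF simplex(1)]] by blast
  qed
next
  case (attach K F R)
  have triv: "trivial_group (reduced_homology_group i (geometric_realization K))"
    using attach.IH attach.prems .
  have simp_K: "simplicial K" by (rule shelling_complex(1)[OF attach.hyps(1)])
  show ?case
  proof (cases "R = F")
    case True
    then have I: "{s. R \<subseteq> s \<and> s \<subseteq> F} = {F}" by auto
    show ?thesis
    proof (cases "i < 0")
      case True
      then show ?thesis by (rule trivial_reduced_homology_group)
    next
      case False
      \<comment> \<open>A degree i with 0 \<le> i < c - 1 gives c \<ge> 2, so the subtraction is not
        truncated.\<close>
      then have c: "card F = Suc (Suc (card F - 2))" "i < int (Suc (card F - 2))"
        using attach.hyps(3) attach.prems by auto
      have "bd F \<subseteq> K" using attach.hyps(7) True by auto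
      then interpret attached_facet K F
        using simp_K attach.hyps True by unfold_locales auto
      show ?thesis unfolding I by (rule reduced_homology_attach[OF c triv])
    qed
  next
    case False
    have "geometric_realization (K \<union> {s. R \<subseteq> s \<and> s \<subseteq> F}) homotopy_equivalent_space geometric_realization K"
    proof (rule collapse_homotopy_equivalent[OF simp_K])
      show "simplicial (K \<union> {s. R \<subseteq> s \<and> s \<subseteq> F})"
        by (rule simplicial_Un_interval[OF simp_K attach.hyps(2,7)])
    qed (use attach.hyps False in auto)
    then show ?thesis using triv by (rule trivial_reduced_homology_homotopy_equivalent)
  qed
qed

section \<open>Links and Cohen--Macaulayness\<close>

lemma link_simplicial: "simplicial K \<Longrightarrow> link K \<sigma> = {\<tau>. \<sigma> \<inter> \<tau> = {} \<and> \<sigma> \<union> \<tau> \<in> K}"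
  unfolding link_def using simplicialD by blast

text \<open>If \<sigma> is not in \<open>F\<close>, the link does not notice the new interval. If R
  \<subseteq> \<sigma> \<subseteq> F, all faces containing \<sigma> are new and the link is a
  simplex. Otherwise the link acquires the interval from R - \<sigma> to F - \<sigma>, again an
  admissible attachment.\<close>

lemma shelling_link:
  assumes "shelling c K" "\<sigma> \<in> K"
  shows "shelling (c - card \<sigma>) (link K \<sigma>)"
  using assms
proof (induction rule: shelling.induct)
  case (simplex F)
  have "link (Pow F) \<sigma> = Pow (F - \<sigma>)" using simplex.prems unfolding link_def by auto
  then show ?case
    using simplex by (auto intro!: shelling.simplex simp: card_Diff_subset finite_subset)
next
  case (attach K F R)
  let ?L = "K \<union> {s. R \<subseteq> s \<and> s \<subseteq> F}"
  have simp_K: "simplicial K" by (rule shelling_complex(1)[OF attach.hyps(1)])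
  have simp_L: "simplicial ?L" by (rule simplicial_Un_interval[OF simp_K attach.hyps(2,7)])
  have notR: "s \<notin> K" if "R \<subseteq> s" for s using that attach.hyps(6) simplicialD[OF simp_K] by blast
  consider "\<not> \<sigma> \<subseteq> F" | "\<sigma> \<subseteq> F" "R \<subseteq> \<sigma>" | "\<sigma> \<subseteq> F" "\<not> R \<subseteq> \<sigma>" by blast
  then show ?case
  proof cases
    case 1
    then have "\<sigma> \<in> K" using attach.prems by auto
    moreover have "link ?L \<sigma> = link K \<sigma>"
      unfolding link_simplicial[OF simp_K] link_simplicial[OF simp_L] using 1 by auto
    ultimately show ?thesis using attach.IH by simp
  next
    case 2
    have "link ?L \<sigma> = Pow (F - \<sigma>)"
      unfolding link_simplicial[OF simp_L]
    proof (intro equalityI subsetI)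
      fix \<tau> assume "\<tau> \<in> {\<tau>. \<sigma> \<inter> \<tau> = {} \<and> \<sigma> \<union> \<tau> \<in> ?L}"
      then show "\<tau> \<in> Pow (F - \<sigma>)" using notR[of "\<sigma> \<union> \<tau>"] 2 by auto
    qed (use 2 in auto)
    then show ?thesis
      using 2 attach.hyps by (auto intro!: shelling.simplex simp: card_Diff_subset finite_subset)
  next
    case 3
    have sK: "\<sigma> \<in> K" using attach.hyps(7) 3 .
    have R: "R \<subseteq> \<sigma> \<union> \<tau> \<longleftrightarrow> R - \<sigma> \<subseteq> \<tau>" for \<tau> by blast
    have eq: "link ?L \<sigma> = link K \<sigma> \<union> {\<tau>. R - \<sigma> \<subseteq> \<tau> \<and> \<tau> \<subseteq> F - \<sigma>}"
      unfolding link_simplicial[OF simp_K] link_simplicial[OF simp_L]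
    proof (intro equalityI subsetI)
      fix \<tau> assume "\<tau> \<in> {\<tau>. \<sigma> \<inter> \<tau> = {} \<and> \<sigma> \<union> \<tau> \<in> K} \<union> {\<tau>. R - \<sigma> \<subseteq> \<tau> \<and> \<tau> \<subseteq> F - \<sigma>}"
      then show "\<tau> \<in> {\<tau>. \<sigma> \<inter> \<tau> = {} \<and> \<sigma> \<union> \<tau> \<in> ?L}" using R[of \<tau>] 3(1) by auto
    next
      fix \<tau> assume "\<tau> \<in> {\<tau>. \<sigma> \<inter> \<tau> = {} \<and> \<sigma> \<union> \<tau> \<in> ?L}"
      then show "\<tau> \<in> {\<tau>. \<sigma> \<inter> \<tau> = {} \<and> \<sigma> \<union> \<tau> \<in> K} \<union> {\<tau>. R - \<sigma> \<subseteq> \<tau> \<and> \<tau> \<subseteq> F - \<sigma>}"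
        using R[of \<tau>] by auto
    qed
    show ?thesis unfolding eq
    proof (rule shelling.attach)
      show "shelling (c - card \<sigma>) (link K \<sigma>)" by (rule attach.IH[OF sK])
      show "finite (F - \<sigma>)" using attach.hyps by simp
      show "card (F - \<sigma>) = c - card \<sigma>"
        using card_Diff_subset[OF finite_subset[OF 3(1) attach.hyps(2)] 3(1)] attach.hyps(3) by simp
      show "R - \<sigma> \<subseteq> F - \<sigma>" using attach.hyps(4) by blast
      show "R - \<sigma> \<noteq> {}" using 3 by blast
      show "R - \<sigma> \<notin> link K \<sigma>"
        unfolding link_simplicial[OF simp_K] using notR[of "\<sigma> \<union> (R - \<sigma>)"] by blast
      show "s \<in> link K \<sigma>" if "s \<subseteq> F - \<sigma>" "\<not> R - \<sigma> \<subseteq> s" for s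
        unfolding link_simplicial[OF simp_K] using that 3(1) R[of s] attach.hyps(7)[of "\<sigma> \<union> s"] by blast
    qed
  qed
qed

lemma shelling_complex_dim: "shelling c K \<Longrightarrow> complex_dim K = int c - 1"
proof -
  assume K: "shelling c K"
  have "finite K" using finite_subset[of K "Pow (\<Union>K)"] shelling_complex(2)[OF K] by auto
  moreover obtain s where "s \<in> K" "card s = c" using shelling_dim(2)[OF K] by blast
  ultimately have "Max (card ` K) = c"
    using shelling_dim(1)[OF K] by (intro Max_eqI) auto
  then show ?thesis by (simp add: complex_dim_def)
qed

lemma shelling_cohen_macaulay:
  assumes "shelling c K"
  shows "cohen_macaulay_complex K"
  unfolding cohen_macaulay_complex_def
  using shelling_homology shelling_link[OF assms] shelling_complex_dim by metis

section \<open>Shellings from EL-labelings\<close>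

text \<open>The intervals are disjoint, and any other face of \<open>F i\<close> lies in the
  interval of an earlier index. The order may be partial: from an index set closed under
  predecessors, any maximal element can be removed last.\<close>

lemma shelling_of_order:
  fixes F R :: "'i \<Rightarrow> 'a set" and lt :: "'i \<Rightarrow> 'i \<Rightarrow> bool"
  assumes S: "finite S" "S \<noteq> {}"
    and trans: "\<And>i j l. lt i j \<Longrightarrow> lt j l \<Longrightarrow> lt i l" and irrefl: "\<And>i. \<not> lt i i"
    and F: "\<And>i. i \<in> S \<Longrightarrow> finite (F i)" "\<And>i. i \<in> S \<Longrightarrow> card (F i) = c" "\<And>i. i \<in> S \<Longrightarrow> R i \<subseteq> F i"
    and disj: "\<And>i j s. i \<in> S \<Longrightarrow> j \<in> S \<Longrightarrow> R i \<subseteq> s \<Longrightarrow> s \<subseteq> F i \<Longrightarrow> R j \<subseteq> s \<Longrightarrow> s \<subseteq> F j \<Longrightarrow> i = j"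
    and ord: "\<And>i s. i \<in> S \<Longrightarrow> s \<subseteq> F i \<Longrightarrow> \<not> R i \<subseteq> s \<Longrightarrow> \<exists>j\<in>S. lt j i \<and> R j \<subseteq> s \<and> s \<subseteq> F j"
  shows "shelling c (\<Union>i\<in>S. {s. R i \<subseteq> s \<and> s \<subseteq> F i})"
proof -
  have "shelling c (\<Union>i\<in>D. {s. R i \<subseteq> s \<and> s \<subseteq> F i})"
    if "finite D" "D \<noteq> {}" "D \<subseteq> S" "\<And>i j. i \<in> D \<Longrightarrow> j \<in> S \<Longrightarrow> lt j i \<Longrightarrow> j \<in> D" for D
    using that
  proof (induction D rule: finite_psubset_induct)
    case (psubset D)
    have "asymp_on D lt" "transp_on D lt"
      using trans irrefl by (auto intro!: asymp_onI transp_onI)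
    then obtain i where i: "i \<in> D" and max: "\<And>j. j \<in> D \<Longrightarrow> \<not> lt i j"
      using Finite_Set.bex_max_element[of D lt] psubset.hyps psubset.prems(1) irrefl by metis
    have iS: "i \<in> S" using i psubset.prems by blast
    have low: "\<exists>j\<in>D - {i}. R j \<subseteq> s \<and> s \<subseteq> F j" if "s \<subseteq> F i" "\<not> R i \<subseteq> s" for s
      using ord[OF iS that] psubset.prems(3)[OF i] irrefl by auto
    show ?case
    proof (cases "D = {i}")
      case True
      then have "R i = {}" using low[of "{}"] by auto
      then have "(\<Union>i\<in>D. {s. R i \<subseteq> s \<and> s \<subseteq> F i}) = Pow (F i)" using True by auto
      then show ?thesis using F iS by (auto intro!: shelling.simplex)
    next
      case False
      let ?K = "\<Union>i\<in>D - {i}. {s. R i \<subseteq> s \<and> s \<subseteq> F i}"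
      have eq: "(\<Union>i\<in>D. {s. R i \<subseteq> s \<and> s \<subseteq> F i}) = ?K \<union> {s. R i \<subseteq> s \<and> s \<subseteq> F i}" using i by blast
      show ?thesis unfolding eq
      proof (rule shelling.attach)
        show "shelling c ?K"
        proof (rule psubset.IH)
          show "j \<in> D - {i}" if "l \<in> D - {i}" "j \<in> S" "lt j l" for l j
            using that psubset.prems(3)[of l j] max[of l] by blast
        qed (use i False psubset.prems in auto)
        \<comment> \<open>Only one interval contains the empty face. If it were that of the last
          index \<open>i\<close>, then \<open>ord\<close> for another index \<open>j\<close> would
          produce an earlier owner of the empty face, hence \<open>i\<close> before
          \<open>j\<close>.\<close>
        show "R i \<noteq> {}"
        proof
          assume Ri: "R i = {}"
          obtain j where j: "j \<in> D" "j \<noteq> i" using False i by blast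
          have jS: "j \<in> S" using j psubset.prems by blast
          show False
          proof (cases "R j = {}")
            case True
            then show False using disj[OF iS jS, of "{}"] Ri j by auto
          next
            case False
            then obtain l where l: "l \<in> S" "lt l j" "R l \<subseteq> {}" using ord[OF jS, of "{}"] by auto
            then have "l = i" using disj[OF l(1) iS, of "{}"] Ri by auto
            then show False using max[OF j(1)] l by simp
          qed
        qed
        show "R i \<notin> ?K"
        proof
          assume "R i \<in> ?K"
          then obtain j where j: "j \<in> D" "j \<noteq> i" "R j \<subseteq> R i" "R i \<subseteq> F j" by blast
          moreover have "j \<in> S" using j psubset.prems by blast
          ultimately show False using disj[OF iS \<open>j \<in> S\<close>, of "R i"] F(3)[OF iS] by blast
        qed
        show "s \<in> ?K" if "s \<subseteq> F i" "\<not> R i \<subseteq> s" for s using low[OF that] by blast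
      qed (use F iS in auto)
    qed
  qed
  then show ?thesis using S by blast
qed

text \<open>A vertex counts as soon as its two adjacent labels fail to increase strictly, thus also
  when they are equal or incomparable.\<close>

fun descents :: "('l \<Rightarrow> 'l \<Rightarrow> bool) \<Rightarrow> ('a \<Rightarrow> 'a \<Rightarrow> 'l) \<Rightarrow> 'a list \<Rightarrow> 'a set" where
  "descents lt lam (x # y # z # zs) =
     (if lt (lam x y) (lam y z) then {} else {y}) \<union> descents lt lam (y # z # zs)"
| "descents lt lam _ = {}"

lemma label_word_simps [simp]:
  "label_word lam [] = []" "label_word lam [x] = []"
  "label_word lam (x # y # zs) = lam x y # label_word lam (y # zs)"
  by (simp_all add: label_word_def)

lemma successively_label_word: "successively lt (label_word lam c) \<longleftrightarrow> descents lt lam c = {}"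
  by (induction lt lam c rule: descents.induct) auto

lemma increasing_iff_descents:
  "increasing_word s (label_word lam c) \<longleftrightarrow> descents (\<lambda>a b. (a, b) \<in> s - Id) lam c = {}"
  unfolding increasing_word_def by (rule successively_label_word)

lemma length_label_word: "length (label_word lam c) = length c - 1"
  by (simp add: label_word_def)

lemma label_word_append: "label_word lam (c @ z # d) = label_word lam (c @ [z]) @ label_word lam (z # d)"
proof (induction c rule: induct_list012)
  case (3 x y zs)
  then show ?case by simp
qed (cases d; simp)+

text \<open>Cutting a chain at \<open>z\<close> only loses the information whether \<open>z\<close>
  itself is a descent.\<close>

lemma descents_append:
  "descents lt lam (c @ [z]) \<union> descents lt lam (z # d) \<subseteq> descents lt lam (c @ z # d)"
  "descents lt lam (c @ z # d) \<subseteq> insert z (descents lt lam (c @ [z]) \<union> descents lt lam (z # d))"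
proof (induction c rule: induct_list012)
  case (2 x)
  { case 1 show ?case by (cases d) auto }
  { case 2 show ?case by (cases d) auto }
next
  case (3 x y zs)
  { case 1 show ?case using 3(3) by (cases zs) auto }
  { case 2 show ?case using 3(4) by (cases zs) auto }
qed auto

lemma descents_inner: "descents lt lam c \<subseteq> set (butlast (tl c))"
proof (induction lt lam c rule: descents.induct)
  case (1 lt lam x y z zs)
  then have "descents lt lam (y # z # zs) \<subseteq> set (butlast (z # zs))" by simp
  moreover have "butlast (tl (x # y # z # zs)) = y # butlast (z # zs)" by simp
  ultimately show ?case by (simp only: descents.simps(1) list.set) auto
qed auto

lemma successively_covers_rank:
  assumes "\<And>x y. covers r x y \<Longrightarrow> rk y = Suc (rk x)" "successively (covers r) c" "c \<noteq> []"
  shows "rk (last c) + 1 = rk (hd c) + length c"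
  using assms(2,3) by (induction c rule: induct_list012) (use assms(1) in auto)

text \<open>The rank function makes all maximal chains of an interval equally long. This yields
  facets of equal size and lets strict lexicographic comparison survive the appending of further
  labels.\<close>

locale graded_EL =
  fixes r :: "'a rel" and s :: "'l rel" and lam :: "'a \<Rightarrow> 'a \<Rightarrow> 'l" and rk :: "'a \<Rightarrow> nat" and bot top :: 'a
  assumes po: "Partial_order r" and fin: "finite (Field r)" and EL: "EL_labeling s lam r"
    and rk: "\<And>x y. covers r x y \<Longrightarrow> rk y = Suc (rk x)"
    and bot: "\<And>x. x \<in> Field r \<Longrightarrow> (bot, x) \<in> r" and top: "\<And>x. x \<in> Field r \<Longrightarrow> (x, top) \<in> r"
    and bot_in: "bot \<in> Field r"
begin

abbreviation lt where "lt \<equiv> \<lambda>a b. (a, b) \<in> s - Id"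
abbreviation desc where "desc \<equiv> descents lt lam"
abbreviation lw where "lw \<equiv> label_word lam"

lemma r_trans: "(x, y) \<in> r \<Longrightarrow> (y, z) \<in> r \<Longrightarrow> (x, z) \<in> r"
  using po unfolding partial_order_on_def preorder_on_def by (meson transD)

lemma r_refl: "x \<in> Field r \<Longrightarrow> (x, x) \<in> r"
  using po unfolding partial_order_on_def preorder_on_def refl_on_def by blast

lemma r_antisym: "(x, y) \<in> r \<Longrightarrow> (y, x) \<in> r \<Longrightarrow> x = y"
  using po unfolding partial_order_on_def by (meson antisymD)

lemma covers_r: "covers r x y \<Longrightarrow> (x, y) \<in> r"
  by (simp add: covers_def)

lemma chain_sorted: "successively (covers r) c \<Longrightarrow> sorted_wrt (\<lambda>x y. (x, y) \<in> r \<and> rk x < rk y) c"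
proof (induction c rule: induct_list012)
  case (3 x y zs)
  then show ?case using r_trans covers_r rk by fastforce
qed auto

lemma chain_rk: "successively (covers r) c \<Longrightarrow> c \<noteq> [] \<Longrightarrow> rk (last c) + 1 = rk (hd c) + length c"
  by (rule successively_covers_rank[of r rk]) (use rk in auto)

lemma maximal_chains_length: "c \<in> maximal_chains r x y \<Longrightarrow> length c = rk y + 1 - rk x"
  unfolding maximal_chains_def using chain_rk[of c] by auto

lemma maximal_chains_distinct: "c \<in> maximal_chains r x y \<Longrightarrow> distinct c"
proof -
  assume "c \<in> maximal_chains r x y"
  then have "sorted_wrt (\<lambda>x y. (x, y) \<in> r \<and> rk x < rk y) c"
    using chain_sorted unfolding maximal_chains_def by blast
  then have "sorted_wrt (\<lambda>x y. rk x < rk y) c"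
    by (rule sorted_wrt_mono_rel[rotated]) simp
  then have "sorted_wrt (<) (map rk c)" by (simp add: sorted_wrt_map)
  then show ?thesis using strict_sorted_iff distinct_map by metis
qed

lemma maximal_chains_split:
  assumes "c @ z # d \<in> maximal_chains r x y"
  shows "c @ [z] \<in> maximal_chains r x z" "z # d \<in> maximal_chains r z y"
  using assms unfolding maximal_chains_def
  by (auto simp: successively_append_iff hd_append split: if_splits)

lemma maximal_chains_join:
  assumes "c @ [z] \<in> maximal_chains r x z" "z # d \<in> maximal_chains r z y"
  shows "c @ z # d \<in> maximal_chains r x y"
  using assms unfolding maximal_chains_def
  by (auto simp: successively_append_iff hd_append split: if_splits)

lemma maximal_chains_between:
  assumes c: "c \<in> maximal_chains r x y" and w: "w \<in> set c" and x: "x \<in> Field r" and y: "y \<in> Field r"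
  shows "(x, w) \<in> r" "(w, y) \<in> r"
proof -
  obtain a b where ab: "c = a @ w # b" using w by (meson split_list)
  have s: "sorted_wrt (\<lambda>x y. (x, y) \<in> r \<and> rk x < rk y) c" and hd: "hd c = x" "last c = y"
    using c chain_sorted unfolding maximal_chains_def by auto
  show "(x, w) \<in> r"
  proof (cases a)
    case Nil
    then show ?thesis using hd ab r_refl x by simp
  next
    case (Cons u us)
    then show ?thesis using s hd ab by simp
  qed
  show "(w, y) \<in> r"
  proof (cases b rule: rev_cases)
    case Nil
    then show ?thesis using hd ab r_refl y by simp
  next
    case (snoc us u)
    then show ?thesis using s hd ab by (simp add: sorted_wrt_append)
  qed
qed

lemma EL_chain:
  assumes "(x, y) \<in> r"
  obtains c where "c \<in> maximal_chains r x y" "desc c = {}"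
    "\<forall>c'\<in>maximal_chains r x y. c' \<noteq> c \<longrightarrow> desc c' \<noteq> {} \<and> (lw c, lw c') \<in> lexord (s - Id)"
proof -
  obtain c where c: "c \<in> maximal_chains r x y" "desc c = {}"
    and min: "\<forall>c'\<in>maximal_chains r x y. c' \<noteq> c \<longrightarrow> desc c' \<noteq> {} \<and> (lw c, lw c') \<in> lexord (s - Id)"
    using EL[unfolded EL_labeling_def increasing_iff_descents, THEN conjunct2, THEN conjunct2, THEN bspec, OF assms]
    unfolding case_prod_conv by (elim bexE conjE)
  show thesis by (rule that[OF c min])
qed

lemma rk_strict: assumes "(x, y) \<in> r" "x \<noteq> y" shows "rk x < rk y"
proof -
  obtain c where c: "c \<in> maximal_chains r x y" using EL_chain[OF assms(1)] .
  then have "hd c = x" "last c = y" "c \<noteq> []" "successively (covers r) c" by (auto simp: maximal_chains_def)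
  moreover from this have "length c \<noteq> 1" using assms(2) by (auto simp: length_Suc_conv)
  moreover have "rk y + 1 = rk x + length c" using calculation chain_rk[of c] by simp
  moreover have "length c \<noteq> 0" using \<open>c \<noteq> []\<close> by simp
  ultimately show ?thesis by arith
qed

text \<open>Between consecutive elements of \<tau>, and from its last element to the top, the
  increasing chain is inserted. The result has descents only in \<tau> and precedes all other
  maximal chains through \<tau>. The recursion splits off the least element of \<tau> above
  \<open>x\<close>.\<close>

lemma unique_filling:
  assumes "finite \<tau>" "\<And>a b. a \<in> \<tau> \<Longrightarrow> b \<in> \<tau> \<Longrightarrow> (a, b) \<in> r \<or> (b, a) \<in> r"
    and "x \<in> Field r" "\<And>w. w \<in> \<tau> \<Longrightarrow> (x, w) \<in> r"
  shows "\<exists>c\<in>maximal_chains r x top. desc c \<subseteq> \<tau> \<and> \<tau> \<subseteq> set c \<and>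
    (\<forall>c'\<in>maximal_chains r x top. \<tau> \<subseteq> set c' \<longrightarrow> c' \<noteq> c \<longrightarrow>
       \<not> desc c' \<subseteq> \<tau> \<and> (lw c, lw c') \<in> lexord (s - Id))"
  using assms
proof (induction "card (\<tau> - {x})" arbitrary: \<tau> x rule: less_induct)
  case less
  have inner: "w \<noteq> u \<and> w \<noteq> v \<and> w \<in> set c" if "c \<in> maximal_chains r u v" "w \<in> desc c" for c u v w
  proof -
    have w: "w \<in> set (butlast (tl c))" by (rule subsetD[OF descents_inner that(2)])
    have "c \<noteq> []" "hd c = u" "last c = v" using that(1) by (auto simp: maximal_chains_def)
    then obtain d where d: "c = u # d" by (cases c) auto
    have dist: "distinct c" by (rule maximal_chains_distinct[OF that(1)])
    have wd: "w \<in> set (butlast d)" using w d by simp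
    then have "d \<noteq> []" by auto
    then have "v = last d" "d = butlast d @ [last d]" using \<open>last c = v\<close> d by auto
    then have "w \<noteq> v" using wd dist d by (metis distinct.simps(2) distinct_butlast not_distinct_conv_prefix append_butlast_last_id)
    moreover have "w \<in> set d" using wd by (rule in_set_butlastD)
    ultimately show ?thesis using d dist by auto
  qed
  show ?case
  proof (cases "\<tau> - {x} = {}")
    case True
    obtain c where c: "c \<in> maximal_chains r x top" "desc c = {}"
      and min: "\<forall>c'\<in>maximal_chains r x top. c' \<noteq> c \<longrightarrow> desc c' \<noteq> {} \<and> (lw c, lw c') \<in> lexord (s - Id)"
      using EL_chain[OF top[OF less.prems(3)]] .
    note min = min[rule_format]
    have "x \<in> set c" using c(1) by (auto simp: maximal_chains_def)
    moreover have "\<not> desc c' \<subseteq> \<tau>" if "c' \<in> maximal_chains r x top" "c' \<noteq> c" for c'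
      using min[OF that] inner[OF that(1)] True by blast
    ultimately show ?thesis using c min True by (intro bexI[of _ c]) auto
  next
    case False
    let ?\<tau> = "\<tau> - {x}"
    have "finite ?\<tau>" using less.prems(1) by simp
    then obtain z where z: "z \<in> ?\<tau>" "\<And>w. w \<in> ?\<tau> \<Longrightarrow> rk z \<le> rk w"
      using False arg_min_if_finite(1)[of ?\<tau> rk] arg_min_least[of ?\<tau> _ rk] by metis
    have zmin: "(z, w) \<in> r" if w: "w \<in> ?\<tau>" for w
    proof -
      have "(z, w) \<in> r \<or> (w, z) \<in> r" using less.prems(2) z(1) w by blast
      moreover have "w = z" if "(w, z) \<in> r" using rk_strict[OF that] z(2)[OF w] by force
      ultimately show ?thesis by blast
    qed
    have xz: "(x, z) \<in> r" "x \<noteq> z" using z(1) less.prems(4) by auto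
    have zF: "z \<in> Field r" using xz(1) by (auto simp: Field_def)
    have topF: "top \<in> Field r" using top[OF zF] by (auto simp: Field_def)
    have "card (?\<tau> - {z}) < card ?\<tau>" using z(1) \<open>finite ?\<tau>\<close> by (intro psubset_card_mono) auto
    from less.hyps[OF this \<open>finite ?\<tau>\<close> _ zF zmin] less.prems(2)
    obtain c2 where c2: "c2 \<in> maximal_chains r z top" "desc c2 \<subseteq> ?\<tau>" "?\<tau> \<subseteq> set c2"
      and min2: "\<And>c'. c' \<in> maximal_chains r z top \<Longrightarrow> ?\<tau> \<subseteq> set c' \<Longrightarrow> c' \<noteq> c2 \<Longrightarrow>
         \<not> desc c' \<subseteq> ?\<tau> \<and> (lw c2, lw c') \<in> lexord (s - Id)"
      by blast
    obtain c1 where c1: "c1 \<in> maximal_chains r x z" "desc c1 = {}"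
      and min1: "\<forall>c'\<in>maximal_chains r x z. c' \<noteq> c1 \<longrightarrow> desc c' \<noteq> {} \<and> (lw c1, lw c') \<in> lexord (s - Id)"
      using EL_chain[OF xz(1)] .
    note min1 = min1[rule_format]
    obtain a where a: "c1 = a @ [z]"
      using c1(1) unfolding maximal_chains_def by (cases c1 rule: rev_cases) auto
    obtain b where b: "c2 = z # b"
      using c2(1) unfolding maximal_chains_def by (cases c2) auto
    let ?c = "a @ z # b"
    have cM: "?c \<in> maximal_chains r x top" using maximal_chains_join c1(1) c2(1) a b by simp
    have "x \<in> set ?c"
    proof -
      have "hd ?c = x" "?c \<noteq> []" using cM by (auto simp: maximal_chains_def)
      then show ?thesis by (metis hd_in_set)
    qed
    then have sub: "\<tau> \<subseteq> set ?c" using c2(3) b by auto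
    have dsub: "desc ?c \<subseteq> \<tau>"
      using descents_append(2)[of lt lam a z b] c1(2) c2(2) z(1) a b by auto
    have "\<not> desc c' \<subseteq> \<tau> \<and> (lw ?c, lw c') \<in> lexord (s - Id)"
      if c': "c' \<in> maximal_chains r x top" "\<tau> \<subseteq> set c'" "c' \<noteq> ?c" for c'
    proof -
      have "z \<in> set c'" using c'(2) z(1) by auto
      then obtain p q where pq: "c' = p @ z # q" by (meson split_list)
      let ?d1 = "p @ [z]" and ?d2 = "z # q"
      have d: "?d1 \<in> maximal_chains r x z" "?d2 \<in> maximal_chains r z top"
        using maximal_chains_split c'(1) pq by auto
      have subd: "?\<tau> \<subseteq> set ?d2"
      proof
        fix w assume w: "w \<in> ?\<tau>"
        then have "w \<in> set ?d1 \<or> w \<in> set ?d2" using c'(2) pq by auto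
        moreover have "w = z" if "w \<in> set ?d1"
          using maximal_chains_between(2)[OF d(1) that less.prems(3) zF] zmin[OF w] r_antisym by blast
        ultimately show "w \<in> set ?d2" by auto
      qed
      have split: "lw ?c = lw c1 @ lw c2" "lw c' = lw ?d1 @ lw ?d2"
        unfolding pq a b by (rule label_word_append)+
      have ne: "?d1 \<noteq> c1 \<or> ?d2 \<noteq> c2" using c'(3) pq a b by auto
      have "\<not> desc c' \<subseteq> \<tau>"
      proof
        assume sub': "desc c' \<subseteq> \<tau>"
        have dd: "desc ?d1 \<subseteq> \<tau>" "desc ?d2 \<subseteq> \<tau>"
          using sub' descents_append(1)[of lt lam p z q] pq by auto
        \<comment> \<open>A descent of the first segment would be an element of \<tau> strictly
          between x and z, but z is the least element of \<tau> other than x.\<close>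
        have "desc ?d1 = {}"
        proof (rule ccontr)
          assume "desc ?d1 \<noteq> {}"
          then obtain w where w: "w \<in> desc ?d1" by blast
          then have "w \<noteq> x" "w \<noteq> z" "w \<in> set ?d1" using inner[OF d(1)] by auto
          moreover then have "(w, z) \<in> r" using maximal_chains_between(2)[OF d(1) _ less.prems(3) zF] by blast
          moreover have "(z, w) \<in> r" using zmin w dd(1) \<open>w \<noteq> x\<close> by blast
          ultimately show False using r_antisym by blast
        qed
        then have "?d1 = c1" using min1[OF d(1)] by blast
        moreover have "x \<notin> desc ?d2"
        proof
          assume "x \<in> desc ?d2"
          then have "x \<in> set ?d2" using inner[OF d(2)] by blast
          then have "(z, x) \<in> r" using maximal_chains_between(1)[OF d(2) _ zF topF] by blast
          then show False using xz r_antisym by blast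
        qed
        then have "?d2 = c2" using min2[OF d(2) subd] dd(2) by blast
        ultimately show False using ne by blast
      qed
      moreover have "(lw ?c, lw c') \<in> lexord (s - Id)"
      proof (cases "?d1 = c1")
        case True
        then have "?d2 \<noteq> c2" using ne by blast
        then have "(lw c2, lw ?d2) \<in> lexord (s - Id)" using min2[OF d(2) subd] by blast
        then show ?thesis unfolding split True by (rule lexord_append_leftI)
      next
        case False
        then have "(lw c1, lw ?d1) \<in> lexord (s - Id)" using min1[OF d(1)] by blast
        \<comment> \<open>The first segments have equal length, so \<open>lw c1\<close> is not
          merely a prefix and the comparison is decided before the second segments begin.\<close>
        moreover have "length (lw ?d1) \<le> length (lw c1)"
          unfolding length_label_word using maximal_chains_length[OF d(1)] maximal_chains_length[OF c1(1)] by simp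
        ultimately show ?thesis unfolding split by (rule lexord_sufI)
      qed
      ultimately show ?thesis by blast
    qed
    then show ?thesis using cM sub dsub by (intro bexI[of _ ?c]) auto
  qed
qed

lemma order_complex_chain:
  assumes c: "c \<in> maximal_chains r bot top" and s: "\<tau> \<subseteq> set c"
  shows "finite \<tau>" "a \<in> \<tau> \<Longrightarrow> b \<in> \<tau> \<Longrightarrow> (a, b) \<in> r \<or> (b, a) \<in> r" "w \<in> \<tau> \<Longrightarrow> (bot, w) \<in> r"
proof -
  show "finite \<tau>" using s finite_subset by auto
  have topF: "top \<in> Field r" using top[OF bot_in] by (auto simp: Field_def)
  show bw: "(bot, w) \<in> r" if "w \<in> \<tau>" for w
    using maximal_chains_between(1)[OF c _ bot_in topF] s that by blast
  assume ab: "a \<in> \<tau>" "b \<in> \<tau>"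
  obtain p q where pq: "c = p @ a # q" using ab s by (meson split_list subsetD)
  have "b \<in> set (p @ [a]) \<or> b \<in> set (a # q)" using ab s pq by auto
  moreover have aF: "a \<in> Field r" using bw[OF ab(1)] by (auto simp: Field_def)
  ultimately show "(a, b) \<in> r \<or> (b, a) \<in> r"
    using maximal_chains_split[of p a q bot top] c pq bot_in topF
      maximal_chains_between(2)[of "p @ [a]" bot a b] maximal_chains_between(1)[of "a # q" a top b] by blast
qed

text \<open>A face \<tau> lies in the interval from \<open>desc c\<close> to \<open>set c\<close>
  exactly when \<open>c\<close> is its filling. Uniqueness of the filling gives disjointness; its
  being lexicographically first gives the earlier interval required by
  \<open>shelling_of_order\<close>.\<close>

theorem order_complex_shelling: "shelling (rk top + 1 - rk bot) (order_complex r)"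
proof -
  let ?S = "maximal_chains r bot top"
  have topF: "top \<in> Field r" using top[OF bot_in] by (auto simp: Field_def)
  have setF: "set c \<subseteq> Field r" if "c \<in> ?S" for c
    using maximal_chains_between(1)[OF that _ bot_in topF] by (auto simp: Field_def)
  have fill: "\<exists>c\<in>?S. desc c \<subseteq> \<tau> \<and> \<tau> \<subseteq> set c \<and>
      (\<forall>c'\<in>?S. \<tau> \<subseteq> set c' \<longrightarrow> c' \<noteq> c \<longrightarrow> \<not> desc c' \<subseteq> \<tau> \<and> (lw c, lw c') \<in> lexord (s - Id))"
    if c: "c \<in> ?S" "\<tau> \<subseteq> set c" for c \<tau>
  proof (rule unique_filling[OF _ _ bot_in])
    show "finite \<tau>" by (rule order_complex_chain(1)[OF c])
    show "(a, b) \<in> r \<or> (b, a) \<in> r" if "a \<in> \<tau>" "b \<in> \<tau>" for a b by (rule order_complex_chain(2)[OF c that])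
    show "(bot, w) \<in> r" if "w \<in> \<tau>" for w by (rule order_complex_chain(3)[OF c that])
  qed
  have "finite ?S"
  proof (rule finite_subset)
    show "?S \<subseteq> {c. set c \<subseteq> Field r \<and> length c = rk top + 1 - rk bot}"
      using setF maximal_chains_length by blast
  qed (use fin in \<open>rule finite_lists_length_eq\<close>)
  moreover have "?S \<noteq> {}"
  proof -
    obtain c where "c \<in> ?S" using EL_chain[OF top[OF bot_in]] .
    then show ?thesis by auto
  qed
  moreover have tr: "trans (lexord (s - Id))"
  proof (rule lexord_transI, rule trans_diff_Id)
    show "trans s" "antisym s"
      using EL unfolding EL_labeling_def partial_order_on_def preorder_on_def by simp_all
  qed
  ultimately have "shelling (rk top + 1 - rk bot) (\<Union>c\<in>?S. {\<tau>. desc c \<subseteq> \<tau> \<and> \<tau> \<subseteq> set c})"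
  proof (intro shelling_of_order[where lt = "\<lambda>c d. (lw c, lw d) \<in> lexord (s - Id)"])
    show "(lw i, lw l) \<in> lexord (s - Id)"
      if "(lw i, lw j) \<in> lexord (s - Id)" "(lw j, lw l) \<in> lexord (s - Id)" for i j l
      using tr that by (rule transD)
    show "(lw i, lw i) \<notin> lexord (s - Id)" for i by (rule lexord_irreflexive) simp
    show "card (set c) = rk top + 1 - rk bot" if "c \<in> ?S" for c
      using maximal_chains_distinct[OF that] maximal_chains_length[OF that] by (simp add: distinct_card)
    show "desc c \<subseteq> set c" for c
    proof
      fix w assume "w \<in> desc c"
      then have "w \<in> set (butlast (tl c))" by (rule subsetD[OF descents_inner])
      then have "w \<in> set (tl c)" by (rule in_set_butlastD)
      then show "w \<in> set c" by (cases c) simp_all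
    qed
    show "c = d" if cd: "c \<in> ?S" "d \<in> ?S" "desc c \<subseteq> \<tau>" "\<tau> \<subseteq> set c" "desc d \<subseteq> \<tau>" "\<tau> \<subseteq> set d" for c d \<tau>
    proof -
      obtain e where e: "\<forall>c'\<in>?S. \<tau> \<subseteq> set c' \<longrightarrow> c' \<noteq> e \<longrightarrow> \<not> desc c' \<subseteq> \<tau> \<and> (lw e, lw c') \<in> lexord (s - Id)"
        using fill[OF cd(1,4)] by (elim bexE conjE)
      have "c = e" using bspec[OF e cd(1)] cd(3,4) by blast
      moreover have "d = e" using bspec[OF e cd(2)] cd(5,6) by blast
      ultimately show ?thesis by simp
    qed
    show "\<exists>d\<in>?S. (lw d, lw c) \<in> lexord (s - Id) \<and> desc d \<subseteq> \<tau> \<and> \<tau> \<subseteq> set d"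
      if c: "c \<in> ?S" "\<tau> \<subseteq> set c" "\<not> desc c \<subseteq> \<tau>" for c \<tau>
    proof -
      obtain d where d: "d \<in> ?S" "desc d \<subseteq> \<tau>" "\<tau> \<subseteq> set d"
        and e: "\<forall>c'\<in>?S. \<tau> \<subseteq> set c' \<longrightarrow> c' \<noteq> d \<longrightarrow> \<not> desc c' \<subseteq> \<tau> \<and> (lw d, lw c') \<in> lexord (s - Id)"
        using fill[OF c(1,2)] by (elim bexE conjE)
      have "c \<noteq> d" using d(2) c(3) by blast
      then have "(lw d, lw c) \<in> lexord (s - Id)" using bspec[OF e c(1)] c(2) by blast
      then show ?thesis using d by blast
    qed
  qed simp_all
  also have "(\<Union>c\<in>?S. {\<tau>. desc c \<subseteq> \<tau> \<and> \<tau> \<subseteq> set c}) = order_complex r"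
  proof (intro equalityI subsetI)
    fix \<tau> assume "\<tau> \<in> (\<Union>c\<in>?S. {\<tau>. desc c \<subseteq> \<tau> \<and> \<tau> \<subseteq> set c})"
    then obtain c where c: "c \<in> ?S" "\<tau> \<subseteq> set c" by blast
    show "\<tau> \<in> order_complex r"
      using order_complex_chain(1,2)[OF c] unfolding order_complex_def Chains_def by blast
  next
    fix \<tau> assume "\<tau> \<in> order_complex r"
    then have t: "finite \<tau>" "\<And>a b. a \<in> \<tau> \<Longrightarrow> b \<in> \<tau> \<Longrightarrow> (a, b) \<in> r \<or> (b, a) \<in> r"
      unfolding order_complex_def Chains_def by auto
    have b: "(bot, w) \<in> r" if "w \<in> \<tau>" for w
      using t(2)[OF that that] by (intro bot) (auto simp: Field_def)
    have "\<exists>c\<in>?S. desc c \<subseteq> \<tau> \<and> \<tau> \<subseteq> set c \<and>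
      (\<forall>c'\<in>?S. \<tau> \<subseteq> set c' \<longrightarrow> c' \<noteq> c \<longrightarrow> \<not> desc c' \<subseteq> \<tau> \<and> (lw c, lw c') \<in> lexord (s - Id))"
      by (rule unique_filling[OF t bot_in b])
    then show "\<tau> \<in> (\<Union>c\<in>?S. {\<tau>. desc c \<subseteq> \<tau> \<and> \<tau> \<subseteq> set c})" by blast
  qed
  finally show ?thesis .
qed

end

section \<open>EL-labelings from strictly minimal covers\<close>

lemma successively_covers_le:
  assumes "trans r" "successively (covers r) c" "c \<noteq> []" "(last c, last c) \<in> r"
  shows "(hd c, last c) \<in> r"
  using assms(2-4)
proof (induction c rule: induct_list012)
  case (3 x y zs)
  have xy: "(x, y) \<in> r" using 3(3) by (simp add: covers_def)
  have "(hd (y # zs), last (y # zs)) \<in> r" by (rule 3(2)) (use 3(3,5) in simp_all)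
  then have "(y, last (y # zs)) \<in> r" by (simp only: list.sel)
  from transD[OF assms(1) xy this] show ?case by simp
qed simp_all

text \<open>\<open>M x y\<close> is the atom of the interval with least label. By induction the tail
  of an increasing chain is the greedy chain above its second element, so the first two labels are
  those compared in \<open>only\<close>, which forces the greedy first step. Lexicographic
  minimality comes from \<open>least\<close> at the first step where chains part.\<close>

lemma EL_labeling_greedy:
  fixes r :: "'a rel" and rk :: "'a \<Rightarrow> nat"
  assumes po: "Partial_order r" and s: "Partial_order s" "\<And>x y. covers r x y \<Longrightarrow> lam x y \<in> Field s"
    and rk: "\<And>x y. covers r x y \<Longrightarrow> rk y = Suc (rk x)" and rk_mono: "\<And>x y. (x, y) \<in> r \<Longrightarrow> rk x \<le> rk y"
    and cov: "\<And>x y. (x, y) \<in> r \<Longrightarrow> x \<noteq> y \<Longrightarrow> covers r x (M x y)"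
    and le: "\<And>x y. (x, y) \<in> r \<Longrightarrow> x \<noteq> y \<Longrightarrow> (M x y, y) \<in> r"
    and least: "\<And>x y z. covers r x z \<Longrightarrow> (z, y) \<in> r \<Longrightarrow> z \<noteq> M x y \<Longrightarrow> (lam x (M x y), lam x z) \<in> s - Id"
    and incr: "\<And>x y. (x, y) \<in> r \<Longrightarrow> x \<noteq> y \<Longrightarrow> M x y \<noteq> y \<Longrightarrow>
       (lam x (M x y), lam (M x y) (M (M x y) y)) \<in> s - Id"
    and only: "\<And>x y z. covers r x z \<Longrightarrow> (z, y) \<in> r \<Longrightarrow> z \<noteq> y \<Longrightarrow>
       (lam x z, lam z (M z y)) \<in> s - Id \<Longrightarrow> z = M x y"
  shows "EL_labeling s lam r"
proof -
  have tr: "trans r" and anti: "antisym r" and refl: "refl_on (Field r) r"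
    using po unfolding partial_order_on_def preorder_on_def by simp_all
  have single: "c = [x]" if "c \<in> maximal_chains r x x" for c x
  proof -
    have c: "c \<noteq> []" "hd c = x" "last c = x" "successively (covers r) c" using that by (auto simp: maximal_chains_def)
    then have "length c = 1" using successively_covers_rank[of r rk c] rk by simp
    then show ?thesis using c(2) by (auto simp: length_Suc_conv)
  qed
  have split: "\<exists>z d. c = x # z # d \<and> covers r x z \<and> z # d \<in> maximal_chains r z y \<and> (z, y) \<in> r"
    if c: "c \<in> maximal_chains r x y" and xy: "x \<noteq> y" "y \<in> Field r" for c x y
  proof -
    have c': "c \<noteq> []" "hd c = x" "last c = y" "successively (covers r) c" using c by (auto simp: maximal_chains_def)
    obtain d where d: "c = x # d" using c' by (cases c) auto
    then have "d \<noteq> []" using c' xy by auto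
    then obtain z e where e: "c = x # z # e" using d by (cases d) auto
    have z: "covers r x z" "successively (covers r) (z # e)" "last (z # e) = y" using c' e by auto
    have "(y, y) \<in> r" using refl xy(2) by (simp add: refl_on_def)
    then have "(z, y) \<in> r" using successively_covers_le[OF tr z(2)] z(3) by simp
    then show ?thesis using e z by (auto simp: maximal_chains_def)
  qed
  \<comment> \<open>The induction also records that the chain starts with \<open>M x y\<close>;
    otherwise the hypotheses on two consecutive labels could not be applied.\<close>
  have main: "\<exists>c\<in>maximal_chains r x y. increasing_word s (label_word lam c) \<and>
      (x \<noteq> y \<longrightarrow> (\<exists>d. c = x # M x y # d)) \<and>
      (\<forall>c'\<in>maximal_chains r x y. c' \<noteq> c \<longrightarrow> \<not> increasing_word s (label_word lam c') \<and>
         (label_word lam c, label_word lam c') \<in> lexord (s - Id))" if "(x, y) \<in> r" for x y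
    using that
  proof (induction "rk y - rk x" arbitrary: x rule: less_induct)
    case less
    have yF: "y \<in> Field r" using less.prems by (auto simp: Field_def)
    show ?case
    proof (cases "x = y")
      case True
      have c: "[x] \<in> maximal_chains r x y" using True by (simp add: maximal_chains_def)
      have inc: "increasing_word s (label_word lam [x])" by (simp add: increasing_word_def)
      have only: "c' = [x]" if "c' \<in> maximal_chains r x y" for c' using single that True by simp
      show ?thesis
      proof (rule bexI[OF _ c], intro conjI ballI impI)
        fix c' assume "c' \<in> maximal_chains r x y" "c' \<noteq> [x]"
        then show "\<not> increasing_word s (label_word lam c')"
          "(label_word lam [x], label_word lam c') \<in> lexord (s - Id)"
          using only[of c'] by simp_all
      qed (use True inc in simp_all)
    next
      case False
      have dec: "rk y - rk z < rk y - rk x" if "covers r x z" "(z, y) \<in> r" for z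
        using rk[OF that(1)] rk_mono[OF that(2)] by simp
      let ?z = "M x y"
      note z = cov[OF less.prems False] le[OF less.prems False]
      obtain c where c: "c \<in> maximal_chains r ?z y" "increasing_word s (label_word lam c)"
        and cM: "?z \<noteq> y \<longrightarrow> (\<exists>d. c = ?z # M ?z y # d)"
        and c': "\<forall>c'\<in>maximal_chains r ?z y. c' \<noteq> c \<longrightarrow> \<not> increasing_word s (label_word lam c') \<and>
         (label_word lam c, label_word lam c') \<in> lexord (s - Id)"
        using less.hyps[OF dec[OF z] z(2)] by (elim bexE conjE)
      obtain d where d: "c = ?z # d" using c(1) unfolding maximal_chains_def by (cases c) auto
      have xc: "x # c \<in> maximal_chains r x y"
        using c(1) z(1) d by (auto simp: maximal_chains_def)
      have lw: "label_word lam (x # c) = lam x ?z # label_word lam c" using d by simp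
      have inc: "increasing_word s (label_word lam (x # c))"
      proof (cases "?z = y")
        case True
        then have "c = [y]" using single c(1) by simp
        then show ?thesis using d lw by (simp add: increasing_word_def)
      next
        case False
        then obtain e where e: "c = ?z # M ?z y # e" using cM by blast
        have "(lam x ?z, lam ?z (M ?z y)) \<in> s - Id" using incr[OF less.prems \<open>x \<noteq> y\<close> False] .
        then show ?thesis using c(2) unfolding lw unfolding e increasing_word_def by simp
      qed
      have "\<not> increasing_word s (label_word lam b) \<and>
         (label_word lam (x # c), label_word lam b) \<in> lexord (s - Id)"
        if b: "b \<in> maximal_chains r x y" "b \<noteq> x # c" for b
      proof -
        obtain w e where we: "b = x # w # e" "covers r x w" "w # e \<in> maximal_chains r w y" "(w, y) \<in> r"
          using split[OF b(1) False yF] by blast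
        have lwb: "label_word lam b = lam x w # label_word lam (w # e)" using we(1) by simp
        have tail: "increasing_word s (label_word lam (w # e))" if "increasing_word s (label_word lam b)"
          using that unfolding lwb increasing_word_def by (cases "label_word lam (w # e)") auto
        show ?thesis
        proof (cases "w = ?z")
          case True
          then have "w # e \<noteq> c" using b(2) we(1) by simp
          then have t: "\<not> increasing_word s (label_word lam (w # e))"
              "(label_word lam c, label_word lam (w # e)) \<in> lexord (s - Id)"
            using c' we(3) True by blast+
          then show ?thesis using tail unfolding lw lwb True by (auto simp: lexord_cons_cons)
        next
          case wz: False
          have lt: "(lam x ?z, lam x w) \<in> s - Id" by (rule least[OF we(2,4) wz])
          have "\<not> increasing_word s (label_word lam b)"
          proof
            assume I: "increasing_word s (label_word lam b)"
            have wy: "w \<noteq> y"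
            proof
              assume wy: "w = y"
              have "?z = x \<or> ?z = y" using we(2) z unfolding covers_def wy by blast
              then show False using z(1) wz wy by (auto simp: covers_def)
            qed
            obtain f where f: "f \<in> maximal_chains r w y" "w \<noteq> y \<longrightarrow> (\<exists>d. f = w # M w y # d)"
              and f': "\<forall>c'\<in>maximal_chains r w y. c' \<noteq> f \<longrightarrow> \<not> increasing_word s (label_word lam c') \<and>
                 (label_word lam f, label_word lam c') \<in> lexord (s - Id)"
              using less.hyps[OF dec[OF we(2,4)] we(4)] by (elim bexE conjE)
            \<comment> \<open>By uniqueness in the smaller interval, the increasing tail is the
              greedy chain, so its first step goes to \<open>M w y\<close>.\<close>
            have "w # e = f" using f' we(3) tail[OF I] by blast
            then obtain g where "w # e = w # M w y # g" using f(2) wy by blast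
            then have "(lam x w, lam w (M w y)) \<in> s - Id"
              using I unfolding lwb increasing_word_def by auto
            then show False using only[OF we(2,4) wy] wz by blast
          qed
          then show ?thesis using lt unfolding lw lwb by (simp add: lexord_cons_cons)
        qed
      qed
      note others = this
      show ?thesis
      proof (rule bexI[OF _ xc], intro conjI ballI impI)
        show "\<exists>d. x # c = x # ?z # d" using d by blast
        fix b assume b: "b \<in> maximal_chains r x y" "b \<noteq> x # c"
        show "\<not> increasing_word s (label_word lam b)"
          "(label_word lam (x # c), label_word lam b) \<in> lexord (s - Id)"
          using others[OF b] by simp_all
      qed (fact inc)
    qed
  qed
  show ?thesis
    unfolding EL_labeling_def
  proof (intro conjI allI impI ballI)
    fix p assume "p \<in> r"
    then show "case p of (x, y) \<Rightarrow> \<exists>c\<in>maximal_chains r x y. increasing_word s (label_word lam c) \<and>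
        (\<forall>c'\<in>maximal_chains r x y. c' \<noteq> c \<longrightarrow> \<not> increasing_word s (label_word lam c') \<and>
           (label_word lam c, label_word lam c') \<in> lexord (s - Id))"
      using main[of "fst p" "snd p"] by (auto simp: case_prod_unfold)
  qed (fact s)+
qed

section \<open>The order on weighted partitions\<close>

abbreviation wt :: "nat set \<times> (nat \<Rightarrow>\<^sub>0 nat) \<Rightarrow> nat \<Rightarrow> nat" where
  "wt p u \<equiv> Poly_Mapping.lookup (snd p) u"

definition merge :: "weighted_partition \<Rightarrow> nat set \<times> (nat \<Rightarrow>\<^sub>0 nat) \<Rightarrow> nat set \<times> (nat \<Rightarrow>\<^sub>0 nat) \<Rightarrow> nat \<Rightarrow> weighted_partition" where
  "merge \<alpha> p q u = insert (fst p \<union> fst q, snd p + snd q + Poly_Mapping.single u 1) (\<alpha> - {p, q})"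

definition weight_sum :: "weighted_partition \<Rightarrow> nat set \<Rightarrow> nat \<Rightarrow> nat" where
  "weight_sum \<alpha> C u = (\<Sum>p\<in>{p \<in> \<alpha>. fst p \<subseteq> C}. wt p u)"

text \<open>A closed form of the merge order, proved equivalent in \<open>R_iff\<close>. Asking for
  a nonnegative remainder in every colour is enough, because its total in a block always equals the
  number of merges still to be made there.\<close>

definition below :: "weighted_partition \<Rightarrow> weighted_partition \<Rightarrow> bool" where
  "below \<alpha> \<beta> \<longleftrightarrow> (\<forall>p\<in>\<alpha>. \<exists>q\<in>\<beta>. fst p \<subseteq> fst q) \<and> (\<forall>q\<in>\<beta>. \<forall>u. weight_sum \<alpha> (fst q) u \<le> wt q u)"

lemma merge_commute: "merge \<alpha> p q u = merge \<alpha> q p u"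
  by (simp add: merge_def Un_commute insert_commute add.commute)

lemma merge_step_iff:
  "(\<alpha>, \<beta>) \<in> merge_step k \<longleftrightarrow> (\<exists>p\<in>\<alpha>. \<exists>q\<in>\<alpha>. \<exists>u\<in>{1..k}. fst p \<noteq> fst q \<and> \<beta> = merge \<alpha> p q u)"
  by (simp only: merge_step_def merge_def mem_Collect_eq case_prod_conv Bex_def split_paired_Ex
      fst_conv snd_conv) blast

context
  fixes n k :: nat
begin

abbreviation (input) W where "W \<equiv> weighted_partitions n k"

section \<open>Blocks, merges and the comparison of weights\<close>

lemma W_block:
  assumes "\<alpha> \<in> W" "p \<in> \<alpha>"
  shows "fst p \<noteq> {}" "fst p \<subseteq> {1..n}" "finite (fst p)" "Poly_Mapping.keys (snd p) \<subseteq> {1..k}"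
    "(\<Sum>u\<in>{1..k}. wt p u) + 1 = card (fst p)"
proof -
  have P: "partition_on {1..n} (fst ` \<alpha>)" and w: "snd p \<in> WComp (card (fst p) - 1)"
    and k: "Poly_Mapping.keys (snd p) \<subseteq> {1..k}"
    using assms unfolding weighted_partitions_def by (auto simp: case_prod_unfold)
  show ne: "fst p \<noteq> {}" using partition_onD3[OF P] assms(2) by force
  show sub: "fst p \<subseteq> {1..n}" unfolding partition_onD1[OF P] using assms(2) by blast
  then show fin: "finite (fst p)" using finite_subset by blast
  show "Poly_Mapping.keys (snd p) \<subseteq> {1..k}" by (rule k)
  have "(\<Sum>u\<in>{1..k}. wt p u) = (\<Sum>u\<in>Poly_Mapping.keys (snd p). wt p u)"
    using k by (intro sum.mono_neutral_right) (auto simp: in_keys_iff)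
  also have "\<dots> = card (fst p) - 1" using w by (simp add: WComp_def)
  finally show "(\<Sum>u\<in>{1..k}. wt p u) + 1 = card (fst p)"
    using ne fin by (simp add: card_gt_0_iff Suc_leI)
qed

lemma W_disjoint:
  assumes "\<alpha> \<in> W" "p \<in> \<alpha>" "q \<in> \<alpha>" "x \<in> fst p" "x \<in> fst q"
  shows "p = q"
proof -
  have P: "partition_on {1..n} (fst ` \<alpha>)" and i: "inj_on fst \<alpha>"
    using assms(1) unfolding weighted_partitions_def by auto
  have "fst p = fst q"
  proof (rule ccontr)
    assume "fst p \<noteq> fst q"
    then have "disjnt (fst p) (fst q)"
      using partition_onD2[OF P] assms(2,3) by (intro pairwiseD[of disjnt "fst ` \<alpha>"]) auto
    then show False using assms(4,5) by (auto simp: disjnt_iff)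
  qed
  then show ?thesis using i assms by (auto dest: inj_onD)
qed

lemma W_cover: assumes "\<alpha> \<in> W" "x \<in> {1..n}" shows "\<exists>p\<in>\<alpha>. x \<in> fst p"
  using assms unfolding weighted_partitions_def partition_on_def by blast

lemma W_finite: assumes "\<alpha> \<in> W" shows "finite \<alpha>" "card \<alpha> \<le> n"
proof -
  have i: "inj_on fst \<alpha>" and P: "partition_on {1..n} (fst ` \<alpha>)" using assms unfolding weighted_partitions_def by auto
  have f: "finite (fst ` \<alpha>)" using P finite_elements by blast
  then show "finite \<alpha>" using i by (rule finite_imageD)
  have m: "Min (fst p) \<in> fst p" if "p \<in> \<alpha>" for p using W_block[OF assms that] by simp
  have "inj_on (\<lambda>p. Min (fst p)) \<alpha>" using m W_disjoint[OF assms] by (intro inj_onI) metis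
  moreover have "(\<lambda>p. Min (fst p)) ` \<alpha> \<subseteq> {1..n}" using m W_block(2)[OF assms] by blast
  ultimately show "card \<alpha> \<le> n" using card_inj_on_le[of _ \<alpha> "{1..n}"] by simp
qed

lemma W_I:
  assumes "\<And>p. p \<in> \<alpha> \<Longrightarrow> fst p \<noteq> {} \<and> fst p \<subseteq> {1..n} \<and> Poly_Mapping.keys (snd p) \<subseteq> {1..k} \<and>
      (\<Sum>u\<in>{1..k}. wt p u) + 1 = card (fst p)"
    and dis: "\<And>p q x. p \<in> \<alpha> \<Longrightarrow> q \<in> \<alpha> \<Longrightarrow> x \<in> fst p \<Longrightarrow> x \<in> fst q \<Longrightarrow> p = q"
    and cov: "\<And>x. x \<in> {1..n} \<Longrightarrow> \<exists>p\<in>\<alpha>. x \<in> fst p"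
  shows "\<alpha> \<in> W"
proof -
  have "partition_on {1..n} (fst ` \<alpha>)"
  proof (rule partition_onI)
    show "\<Union>(fst ` \<alpha>) = {1..n}" using assms(1) cov by blast
    show "disjnt A B" if "A \<in> fst ` \<alpha>" "B \<in> fst ` \<alpha>" "A \<noteq> B" for A B
      using that dis unfolding disjnt_iff by blast
  qed (use assms(1) in blast)
  moreover have "inj_on fst \<alpha>"
  proof (rule inj_onI)
    fix p q assume pq: "p \<in> \<alpha>" "q \<in> \<alpha>" "fst p = fst q"
    then obtain x where "x \<in> fst p" using assms(1) by blast
    then show "p = q" using dis pq by metis
  qed
  moreover have "snd p \<in> WComp (card (fst p) - 1) \<and> Poly_Mapping.keys (snd p) \<subseteq> {1..k}" if p: "p \<in> \<alpha>" for p
  proof -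
    have k: "Poly_Mapping.keys (snd p) \<subseteq> {1..k}" using assms(1)[OF p] by blast
    have "(\<Sum>u\<in>Poly_Mapping.keys (snd p). wt p u) = (\<Sum>u\<in>{1..k}. wt p u)"
      using k by (intro sum.mono_neutral_left) (auto simp: in_keys_iff)
    moreover have "(\<Sum>u\<in>{1..k}. wt p u) + 1 = card (fst p)" using assms(1)[OF p] by blast
    ultimately have "(\<Sum>u\<in>Poly_Mapping.keys (snd p). wt p u) = card (fst p) - 1"
      by (metis add_diff_cancel_right')
    then show ?thesis using k by (auto simp: WComp_def)
  qed
  ultimately show ?thesis unfolding weighted_partitions_def by (auto simp: case_prod_unfold)
qed

lemma merge_new: assumes "\<alpha> \<in> W" "p \<in> \<alpha>" "q \<in> \<alpha>" "p \<noteq> q"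
  shows "(fst p \<union> fst q, \<mu>) \<notin> \<alpha>"
proof
  assume new: "(fst p \<union> fst q, \<mu>) \<in> \<alpha>"
  obtain x y where xy: "x \<in> fst p" "y \<in> fst q" using W_block(1)[OF assms(1)] assms(2,3) by blast
  have "p = (fst p \<union> fst q, \<mu>)"
    by (rule W_disjoint[OF assms(1,2) new, of x]) (use xy in simp_all)
  moreover have "q = (fst p \<union> fst q, \<mu>)"
    by (rule W_disjoint[OF assms(1,3) new, of y]) (use xy in simp_all)
  ultimately show False using assms(4) by metis
qed

lemma fst_ne: assumes "\<alpha> \<in> W" "p \<in> \<alpha>" "q \<in> \<alpha>" shows "fst p = fst q \<longleftrightarrow> p = q"
  using W_disjoint[OF assms] W_block(1)[OF assms(1,2)] by auto

lemma merge_W: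
  assumes a: "\<alpha> \<in> W" and p: "p \<in> \<alpha>" and q: "q \<in> \<alpha>" and pq: "p \<noteq> q" and u: "u \<in> {1..k}"
  shows "merge \<alpha> p q u \<in> W" "card (merge \<alpha> p q u) + 1 = card \<alpha>"
proof -
  let ?N = "(fst p \<union> fst q, snd p + snd q + Poly_Mapping.single u 1)"
  have dpq: "fst p \<inter> fst q = {}" using W_disjoint[OF a p q] pq by blast
  show "merge \<alpha> p q u \<in> W"
  proof (rule W_I)
    fix r assume "r \<in> merge \<alpha> p q u"
    then consider "r = ?N" | "r \<in> \<alpha>" unfolding merge_def by blast
    then show "fst r \<noteq> {} \<and> fst r \<subseteq> {1..n} \<and> Poly_Mapping.keys (snd r) \<subseteq> {1..k} \<and>
      (\<Sum>u\<in>{1..k}. wt r u) + 1 = card (fst r)"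
    proof cases
      case 1
      have "Poly_Mapping.keys (snd r) \<subseteq> {1..k}"
      proof -
        have "Poly_Mapping.keys (snd r) \<subseteq> Poly_Mapping.keys (snd p) \<union> Poly_Mapping.keys (snd q) \<union> {u}"
          unfolding 1 by (auto simp: in_keys_iff lookup_add lookup_single when_def split: if_splits)
        then show ?thesis using W_block(4)[OF a p] W_block(4)[OF a q] u by blast
      qed
      moreover have "(\<Sum>v\<in>{1..k}. wt r v) = (\<Sum>v\<in>{1..k}. wt p v) + (\<Sum>v\<in>{1..k}. wt q v) + (\<Sum>v\<in>{1..k}. if u = v then 1 else 0)"
        unfolding 1 by (simp add: lookup_add lookup_single sum.distrib when_def)
      moreover have "(\<Sum>v\<in>{1..k}. if u = v then 1 else 0) = (1::nat)" using u by simp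
      moreover have "card (fst r) = card (fst p) + card (fst q)"
        unfolding 1 using dpq W_block(3)[OF a] p q by (simp add: card_Un_disjoint)
      ultimately show ?thesis using W_block[OF a p] W_block[OF a q] unfolding 1 by auto
    next
      case 2
      then show ?thesis using W_block[OF a 2] by blast
    qed
  next
    fix r s x assume "r \<in> merge \<alpha> p q u" "s \<in> merge \<alpha> p q u" "x \<in> fst r" "x \<in> fst s"
    then show "r = s" using W_disjoint[OF a, of r s x] W_disjoint[OF a, of r p x] W_disjoint[OF a, of r q x]
        W_disjoint[OF a, of s p x] W_disjoint[OF a, of s q x] p q unfolding merge_def by auto
  next
    fix x assume "x \<in> {1..n}"
    then obtain r where "r \<in> \<alpha>" "x \<in> fst r" using W_cover[OF a] by blast
    then show "\<exists>r\<in>merge \<alpha> p q u. x \<in> fst r" unfolding merge_def by (cases "r = p \<or> r = q") auto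
  qed
  have "card (\<alpha> - {p, q}) + 2 = card \<alpha>"
  proof -
    have "card {p, q} \<le> card \<alpha>" using p q W_finite[OF a] by (intro card_mono) auto
    then show ?thesis using p q pq W_finite[OF a] by (subst card_Diff_subset) auto
  qed
  then show "card (merge \<alpha> p q u) + 1 = card \<alpha>"
    unfolding merge_def using merge_new[OF a p q pq] W_finite[OF a] by simp
qed

lemma weight_sum_merge_in:
  assumes a: "\<alpha> \<in> W" and p: "p \<in> \<alpha>" and q: "q \<in> \<alpha>" and pq: "p \<noteq> q" and C: "fst p \<subseteq> C" "fst q \<subseteq> C"
  shows "weight_sum (merge \<alpha> p q u) C v = weight_sum \<alpha> C v + (if v = u then 1 else 0)"
proof -
  let ?N = "(fst p \<union> fst q, snd p + snd q + Poly_Mapping.single u 1)"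
  let ?I = "{r \<in> \<alpha>. fst r \<subseteq> C} - {p, q}"
  have f: "finite {r \<in> \<alpha>. fst r \<subseteq> C}" using W_finite[OF a] by simp
  have eq: "{r \<in> merge \<alpha> p q u. fst r \<subseteq> C} = insert ?N ?I" unfolding merge_def using C by auto
  have "?N \<notin> ?I" using merge_new[OF a p q pq] by blast
  then have "weight_sum (merge \<alpha> p q u) C v = wt ?N v + (\<Sum>r\<in>?I. wt r v)"
    unfolding weight_sum_def eq using f by (subst sum.insert) auto
  moreover have "weight_sum \<alpha> C v = wt p v + wt q v + (\<Sum>r\<in>?I. wt r v)"
  proof -
    have "weight_sum \<alpha> C v = (\<Sum>r\<in>insert p (insert q ?I). wt r v)"
      unfolding weight_sum_def using p q C by (intro sum.cong) auto
    also have "\<dots> = wt p v + (wt q v + (\<Sum>r\<in>?I. wt r v))"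
      using f pq by (subst sum.insert, simp, simp, subst sum.insert) simp_all
    finally show ?thesis by simp
  qed
  ultimately show ?thesis by (simp add: lookup_add lookup_single when_def)
qed

lemma weight_sum_merge_out:
  assumes "\<not> fst p \<subseteq> C" "\<not> fst q \<subseteq> C"
  shows "weight_sum (merge \<alpha> p q u) C v = weight_sum \<alpha> C v"
proof -
  have "{r \<in> merge \<alpha> p q u. fst r \<subseteq> C} = {r \<in> \<alpha>. fst r \<subseteq> C}" unfolding merge_def using assms by auto
  then show ?thesis by (simp add: weight_sum_def)
qed

text \<open>Only the block \<open>r\<close> of \<beta> containing both merged blocks notices the
  merge. Its weight sum grows by one in colour \<open>u\<close>, which turns the inequality there
  into a strict one.\<close>

lemma below_merge:
  assumes a: "\<alpha> \<in> W" and b: "\<beta> \<in> W" and p: "p \<in> \<alpha>" and q: "q \<in> \<alpha>" and pq: "p \<noteq> q"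
  shows "below (merge \<alpha> p q u) \<beta> \<longleftrightarrow> below \<alpha> \<beta> \<and>
    (\<exists>r\<in>\<beta>. fst p \<subseteq> fst r \<and> fst q \<subseteq> fst r \<and> weight_sum \<alpha> (fst r) u < wt r u)"
proof -
  let ?N = "(fst p \<union> fst q, snd p + snd q + Poly_Mapping.single u 1)"
  have out: "weight_sum (merge \<alpha> p q u) (fst r') v = weight_sum \<alpha> (fst r') v"
    if r: "r \<in> \<beta>" "fst p \<subseteq> fst r" "fst q \<subseteq> fst r" "r' \<in> \<beta>" "r' \<noteq> r" for r r' v
  proof (rule weight_sum_merge_out)
    obtain x y where "x \<in> fst p" "y \<in> fst q" using W_block(1)[OF a] p q by blast
    then show "\<not> fst p \<subseteq> fst r'" "\<not> fst q \<subseteq> fst r'" using W_disjoint[OF b r(1,4)] r by blast+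
  qed
  show ?thesis
  proof
    assume L: "below (merge \<alpha> p q u) \<beta>"
    have "?N \<in> merge \<alpha> p q u" by (simp add: merge_def)
    then obtain r where r: "r \<in> \<beta>" "fst ?N \<subseteq> fst r" using L unfolding below_def by blast
    then have pr: "fst p \<subseteq> fst r" "fst q \<subseteq> fst r" by auto
    note ws = weight_sum_merge_in[OF a p q pq pr]
    have le: "weight_sum (merge \<alpha> p q u) (fst r') v \<le> wt r' v" if "r' \<in> \<beta>" for r' v
      using L that unfolding below_def by blast
    have "weight_sum \<alpha> (fst r) u < wt r u" using le[OF r(1), of u] ws[of u u] by simp
    moreover have "below \<alpha> \<beta>"
      unfolding below_def
    proof (intro conjI ballI allI)
      fix s assume s: "s \<in> \<alpha>"
      show "\<exists>r\<in>\<beta>. fst s \<subseteq> fst r"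
      proof (cases "s = p \<or> s = q")
        case False
        then have "s \<in> merge \<alpha> p q u" using s by (simp add: merge_def)
        then show ?thesis using L unfolding below_def by blast
      qed (use r pr in blast)
    next
      fix r' v assume r': "r' \<in> \<beta>"
      show "weight_sum \<alpha> (fst r') v \<le> wt r' v"
        using le[OF r', of v] ws[of u v] out[OF r(1) pr r', of v] by (cases "r' = r") auto
    qed
    ultimately show "below \<alpha> \<beta> \<and> (\<exists>r\<in>\<beta>. fst p \<subseteq> fst r \<and> fst q \<subseteq> fst r \<and> weight_sum \<alpha> (fst r) u < wt r u)"
      using r pr by blast
  next
    assume R: "below \<alpha> \<beta> \<and> (\<exists>r\<in>\<beta>. fst p \<subseteq> fst r \<and> fst q \<subseteq> fst r \<and> weight_sum \<alpha> (fst r) u < wt r u)"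
    then obtain r where r: "r \<in> \<beta>" and pr: "fst p \<subseteq> fst r" "fst q \<subseteq> fst r" and lt: "weight_sum \<alpha> (fst r) u < wt r u"
      by blast
    note ws = weight_sum_merge_in[OF a p q pq pr]
    show "below (merge \<alpha> p q u) \<beta>"
      unfolding below_def
    proof (intro conjI ballI allI)
      fix s assume "s \<in> merge \<alpha> p q u"
      then consider "s = ?N" | "s \<in> \<alpha>" unfolding merge_def by blast
      then show "\<exists>r\<in>\<beta>. fst s \<subseteq> fst r"
      proof cases
        case 1
        then show ?thesis using r pr by (intro bexI[of _ r]) auto
      next
        case 2
        then show ?thesis using R unfolding below_def by blast
      qed
    next
      fix r' v assume r': "r' \<in> \<beta>"
      have "weight_sum \<alpha> (fst r') v \<le> wt r' v" using R r' unfolding below_def by blast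
      then show "weight_sum (merge \<alpha> p q u) (fst r') v \<le> wt r' v"
        using ws[of u v] lt out[OF r pr r', of v] by (cases "r' = r"; cases "v = u") auto
    qed
  qed
qed

text \<open>A block \<open>C\<close> of \<open>\<beta>\<close> made of \<open>t\<close> blocks of \<open>\<alpha>\<close> needs \<open>t - 1\<close> more units of weight.\<close>

lemma weight_count:
  assumes a: "\<alpha> \<in> W" and b: "\<beta> \<in> W" and ab: "below \<alpha> \<beta>" and r: "r \<in> \<beta>"
  shows "(\<Sum>u\<in>{1..k}. weight_sum \<alpha> (fst r) u) + card {p \<in> \<alpha>. fst p \<subseteq> fst r} = (\<Sum>u\<in>{1..k}. wt r u) + 1"
proof -
  let ?I = "{p \<in> \<alpha>. fst p \<subseteq> fst r}"
  have f: "finite ?I" using W_finite[OF a] by simp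
  have "(\<Sum>u\<in>{1..k}. weight_sum \<alpha> (fst r) u) = (\<Sum>p\<in>?I. \<Sum>u\<in>{1..k}. wt p u)"
    unfolding weight_sum_def by (rule sum.swap)
  then have "(\<Sum>u\<in>{1..k}. weight_sum \<alpha> (fst r) u) + card ?I = (\<Sum>p\<in>?I. (\<Sum>u\<in>{1..k}. wt p u) + 1)"
    by (simp only: sum.distrib card_eq_sum)
  also have "\<dots> = (\<Sum>p\<in>?I. card (fst p))" using W_block(5)[OF a] by (intro sum.cong) auto
  also have "\<dots> = card (\<Union>p\<in>?I. fst p)"
    using f W_block(3)[OF a] W_disjoint[OF a] by (intro card_UN_disjoint[symmetric]) (simp, simp, blast)
  also have "(\<Union>p\<in>?I. fst p) = fst r"
  proof (intro equalityI subsetI)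
    fix x assume x: "x \<in> fst r"
    then obtain p where p: "p \<in> \<alpha>" "x \<in> fst p" using W_cover[OF a] W_block(2)[OF b r] by blast
    then obtain r' where "r' \<in> \<beta>" "fst p \<subseteq> fst r'" using ab unfolding below_def by blast
    then have "fst p \<subseteq> fst r" using W_disjoint[OF b r, of r' x] x p by blast
    then show "x \<in> (\<Union>p\<in>?I. fst p)" using p by blast
  qed blast
  finally show ?thesis using W_block(5)[OF b r] by simp
qed

text \<open>By \<open>weight_count\<close> both sides say that \<open>r\<close> contains at least
  two blocks of \<alpha>. This lets colours and partners for a merge be chosen
  independently.\<close>

lemma weight_room:
  assumes a: "\<alpha> \<in> W" and b: "\<beta> \<in> W" and ab: "below \<alpha> \<beta>" and r: "r \<in> \<beta>"
  shows "(\<exists>u\<in>{1..k}. weight_sum \<alpha> (fst r) u < wt r u) \<longleftrightarrow> (\<exists>p\<in>\<alpha>. \<exists>q\<in>\<alpha>. p \<noteq> q \<and> fst p \<subseteq> fst r \<and> fst q \<subseteq> fst r)"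
proof -
  let ?I = "{p \<in> \<alpha>. fst p \<subseteq> fst r}"
  have f: "finite ?I" using W_finite[OF a] by simp
  have le: "weight_sum \<alpha> (fst r) u \<le> wt r u" for u using ab r unfolding below_def by blast
  have "(\<exists>u\<in>{1..k}. weight_sum \<alpha> (fst r) u < wt r u) \<longleftrightarrow>
      (\<Sum>u\<in>{1..k}. weight_sum \<alpha> (fst r) u) < (\<Sum>u\<in>{1..k}. wt r u)"
  proof
    assume "\<exists>u\<in>{1..k}. weight_sum \<alpha> (fst r) u < wt r u"
    then show "(\<Sum>u\<in>{1..k}. weight_sum \<alpha> (fst r) u) < (\<Sum>u\<in>{1..k}. wt r u)"
      using le by (intro sum_strict_mono_ex1) auto
  next
    assume lt: "(\<Sum>u\<in>{1..k}. weight_sum \<alpha> (fst r) u) < (\<Sum>u\<in>{1..k}. wt r u)"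
    show "\<exists>u\<in>{1..k}. weight_sum \<alpha> (fst r) u < wt r u"
    proof (rule ccontr)
      assume "\<not> ?thesis"
      then have "(\<Sum>u\<in>{1..k}. wt r u) \<le> (\<Sum>u\<in>{1..k}. weight_sum \<alpha> (fst r) u)"
        by (intro sum_mono) (simp add: not_less)
      then show False using lt by simp
    qed
  qed
  also have "\<dots> \<longleftrightarrow> 2 \<le> card ?I" using weight_count[OF assms] by linarith
  also have "\<dots> \<longleftrightarrow> (\<exists>p\<in>\<alpha>. \<exists>q\<in>\<alpha>. p \<noteq> q \<and> fst p \<subseteq> fst r \<and> fst q \<subseteq> fst r)"
  proof
    assume "2 \<le> card ?I"
    then have "\<not> card ?I \<le> Suc 0" by simp
    then show "\<exists>p\<in>\<alpha>. \<exists>q\<in>\<alpha>. p \<noteq> q \<and> fst p \<subseteq> fst r \<and> fst q \<subseteq> fst r"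
      using card_le_Suc0_iff_eq[OF f] by blast
  next
    assume "\<exists>p\<in>\<alpha>. \<exists>q\<in>\<alpha>. p \<noteq> q \<and> fst p \<subseteq> fst r \<and> fst q \<subseteq> fst r"
    then have "\<not> card ?I \<le> Suc 0" using card_le_Suc0_iff_eq[OF f] by blast
    then show "2 \<le> card ?I" by simp
  qed
  finally show ?thesis .
qed

lemma below_refl: assumes "\<alpha> \<in> W" shows "below \<alpha> \<alpha>"
  unfolding below_def
proof (intro conjI ballI allI)
  fix q u assume q: "q \<in> \<alpha>"
  have "p = q" if "p \<in> \<alpha>" "fst p \<subseteq> fst q" for p
    using W_disjoint[OF assms that(1) q] W_block(1)[OF assms that(1)] that(2) by blast
  then have "{p \<in> \<alpha>. fst p \<subseteq> fst q} = {q}" using q by blast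
  then show "weight_sum \<alpha> (fst q) u \<le> wt q u" by (simp add: weight_sum_def)
qed blast

text \<open>Without room each block of \<beta> contains, by \<open>weight_room\<close>, just one
  block of \<alpha>, and covering makes the two equal. Weights agree in colours up to k since there
  is no room, and both vanish in other colours.\<close>

lemma below_discrete:
  assumes a: "\<alpha> \<in> W" and b: "\<beta> \<in> W" and ab: "below \<alpha> \<beta>"
    and no: "\<not> (\<exists>r\<in>\<beta>. \<exists>u\<in>{1..k}. weight_sum \<alpha> (fst r) u < wt r u)"
  shows "\<alpha> = \<beta>"
proof -
  have key: "p = r" if p: "p \<in> \<alpha>" and r: "r \<in> \<beta>" and pr: "fst p \<subseteq> fst r" for p r
  proof -
    have I: "{q \<in> \<alpha>. fst q \<subseteq> fst r} = {p}"
    proof (intro equalityI subsetI)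
      fix q assume q: "q \<in> {q \<in> \<alpha>. fst q \<subseteq> fst r}"
      have "\<not> (\<exists>u\<in>{1..k}. weight_sum \<alpha> (fst r) u < wt r u)" using no r by blast
      then have "\<not> (\<exists>p\<in>\<alpha>. \<exists>q\<in>\<alpha>. p \<noteq> q \<and> fst p \<subseteq> fst r \<and> fst q \<subseteq> fst r)"
        unfolding weight_room[OF a b ab r] .
      then show "q \<in> {p}" using q p pr by auto
    qed (use p pr in simp)
    have "fst r \<subseteq> fst p"
    proof
      fix x assume x: "x \<in> fst r"
      then obtain q where q: "q \<in> \<alpha>" "x \<in> fst q" using W_cover[OF a] W_block(2)[OF b r] by blast
      then obtain r' where "r' \<in> \<beta>" "fst q \<subseteq> fst r'" using ab unfolding below_def by blast
      then have "fst q \<subseteq> fst r" using W_disjoint[OF b r, of r' x] x q by blast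
      then have "q = p" using I q by blast
      then show "x \<in> fst p" using q by simp
    qed
    moreover have "wt p u = wt r u" for u
    proof (cases "u \<in> {1..k}")
      case True
      have "weight_sum \<alpha> (fst r) u = wt p u" unfolding weight_sum_def I by simp
      moreover have "weight_sum \<alpha> (fst r) u \<le> wt r u" using ab r unfolding below_def by blast
      moreover have "\<not> weight_sum \<alpha> (fst r) u < wt r u" using no r True by blast
      ultimately show ?thesis by simp
    next
      case False
      then have "u \<notin> Poly_Mapping.keys (snd p)" "u \<notin> Poly_Mapping.keys (snd r)"
        using W_block(4)[OF a p] W_block(4)[OF b r] by blast+
      then show ?thesis by (simp add: in_keys_iff)
    qed
    ultimately show ?thesis using pr by (simp add: prod_eq_iff poly_mapping_eqI)
  qed
  show ?thesis
  proof (intro equalityI subsetI)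
    fix p assume p: "p \<in> \<alpha>"
    then obtain r where "r \<in> \<beta>" "fst p \<subseteq> fst r" using ab unfolding below_def by blast
    then show "p \<in> \<beta>" using key p by metis
  next
    fix r assume r: "r \<in> \<beta>"
    then obtain x where x: "x \<in> fst r" using W_block(1)[OF b] by blast
    then obtain p where p: "p \<in> \<alpha>" "x \<in> fst p" using W_cover[OF a] W_block(2)[OF b r] by blast
    then obtain r' where r': "r' \<in> \<beta>" "fst p \<subseteq> fst r'" using ab unfolding below_def by blast
    then have "r' = r" using W_disjoint[OF b r'(1) r, of x] x p by blast
    then show "r \<in> \<alpha>" using key[OF p(1) r] r' p by simp
  qed
qed

abbreviation (input) R where "R \<equiv> weighted_partition_poset n k"

text \<open>For the converse direction, \<alpha> different from \<beta> leaves room in some block;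
  two of its parts are merged in a colour with room, which stays below \<beta> and lowers the number
  of blocks.\<close>

lemma R_iff: "(\<alpha>, \<beta>) \<in> R \<longleftrightarrow> \<alpha> \<in> W \<and> \<beta> \<in> W \<and> below \<alpha> \<beta>"
proof
  assume "(\<alpha>, \<beta>) \<in> R"
  then have st: "(\<alpha>, \<beta>) \<in> (Restr (merge_step k) W)\<^sup>*" and W: "\<alpha> \<in> W" "\<beta> \<in> W"
    unfolding weighted_partition_poset_def by auto
  from st have "below \<alpha> \<beta>"
  proof (induction rule: converse_rtrancl_induct)
    case base
    show ?case by (rule below_refl[OF W(2)])
  next
    case (step \<gamma> \<delta>)
    then have g: "\<gamma> \<in> W" and st: "(\<gamma>, \<delta>) \<in> merge_step k" by auto
    obtain p q u where p: "p \<in> \<gamma>" "q \<in> \<gamma>" "fst p \<noteq> fst q" "\<delta> = merge \<gamma> p q u"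
      using st unfolding merge_step_iff by blast
    then have "p \<noteq> q" by auto
    then show ?case using below_merge[OF g W(2) p(1,2)] step.IH p(4) by blast
  qed
  then show "\<alpha> \<in> W \<and> \<beta> \<in> W \<and> below \<alpha> \<beta>" using W by blast
next
  assume "\<alpha> \<in> W \<and> \<beta> \<in> W \<and> below \<alpha> \<beta>"
  then have W: "\<alpha> \<in> W" "\<beta> \<in> W" and ab: "below \<alpha> \<beta>" by auto
  have "(\<alpha>, \<beta>) \<in> (Restr (merge_step k) W)\<^sup>*"
    using W(1) ab
  proof (induction "card \<alpha>" arbitrary: \<alpha> rule: less_induct)
    case less
    show ?case
    proof (cases "\<alpha> = \<beta>")
      case False
      then obtain r u where r: "r \<in> \<beta>" "u \<in> {1..k}" "weight_sum \<alpha> (fst r) u < wt r u"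
        using below_discrete[OF less.prems(1) W(2) less.prems(2)] by blast
      then obtain p q where pq: "p \<in> \<alpha>" "q \<in> \<alpha>" "p \<noteq> q" "fst p \<subseteq> fst r" "fst q \<subseteq> fst r"
        using weight_room[OF less.prems(1) W(2) less.prems(2) r(1)] by blast
      let ?\<gamma> = "merge \<alpha> p q u"
      note g = merge_W[OF less.prems(1) pq(1-3) r(2)]
      have "below ?\<gamma> \<beta>" using below_merge[OF less.prems(1) W(2) pq(1-3)] less.prems(2) r pq by blast
      then have "(?\<gamma>, \<beta>) \<in> (Restr (merge_step k) W)\<^sup>*" using less.hyps[OF _ g(1)] g(2) by simp
      moreover have "fst p \<noteq> fst q" using fst_ne[OF less.prems(1) pq(1,2)] pq(3) by blast
      then have "(\<alpha>, ?\<gamma>) \<in> Restr (merge_step k) W" using less.prems(1) g(1) pq r(2) unfolding Int_iff merge_step_iff by blast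
      ultimately show ?thesis by (rule converse_rtrancl_into_rtrancl[rotated])
    qed simp
  qed
  then show "(\<alpha>, \<beta>) \<in> R" using W unfolding weighted_partition_poset_def by blast
qed

end

section \<open>The EL-labeling\<close>

text \<open>
  Merging blocks with minima \<open>a < b\<close> in colour \<open>u\<close> gets the label \<open>(a, b, u)\<close>. Labels are
  ordered first by \<open>a\<close>, and for equal \<open>a\<close> componentwise.
\<close>

definition label_code :: "nat \<times> nat \<times> nat \<Rightarrow> nat" where
  "label_code x = prod_encode (fst x, prod_encode (snd x))"

definition label_le :: "nat \<times> nat \<times> nat \<Rightarrow> nat \<times> nat \<times> nat \<Rightarrow> bool" where
  "label_le x y \<longleftrightarrow> fst x < fst y \<or> fst x = fst y \<and> fst (snd x) \<le> fst (snd y) \<and> snd (snd x) \<le> snd (snd y)"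

text \<open>The label order is transported to natural numbers because \<open>EL_shellable\<close>
  asks for labels in a \<open>nat rel\<close>.\<close>

definition label_rel :: "nat rel" where
  "label_rel = {(label_code x, label_code y) | x y. label_le x y}"

lemma label_code_inj [simp]: "label_code x = label_code y \<longleftrightarrow> x = y"
  by (auto simp: label_code_def prod_eq_iff)

lemma label_rel_iff: "(label_code x, label_code y) \<in> label_rel - Id \<longleftrightarrow> label_le x y \<and> x \<noteq> y"
  by (simp add: label_rel_def del: split_paired_Ex)

lemma label_le_simp: "label_le (a, b, u) (a', b', u') \<longleftrightarrow> a < a' \<or> a = a' \<and> b \<le> b' \<and> u \<le> u'"
  by (simp add: label_le_def)

lemma label_le_refl: "label_le x x"
  by (simp add: label_le_def)

lemma label_le_trans: "label_le x y \<Longrightarrow> label_le y z \<Longrightarrow> label_le x z"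
  by (auto simp: label_le_def)

lemma label_code_Field: "label_code x \<in> Field label_rel"
  unfolding Field_def label_rel_def using label_le_refl by blast

lemma rel_subset_Field: "r \<subseteq> Field r \<times> Field r"
  by (auto simp: Field_def)

lemma Partial_order_label_rel: "Partial_order label_rel"
  unfolding partial_order_on_def preorder_on_def
proof (intro conjI)
  show "refl_on (Field label_rel) label_rel"
  proof (rule refl_onI)
    fix i assume "i \<in> Field label_rel"
    then obtain x where "i = label_code x" unfolding Field_def label_rel_def by auto
    then show "(i, i) \<in> label_rel" unfolding label_rel_def using label_le_refl by blast
  qed
  show "trans label_rel"
    unfolding label_rel_def by (intro transI) (auto, metis label_le_trans surj_pair)
  show "antisym label_rel"
    unfolding label_rel_def label_le_def by (intro antisymI) auto
qed (rule rel_subset_Field)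

locale weighted_poset =
  fixes n k :: nat
  assumes n: "1 \<le> n" and k: "1 \<le> k"
begin

abbreviation WP where "WP \<equiv> weighted_partitions n k"
abbreviation Q where "Q \<equiv> weighted_partition_poset n k"
abbreviation Ph where "Ph \<equiv> adjoin_top Q"

section \<open>The graded order with the adjoined top\<close>

lemma Q_refl: "\<alpha> \<in> WP \<Longrightarrow> (\<alpha>, \<alpha>) \<in> Q"
  by (simp add: R_iff below_refl)

lemma Q_W: "(\<alpha>, \<beta>) \<in> Q \<Longrightarrow> \<alpha> \<in> WP" "(\<alpha>, \<beta>) \<in> Q \<Longrightarrow> \<beta> \<in> WP"
  by (simp_all add: R_iff)

lemma Q_trans: "(\<alpha>, \<beta>) \<in> Q \<Longrightarrow> (\<beta>, \<gamma>) \<in> Q \<Longrightarrow> (\<alpha>, \<gamma>) \<in> Q"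
  unfolding weighted_partition_poset_def by (auto intro: rtrancl_trans)

lemma Q_merge:
  assumes "\<alpha> \<in> WP" "p \<in> \<alpha>" "q \<in> \<alpha>" "p \<noteq> q" "u \<in> {1..k}"
  shows "(\<alpha>, merge \<alpha> p q u) \<in> Q"
  using merge_W(1)[OF assms] below_merge[OF assms(1) merge_W(1)[OF assms] assms(2-4)]
    below_refl[OF merge_W(1)[OF assms]] assms(1) by (simp add: R_iff)

lemma Q_step:
  assumes "(\<alpha>, \<beta>) \<in> Q" "\<alpha> \<noteq> \<beta>"
  shows "\<exists>p\<in>\<alpha>. \<exists>q\<in>\<alpha>. \<exists>u\<in>{1..k}. p \<noteq> q \<and> (merge \<alpha> p q u, \<beta>) \<in> Q"
proof -
  have W: "\<alpha> \<in> WP" "\<beta> \<in> WP" and ab: "below \<alpha> \<beta>" using assms(1) by (simp_all add: R_iff)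
  obtain r u where r: "r \<in> \<beta>" "u \<in> {1..k}" "weight_sum \<alpha> (fst r) u < wt r u"
    using below_discrete[OF W ab] assms(2) by blast
  then have "\<exists>p\<in>\<alpha>. \<exists>q\<in>\<alpha>. p \<noteq> q \<and> fst p \<subseteq> fst r \<and> fst q \<subseteq> fst r"
    using weight_room[OF W ab r(1)] by blast
  then obtain p q where pq: "p \<in> \<alpha>" "q \<in> \<alpha>" "p \<noteq> q" "fst p \<subseteq> fst r" "fst q \<subseteq> fst r" by blast
  have "below (merge \<alpha> p q u) \<beta>" unfolding below_merge[OF W pq(1-3)] using ab r pq by blast
  then have "(merge \<alpha> p q u, \<beta>) \<in> Q" using merge_W(1)[OF W(1) pq(1-3) r(2)] W by (simp add: R_iff)
  then show ?thesis using pq r by blast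
qed

lemma Q_card: "(\<alpha>, \<beta>) \<in> Q \<Longrightarrow> \<alpha> \<noteq> \<beta> \<Longrightarrow> card \<beta> < card \<alpha>"
proof (induction "card \<alpha>" arbitrary: \<alpha> rule: less_induct)
  case less
  obtain p q u where pq: "p \<in> \<alpha>" "q \<in> \<alpha>" "u \<in> {1..k}" "p \<noteq> q" "(merge \<alpha> p q u, \<beta>) \<in> Q"
    using Q_step[OF less.prems] by blast
  have c: "card (merge \<alpha> p q u) + 1 = card \<alpha>" by (rule merge_W(2)[OF Q_W(1)[OF less.prems(1)] pq(1,2,4,3)])
  show ?case
  proof (cases "merge \<alpha> p q u = \<beta>")
    case True
    then show ?thesis using c by simp
  next
    case False
    then have "card \<beta> < card (merge \<alpha> p q u)" using less.hyps pq(5) c by simp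
    then show ?thesis using c by simp
  qed
qed

lemma Q_antisym: "(\<alpha>, \<beta>) \<in> Q \<Longrightarrow> (\<beta>, \<alpha>) \<in> Q \<Longrightarrow> \<alpha> = \<beta>"
  using Q_card[of \<alpha> \<beta>] Q_card[of \<beta> \<alpha>] by fastforce

lemma W_card_pos: "\<alpha> \<in> WP \<Longrightarrow> 0 < card \<alpha>"
proof -
  assume a: "\<alpha> \<in> WP"
  obtain p where "p \<in> \<alpha>" using W_cover[OF a, of 1] n by auto
  then show ?thesis using W_finite[OF a] by (auto simp: card_gt_0_iff)
qed

lemma Field_Q: "Field Q = WP"
  using Q_refl Q_W unfolding Field_def by blast

lemma Ph_simps [simp]:
  "(Some \<alpha>, Some \<beta>) \<in> Ph \<longleftrightarrow> (\<alpha>, \<beta>) \<in> Q" "(Some \<alpha>, None) \<in> Ph \<longleftrightarrow> \<alpha> \<in> WP"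
  "(None, None) \<in> Ph" "(None, Some \<beta>) \<notin> Ph"
  by (auto simp: adjoin_top_def Field_Q)

lemma Field_Ph: "Field Ph = insert None (Some ` WP)"
proof (intro equalityI subsetI)
  fix x assume "x \<in> Field Ph"
  then obtain y where "(x, y) \<in> Ph \<or> (y, x) \<in> Ph" unfolding Field_def by auto
  then show "x \<in> insert None (Some ` WP)"
    by (cases x; cases y) (auto dest: Q_W)
next
  fix x assume "x \<in> insert None (Some ` WP)"
  then have "(x, None) \<in> Ph" by auto
  then show "x \<in> Field Ph" unfolding Field_def by blast
qed

lemma Ph_trans: "(x, y) \<in> Ph \<Longrightarrow> (y, z) \<in> Ph \<Longrightarrow> (x, z) \<in> Ph"
  by (cases x; cases y; cases z) (auto dest: Q_W intro: Q_trans)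

lemma Ph_antisym: "(x, y) \<in> Ph \<Longrightarrow> (y, x) \<in> Ph \<Longrightarrow> x = y"
  by (cases x; cases y) (auto dest: Q_antisym)

lemma Partial_order_Ph: "Partial_order Ph"
  unfolding partial_order_on_def preorder_on_def
proof (intro conjI)
  show "refl_on (Field Ph) Ph"
  proof (rule refl_onI)
    fix x assume "x \<in> Field Ph"
    then show "(x, x) \<in> Ph" using Q_refl by (auto simp: Field_Ph)
  qed
  show "trans Ph" using Ph_trans by (intro transI)
  show "antisym Ph" using Ph_antisym by (intro antisymI)
qed (rule rel_subset_Field)

text \<open>The number of merges made: 0 at the bottom and n - 1 at a single block; the adjoined top
  counts one more.\<close>

definition rk :: "weighted_partition option \<Rightarrow> nat" where
  "rk x = (case x of None \<Rightarrow> n | Some \<alpha> \<Rightarrow> n - card \<alpha>)"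

definition is_merge :: "weighted_partition \<Rightarrow> weighted_partition \<Rightarrow> nat \<times> nat \<times> nat \<Rightarrow> bool" where
  "is_merge \<alpha> \<gamma> l \<longleftrightarrow> (\<exists>p\<in>\<alpha>. \<exists>q\<in>\<alpha>. \<exists>u\<in>{1..k}. Min (fst p) < Min (fst q) \<and>
     l = (Min (fst p), Min (fst q), u) \<and> \<gamma> = merge \<alpha> p q u)"

lemma is_mergeE:
  assumes "is_merge \<alpha> \<gamma> (a, b, u)"
  obtains p q where "p \<in> \<alpha>" "q \<in> \<alpha>" "p \<noteq> q" "u \<in> {1..k}" "a = Min (fst p)" "b = Min (fst q)" "a < b" "\<gamma> = merge \<alpha> p q u"
  using assms unfolding is_merge_def by blast

lemma Min_mem: "\<alpha> \<in> WP \<Longrightarrow> p \<in> \<alpha> \<Longrightarrow> Min (fst p) \<in> fst p"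
  using W_block[of \<alpha> n k p] by simp

lemma Min_inj: "\<alpha> \<in> WP \<Longrightarrow> p \<in> \<alpha> \<Longrightarrow> q \<in> \<alpha> \<Longrightarrow> Min (fst p) = Min (fst q) \<Longrightarrow> p = q"
  using W_disjoint[of \<alpha> n k p q "Min (fst p)"] Min_mem[of \<alpha> p] Min_mem[of \<alpha> q] by simp

lemma merge_is_merge:
  assumes "\<alpha> \<in> WP" "p \<in> \<alpha>" "q \<in> \<alpha>" "p \<noteq> q" "u \<in> {1..k}"
  shows "\<exists>l. is_merge \<alpha> (merge \<alpha> p q u) l"
proof (cases "Min (fst p) < Min (fst q)")
  case True
  then show ?thesis using assms unfolding is_merge_def by blast
next
  case False
  then have "Min (fst q) < Min (fst p)" using Min_inj[OF assms(1-3)] assms(4) by fastforce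
  moreover have "merge \<alpha> p q u = merge \<alpha> q p u" by (rule merge_commute)
  ultimately show ?thesis using assms unfolding is_merge_def by blast
qed

lemma is_merge_facts:
  assumes "\<alpha> \<in> WP" "is_merge \<alpha> \<gamma> l"
  shows "\<gamma> \<in> WP" "card \<gamma> + 1 = card \<alpha>" "(\<alpha>, \<gamma>) \<in> Q" "\<alpha> \<noteq> \<gamma>"
proof -
  obtain a b u where l: "l = (a, b, u)" by (cases l) auto
  obtain p q where pq: "p \<in> \<alpha>" "q \<in> \<alpha>" "p \<noteq> q" "u \<in> {1..k}" "\<gamma> = merge \<alpha> p q u"
    using is_mergeE assms(2) unfolding l by metis
  show "\<gamma> \<in> WP" "card \<gamma> + 1 = card \<alpha>" "(\<alpha>, \<gamma>) \<in> Q"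
    unfolding pq(5) using merge_W[OF assms(1) pq(1-4)] Q_merge[OF assms(1) pq(1-4)] by auto
  then show "\<alpha> \<noteq> \<gamma>" by auto
qed

text \<open>The two merged blocks are recovered as the difference of the two partitions, and the
  colour from the weight of the new block.\<close>

lemma label_unique:
  assumes a: "\<alpha> \<in> WP" and l: "is_merge \<alpha> \<gamma> l" and l': "is_merge \<alpha> \<gamma> l'"
  shows "l = l'"
proof -
  obtain p q u where p: "p \<in> \<alpha>" "q \<in> \<alpha>" "Min (fst p) < Min (fst q)" "l = (Min (fst p), Min (fst q), u)" "\<gamma> = merge \<alpha> p q u"
    using l unfolding is_merge_def by blast
  obtain p' q' u' where p': "p' \<in> \<alpha>" "q' \<in> \<alpha>" "Min (fst p') < Min (fst q')" "l' = (Min (fst p'), Min (fst q'), u')" "\<gamma> = merge \<alpha> p' q' u'"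
    using l' unfolding is_merge_def by blast
  have ne: "p \<noteq> q" "p' \<noteq> q'" using p p' by auto
  have "\<alpha> - merge \<alpha> p q u = {p, q}" "\<alpha> - merge \<alpha> p' q' u' = {p', q'}"
    unfolding merge_def using merge_new[OF a p(1,2) ne(1)] merge_new[OF a p'(1,2) ne(2)] p p' by auto
  then have "{p, q} = {p', q'}" using p(5) p'(5) by simp
  then have eq: "p' = p" "q' = q" using p(3) p'(3) by (auto simp: doubleton_eq_iff)
  let ?N = "\<lambda>u. (fst p \<union> fst q, snd p + snd q + Poly_Mapping.single u (1::nat))"
  have "?N u \<in> merge \<alpha> p q u'" using p(5) p'(5) eq by (metis insertI1 merge_def)
  then have "?N u = ?N u'" unfolding merge_def using merge_new[OF a p(1,2) ne(1)] by blast
  then have "Poly_Mapping.single u (1::nat) = Poly_Mapping.single u' 1" by simp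
  then have "Poly_Mapping.lookup (Poly_Mapping.single u (1::nat)) u = Poly_Mapping.lookup (Poly_Mapping.single u' 1) u" by simp
  then have "u = u'" by (simp add: lookup_single when_def split: if_splits)
  then show ?thesis using p p' eq by simp
qed

lemma merge_unique:
  assumes "\<alpha> \<in> WP" "is_merge \<alpha> \<gamma> l" "is_merge \<alpha> \<gamma>' l"
  shows "\<gamma> = \<gamma>'"
proof -
  obtain a b u where l: "l = (a, b, u)" by (cases l) auto
  obtain p q where p: "p \<in> \<alpha>" "q \<in> \<alpha>" "a = Min (fst p)" "b = Min (fst q)" "\<gamma> = merge \<alpha> p q u"
    using is_mergeE assms(2) unfolding l by metis
  obtain p' q' where p': "p' \<in> \<alpha>" "q' \<in> \<alpha>" "a = Min (fst p')" "b = Min (fst q')" "\<gamma>' = merge \<alpha> p' q' u"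
    using is_mergeE assms(3) unfolding l by metis
  have "p = p'" "q = q'" using Min_inj[OF assms(1)] p p' by auto
  then show ?thesis using p p' by simp
qed

lemma covers_Some: "covers Ph (Some \<alpha>) (Some \<gamma>) \<longleftrightarrow> \<alpha> \<in> WP \<and> (\<exists>l. is_merge \<alpha> \<gamma> l)"
proof
  assume c: "covers Ph (Some \<alpha>) (Some \<gamma>)"
  then have ag: "(\<alpha>, \<gamma>) \<in> Q" "\<alpha> \<noteq> \<gamma>" by (auto simp: covers_def)
  note a = Q_W(1)[OF ag(1)]
  obtain p q u where pq: "p \<in> \<alpha>" "q \<in> \<alpha>" "u \<in> {1..k}" "p \<noteq> q" "(merge \<alpha> p q u, \<gamma>) \<in> Q"
    using Q_step[OF ag] by blast
  obtain l where l: "is_merge \<alpha> (merge \<alpha> p q u) l" using merge_is_merge[OF a pq(1,2,4,3)] by blast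
  note f = is_merge_facts[OF a l]
  have "\<not> (\<exists>z. (Some \<alpha>, z) \<in> Ph \<and> (z, Some \<gamma>) \<in> Ph \<and> z \<noteq> Some \<alpha> \<and> z \<noteq> Some \<gamma>)"
    using c by (simp add: covers_def)
  then have "merge \<alpha> p q u = \<gamma>" using f pq(5) by (metis Ph_simps(1) option.inject)
  then show "\<alpha> \<in> WP \<and> (\<exists>l. is_merge \<alpha> \<gamma> l)" using a l by blast
next
  assume "\<alpha> \<in> WP \<and> (\<exists>l. is_merge \<alpha> \<gamma> l)"
  then obtain l where a: "\<alpha> \<in> WP" and l: "is_merge \<alpha> \<gamma> l" by blast
  note f = is_merge_facts[OF a l]
  have "\<not> ((Some \<alpha>, z) \<in> Ph \<and> (z, Some \<gamma>) \<in> Ph \<and> z \<noteq> Some \<alpha> \<and> z \<noteq> Some \<gamma>)" for z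
  proof
    assume z: "(Some \<alpha>, z) \<in> Ph \<and> (z, Some \<gamma>) \<in> Ph \<and> z \<noteq> Some \<alpha> \<and> z \<noteq> Some \<gamma>"
    then obtain \<delta> where d: "z = Some \<delta>" by (cases z) auto
    then have "card \<delta> < card \<alpha>" "card \<gamma> < card \<delta>" using z Q_card[of \<alpha> \<delta>] Q_card[of \<delta> \<gamma>] by auto
    then show False using f(2) by linarith
  qed
  then show "covers Ph (Some \<alpha>) (Some \<gamma>)" using f unfolding covers_def by simp
qed

lemma covers_None: "covers Ph (Some \<alpha>) None \<longleftrightarrow> \<alpha> \<in> WP \<and> card \<alpha> = 1"
proof
  assume c: "covers Ph (Some \<alpha>) None"
  then have a: "\<alpha> \<in> WP" by (simp add: covers_def)
  have "card \<alpha> = 1"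
  proof (rule ccontr)
    assume "card \<alpha> \<noteq> 1"
    then have "\<not> card \<alpha> \<le> Suc 0" using W_card_pos[OF a] by simp
    then obtain p q where pq: "p \<in> \<alpha>" "q \<in> \<alpha>" "p \<noteq> q"
      using card_le_Suc0_iff_eq[OF W_finite(1)[OF a]] by blast
    obtain l where l: "is_merge \<alpha> (merge \<alpha> p q 1) l" using merge_is_merge[OF a pq, of 1] k by auto
    note f = is_merge_facts[OF a l]
    have "\<not> (\<exists>z. (Some \<alpha>, z) \<in> Ph \<and> (z, None) \<in> Ph \<and> z \<noteq> Some \<alpha> \<and> z \<noteq> None)"
      using c by (simp add: covers_def)
    then show False using f by (metis Ph_simps(1,2) option.distinct(1) option.inject)
  qed
  then show "\<alpha> \<in> WP \<and> card \<alpha> = 1" using a by simp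
next
  assume a: "\<alpha> \<in> WP \<and> card \<alpha> = 1"
  have "\<not> ((Some \<alpha>, z) \<in> Ph \<and> (z, None) \<in> Ph \<and> z \<noteq> Some \<alpha> \<and> z \<noteq> None)" for z
  proof
    assume z: "(Some \<alpha>, z) \<in> Ph \<and> (z, None) \<in> Ph \<and> z \<noteq> Some \<alpha> \<and> z \<noteq> None"
    then obtain \<delta> where d: "z = Some \<delta>" by (cases z) auto
    then have "card \<delta> < card \<alpha>" using z Q_card[of \<alpha> \<delta>] by auto
    moreover have "0 < card \<delta>" using z d by (intro W_card_pos) simp
    ultimately show False using a by simp
  qed
  then show "covers Ph (Some \<alpha>) None" using a unfolding covers_def by simp
qed

lemma covers_cases:
  assumes "covers Ph x z"
  obtains (merge) \<alpha> \<gamma> l where "\<alpha> \<in> WP" "x = Some \<alpha>" "z = Some \<gamma>" "is_merge \<alpha> \<gamma> l"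
  | (top) \<alpha> where "\<alpha> \<in> WP" "x = Some \<alpha>" "z = None" "card \<alpha> = 1"
proof (cases x)
  case None
  then show thesis using assms unfolding covers_def by (cases z) auto
next
  case (Some \<alpha>)
  show thesis
  proof (cases z)
    case None
    then show thesis using assms Some top covers_None by blast
  next
    case (Some \<gamma>)
    then show thesis using assms \<open>x = Some \<alpha>\<close> merge covers_Some by blast
  qed
qed

lemma rk_covers: assumes "covers Ph x z" shows "rk z = Suc (rk x)"
  using assms
proof (cases rule: covers_cases)
  case (merge \<alpha> \<gamma> l)
  then show ?thesis using is_merge_facts(2)[OF merge(1,4)] W_finite(2)[OF merge(1)] by (simp add: rk_def)
next
  case (top \<alpha>)
  then show ?thesis using n by (simp add: rk_def)
qed

lemma rk_mono: "(x, y) \<in> Ph \<Longrightarrow> rk x \<le> rk y"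
proof (cases x)
  case (Some \<alpha>)
  assume xy: "(x, y) \<in> Ph"
  show ?thesis
  proof (cases y)
    case (Some \<beta>)
    then have "card \<beta> \<le> card \<alpha>" using Q_card[of \<alpha> \<beta>] xy \<open>x = Some \<alpha>\<close> by (cases "\<alpha> = \<beta>") auto
    then show ?thesis using Some \<open>x = Some \<alpha>\<close> by (simp add: rk_def)
  qed (simp add: rk_def Some)
qed (cases y; simp add: rk_def)

section \<open>Labels available in an interval\<close>

definition mns :: "weighted_partition \<Rightarrow> nat set" where
  "mns \<alpha> = (\<lambda>p. Min (fst p)) ` \<alpha>"

definition Lab :: "weighted_partition \<Rightarrow> weighted_partition option \<Rightarrow> (nat \<times> nat \<times> nat) set" where
  "Lab \<alpha> y = {l. \<exists>\<gamma>. is_merge \<alpha> \<gamma> l \<and> (Some \<gamma>, y) \<in> Ph}"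

definition joined :: "weighted_partition option \<Rightarrow> nat \<Rightarrow> nat \<Rightarrow> bool" where
  "joined y a b \<longleftrightarrow> (case y of None \<Rightarrow> True | Some \<beta> \<Rightarrow> \<exists>r\<in>\<beta>. a \<in> fst r \<and> b \<in> fst r)"

text \<open>The colour still has room in the block of the upper element around \<open>a\<close>;
  below the adjoined top every colour up to k has.\<close>

definition free :: "weighted_partition \<Rightarrow> weighted_partition option \<Rightarrow> nat \<Rightarrow> nat \<Rightarrow> bool" where
  "free \<alpha> y a u \<longleftrightarrow> u \<in> {1..k} \<and>
     (case y of None \<Rightarrow> True | Some \<beta> \<Rightarrow> \<exists>r\<in>\<beta>. a \<in> fst r \<and> weight_sum \<alpha> (fst r) u < wt r u)"

lemma below_subset:
  assumes b: "\<beta> \<in> WP" and ab: "below \<alpha> \<beta>" and p: "p \<in> \<alpha>" and r: "r \<in> \<beta>" and x: "x \<in> fst p" "x \<in> fst r"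
  shows "fst p \<subseteq> fst r"
proof -
  obtain r' where r': "r' \<in> \<beta>" "fst p \<subseteq> fst r'" using ab p unfolding below_def by blast
  then have "r' = r" using W_disjoint[OF b r'(1) r, of x] x by blast
  then show ?thesis using r' by simp
qed

text \<open>The conditions decouple: the partner is governed by \<open>joined\<close> and the colour
  by \<open>free\<close>, which does not mention \<open>b\<close>. Hence for fixed \<open>a\<close>
  the available pairs form a product of a set of partners and a set of colours.\<close>

lemma Lab_iff:
  assumes y: "(Some \<alpha>, y) \<in> Ph"
  shows "(a, b, u) \<in> Lab \<alpha> y \<longleftrightarrow> a \<in> mns \<alpha> \<and> b \<in> mns \<alpha> \<and> a < b \<and> joined y a b \<and> free \<alpha> y a u"
proof -
  have a: "\<alpha> \<in> WP" using y by (cases y) (auto dest: Q_W)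
  show ?thesis
  proof
    assume "(a, b, u) \<in> Lab \<alpha> y"
    then obtain \<gamma> where g: "is_merge \<alpha> \<gamma> (a, b, u)" "(Some \<gamma>, y) \<in> Ph" unfolding Lab_def by blast
    obtain p q where pq: "p \<in> \<alpha>" "q \<in> \<alpha>" "p \<noteq> q" "u \<in> {1..k}" "a = Min (fst p)" "b = Min (fst q)" "a < b" "\<gamma> = merge \<alpha> p q u"
      using is_mergeE[OF g(1)] .
    have m: "a \<in> mns \<alpha>" "b \<in> mns \<alpha>" using pq unfolding mns_def by blast+
    show "a \<in> mns \<alpha> \<and> b \<in> mns \<alpha> \<and> a < b \<and> joined y a b \<and> free \<alpha> y a u"
    proof (cases y)
      case None
      then show ?thesis using m pq by (simp add: joined_def free_def)
    next
      case (Some \<beta>)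
      then have b: "\<beta> \<in> WP" and "below (merge \<alpha> p q u) \<beta>" using g(2) pq(8) by (auto simp: R_iff)
      then obtain r where r: "r \<in> \<beta>" "fst p \<subseteq> fst r" "fst q \<subseteq> fst r" "weight_sum \<alpha> (fst r) u < wt r u"
        using below_merge[OF a b pq(1-3)] by blast
      moreover have "a \<in> fst p" "b \<in> fst q" using Min_mem[OF a] pq by simp_all
      ultimately have "joined y a b" "free \<alpha> y a u" using Some pq(4) by (auto simp: joined_def free_def)
      then show ?thesis using m pq(7) by blast
    qed
  next
    assume R: "a \<in> mns \<alpha> \<and> b \<in> mns \<alpha> \<and> a < b \<and> joined y a b \<and> free \<alpha> y a u"
    then obtain p q where pq: "p \<in> \<alpha>" "q \<in> \<alpha>" "a = Min (fst p)" "b = Min (fst q)" "a < b" unfolding mns_def by blast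
    then have ne: "p \<noteq> q" by auto
    have u: "u \<in> {1..k}" using R by (simp add: free_def)
    have im: "is_merge \<alpha> (merge \<alpha> p q u) (a, b, u)" using pq u unfolding is_merge_def by blast
    have "(Some (merge \<alpha> p q u), y) \<in> Ph"
    proof (cases y)
      case None
      then show ?thesis using is_merge_facts(1)[OF a im] by simp
    next
      case (Some \<beta>)
      then have b: "\<beta> \<in> WP" and ab: "below \<alpha> \<beta>" using y by (auto simp: R_iff)
      obtain r r' where r: "r \<in> \<beta>" "a \<in> fst r" "b \<in> fst r" "r' \<in> \<beta>" "a \<in> fst r'" "weight_sum \<alpha> (fst r') u < wt r' u"
        using R Some unfolding joined_def free_def by auto
      have "r' = r" using W_disjoint[OF b r(4,1), of a] r by blast
      moreover have "a \<in> fst p" "b \<in> fst q" using Min_mem[OF a] pq by simp_all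
      then have "fst p \<subseteq> fst r" "fst q \<subseteq> fst r" using below_subset[OF b ab _ r(1)] pq r by blast+
      ultimately have "below (merge \<alpha> p q u) \<beta>" using below_merge[OF a b pq(1,2) ne] ab r by blast
      then show ?thesis using Some b is_merge_facts(1)[OF a im] by (simp add: R_iff)
    qed
    then show "(a, b, u) \<in> Lab \<alpha> y" using im unfolding Lab_def by blast
  qed
qed

lemma joined_sym: "joined y a b \<Longrightarrow> joined y b a"
  by (auto simp: joined_def split: option.splits)

lemma joined_trans:
  assumes "(x, y) \<in> Ph" "joined y a b" "joined y b c"
  shows "joined y a c"
proof (cases y)
  case (Some \<beta>)
  then have b: "\<beta> \<in> WP" using assms(1) by (cases x) (auto dest: Q_W)
  obtain r r' where r: "r \<in> \<beta>" "a \<in> fst r" "b \<in> fst r" "r' \<in> \<beta>" "b \<in> fst r'" "c \<in> fst r'"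
    using assms Some unfolding joined_def by auto
  then have "r = r'" using W_disjoint[OF b r(1,4), of b] by blast
  then show ?thesis using r Some unfolding joined_def by auto
qed (simp add: joined_def)

lemma free_joined:
  assumes "(x, y) \<in> Ph" "joined y a b" "free \<alpha> y a u"
  shows "free \<alpha> y b u"
proof (cases y)
  case (Some \<beta>)
  then have b: "\<beta> \<in> WP" using assms(1) by (cases x) (auto dest: Q_W)
  obtain r r' where r: "r \<in> \<beta>" "a \<in> fst r" "b \<in> fst r" "r' \<in> \<beta>" "a \<in> fst r'" "weight_sum \<alpha> (fst r') u < wt r' u"
    using assms Some unfolding joined_def free_def by auto
  then have "r = r'" using W_disjoint[OF b r(1,4), of a] by blast
  then show ?thesis using r Some assms(3) unfolding free_def by auto
qed (use assms(3) in \<open>simp add: free_def\<close>)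

lemma free_exists:
  assumes y: "(Some \<alpha>, y) \<in> Ph" and ab: "a \<in> mns \<alpha>" "b \<in> mns \<alpha>" "a \<noteq> b" "joined y a b"
  shows "\<exists>u. free \<alpha> y a u"
proof (cases y)
  case None
  then show ?thesis using k by (intro exI[of _ 1]) (simp add: free_def)
next
  case (Some \<beta>)
  then have W: "\<alpha> \<in> WP" "\<beta> \<in> WP" and bel: "below \<alpha> \<beta>" using y by (auto simp: R_iff)
  obtain p q where pq: "p \<in> \<alpha>" "q \<in> \<alpha>" "a = Min (fst p)" "b = Min (fst q)" using ab unfolding mns_def by blast
  obtain r where r: "r \<in> \<beta>" "a \<in> fst r" "b \<in> fst r" using ab(4) Some unfolding joined_def by auto
  have "a \<in> fst p" "b \<in> fst q" using Min_mem[OF W(1)] pq by simp_all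
  then have "fst p \<subseteq> fst r" "fst q \<subseteq> fst r" using below_subset[OF W(2) bel _ r(1)] pq r by blast+
  moreover have "p \<noteq> q" using pq ab(3) by auto
  ultimately obtain u where "u \<in> {1..k}" "weight_sum \<alpha> (fst r) u < wt r u"
    using weight_room[OF W bel r(1)] pq by blast
  then show ?thesis using r Some unfolding free_def by auto
qed

text \<open>The counterpart of \<open>free_exists\<close>, for genuine partitions only: below the
  adjoined top colours are free even when a single block is left. The top edge therefore needs its
  own argument later.\<close>

lemma partner_exists:
  assumes y: "(Some \<alpha>, Some \<beta>) \<in> Ph" and a: "a \<in> mns \<alpha>" and u: "free \<alpha> (Some \<beta>) a u"
  shows "\<exists>b\<in>mns \<alpha>. b \<noteq> a \<and> joined (Some \<beta>) a b"
proof -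
  have W: "\<alpha> \<in> WP" "\<beta> \<in> WP" and bel: "below \<alpha> \<beta>" using y by (auto simp: R_iff)
  obtain r where r: "r \<in> \<beta>" "a \<in> fst r" "u \<in> {1..k}" "weight_sum \<alpha> (fst r) u < wt r u"
    using u unfolding free_def by auto
  then obtain p q where pq: "p \<in> \<alpha>" "q \<in> \<alpha>" "p \<noteq> q" "fst p \<subseteq> fst r" "fst q \<subseteq> fst r"
    using weight_room[OF W bel r(1)] by blast
  then have "Min (fst p) \<noteq> Min (fst q)" using Min_inj[OF W(1)] by blast
  then obtain s where s: "s \<in> \<alpha>" "Min (fst s) \<noteq> a" "fst s \<subseteq> fst r" using pq by metis
  then have "Min (fst s) \<in> fst r" using Min_mem[OF W(1)] by blast
  then show ?thesis using s r unfolding mns_def joined_def by auto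
qed

lemma mns_merge:
  assumes a: "\<alpha> \<in> WP" and g: "is_merge \<alpha> \<gamma> (a, b, u)"
  shows "mns \<gamma> = mns \<alpha> - {b}"
proof -
  obtain p q where pq: "p \<in> \<alpha>" "q \<in> \<alpha>" "p \<noteq> q" "u \<in> {1..k}" "a = Min (fst p)" "b = Min (fst q)" "a < b" "\<gamma> = merge \<alpha> p q u"
    using is_mergeE[OF g] .
  have "Min (fst p \<union> fst q) = a"
    using W_block[OF a pq(1)] W_block[OF a pq(2)] pq(5-7) by (subst Min_Un) auto
  then have 1: "mns \<gamma> = insert a ((\<lambda>p. Min (fst p)) ` (\<alpha> - {p, q}))"
    unfolding mns_def pq(8) merge_def by simp
  have "(\<lambda>p. Min (fst p)) ` (\<alpha> - {p, q}) = mns \<alpha> - {a, b}"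
  proof -
    have "inj_on (\<lambda>p. Min (fst p)) \<alpha>" using Min_inj[OF a] by (intro inj_onI)
    from inj_on_image_set_diff[OF this, of \<alpha> "{p, q}"] show ?thesis
      using pq by (simp add: mns_def)
  qed
  moreover have "a \<in> mns \<alpha>" using pq unfolding mns_def by blast
  ultimately show ?thesis using 1 pq(7) by auto
qed

text \<open>A merge consumes one unit of its own colour \<open>u\<close> in one block of the upper
  element. Room never grows, and in other colours it is unchanged.\<close>

lemma free_merge:
  assumes a: "\<alpha> \<in> WP" and g: "is_merge \<alpha> \<gamma> (a, b, u)" and y: "(Some \<gamma>, y) \<in> Ph"
  shows "free \<gamma> y c v \<Longrightarrow> free \<alpha> y c v" "free \<alpha> y c v \<Longrightarrow> v \<noteq> u \<Longrightarrow> free \<gamma> y c v"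
proof -
  obtain p q where pq: "p \<in> \<alpha>" "q \<in> \<alpha>" "p \<noteq> q" "u \<in> {1..k}" "\<gamma> = merge \<alpha> p q u"
    using is_mergeE[OF g] by metis
  have ws: "weight_sum \<alpha> (fst r) v \<le> weight_sum \<gamma> (fst r) v" "v \<noteq> u \<Longrightarrow> weight_sum \<gamma> (fst r) v = weight_sum \<alpha> (fst r) v"
    if yb: "y = Some \<beta>" and r: "r \<in> \<beta>" for r \<beta>
  proof -
    have b: "\<beta> \<in> WP" and "below (merge \<alpha> p q u) \<beta>" using y yb pq(5) by (auto simp: R_iff)
    then obtain r' where r': "r' \<in> \<beta>" "fst p \<subseteq> fst r'" "fst q \<subseteq> fst r'" using below_merge[OF a b pq(1-3)] by blast
    have eq: "weight_sum \<gamma> (fst r) v = weight_sum \<alpha> (fst r) v + (if r = r' \<and> v = u then 1 else 0)"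
    proof (cases "r = r'")
      case True
      then show ?thesis using weight_sum_merge_in[OF a pq(1-3), of "fst r" u v] r' pq(5) by simp
    next
      case False
      have "\<not> fst s \<subseteq> fst r" if s: "s \<in> \<alpha>" "fst s \<subseteq> fst r'" for s
      proof
        assume "fst s \<subseteq> fst r"
        moreover obtain x where "x \<in> fst s" using W_block(1)[OF a s(1)] by blast
        ultimately show False using W_disjoint[OF b r r'(1), of x] s(2) False by blast
      qed
      then show ?thesis using weight_sum_merge_out[of p "fst r" q \<alpha> u v] pq r' False by simp
    qed
    then show "weight_sum \<alpha> (fst r) v \<le> weight_sum \<gamma> (fst r) v" by simp
    show "v \<noteq> u \<Longrightarrow> weight_sum \<gamma> (fst r) v = weight_sum \<alpha> (fst r) v" using eq by simp
  qed
  show "free \<alpha> y c v" if f: "free \<gamma> y c v"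
  proof (cases y)
    case (Some \<beta>)
    then obtain r where r: "r \<in> \<beta>" "c \<in> fst r" "weight_sum \<gamma> (fst r) v < wt r v" using f by (auto simp: free_def)
    then have "weight_sum \<alpha> (fst r) v < wt r v" using ws(1)[OF Some r(1)] by linarith
    then show ?thesis using f r Some by (auto simp: free_def)
  qed (use f in \<open>simp add: free_def\<close>)
  show "free \<gamma> y c v" if f: "free \<alpha> y c v" "v \<noteq> u"
  proof (cases y)
    case (Some \<beta>)
    then obtain r where r: "r \<in> \<beta>" "c \<in> fst r" "weight_sum \<alpha> (fst r) v < wt r v" using f by (auto simp: free_def)
    then have "weight_sum \<gamma> (fst r) v < wt r v" using ws(2)[OF Some r(1) f(2)] by linarith
    then show ?thesis using f r Some by (auto simp: free_def)
  qed (use f in \<open>simp add: free_def\<close>)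
qed

text \<open>The larger minimum \<open>b\<close> disappears, no new minimum arises, and room never
  grows; so no label is added, and \<open>l\<close> itself, which mentions \<open>b\<close>, is
  gone.\<close>

lemma Lab_merge_subset:
  assumes a: "\<alpha> \<in> WP" and g: "is_merge \<alpha> \<gamma> l" and y: "(Some \<gamma>, y) \<in> Ph"
  shows "Lab \<gamma> y \<subseteq> Lab \<alpha> y - {l}"
proof
  obtain a b u where l: "l = (a, b, u)" by (cases l) auto
  note g' = g[unfolded l]
  have ay: "(Some \<alpha>, y) \<in> Ph" using is_merge_facts(3)[OF a g] y Ph_trans[of "Some \<alpha>" "Some \<gamma>" y] by simp
  fix x assume x: "x \<in> Lab \<gamma> y"
  obtain c d v where xx: "x = (c, d, v)" by (cases x) auto
  have "c \<in> mns \<alpha> - {b}" "d \<in> mns \<alpha> - {b}" "c < d" "joined y c d" "free \<alpha> y c v"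
    using x unfolding xx Lab_iff[OF y] mns_merge[OF a g'] using free_merge(1)[OF a g' y] by auto
  then show "x \<in> Lab \<alpha> y - {l}" unfolding xx l using Lab_iff[OF ay] by auto
qed

text \<open>Least \<open>a\<close>, then least \<open>b\<close> for this \<open>a\<close>, then
  least free colour for \<open>a\<close>. The product structure makes this triple available, and so
  it is least in the componentwise order as well.\<close>

lemma Lab_least:
  assumes y: "(Some \<alpha>, y) \<in> Ph" and ne: "Lab \<alpha> y \<noteq> {}"
  shows "\<exists>l\<in>Lab \<alpha> y. \<forall>l'\<in>Lab \<alpha> y. label_le l l'"
proof -
  define a where "a = (LEAST a. \<exists>b u. (a, b, u) \<in> Lab \<alpha> y)"
  define b where "b = (LEAST b. \<exists>u. (a, b, u) \<in> Lab \<alpha> y)"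
  define u where "u = (LEAST u. free \<alpha> y a u)"
  have "\<exists>a b u. (a, b, u) \<in> Lab \<alpha> y" using ne by (metis ex_in_conv prod_cases3)
  then have "\<exists>b u. (a, b, u) \<in> Lab \<alpha> y" unfolding a_def by (rule LeastI_ex)
  then have "\<exists>u. (a, b, u) \<in> Lab \<alpha> y" unfolding b_def by (rule LeastI_ex)
  then obtain v where v: "(a, b, v) \<in> Lab \<alpha> y" by blast
  then have "free \<alpha> y a v" by (simp add: Lab_iff[OF y])
  then have "free \<alpha> y a u" unfolding u_def by (rule LeastI)
  then have "(a, b, u) \<in> Lab \<alpha> y" using v by (simp add: Lab_iff[OF y])
  moreover have "label_le (a, b, u) l" if l: "l \<in> Lab \<alpha> y" for l
  proof -
    obtain c d v where cd: "l = (c, d, v)" by (cases l) auto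
    have "a \<le> c" unfolding a_def by (rule Least_le) (use l cd in blast)
    moreover have "b \<le> d \<and> u \<le> v" if ac: "a = c"
    proof
      show "b \<le> d" unfolding b_def by (rule Least_le) (use l cd ac in blast)
      show "u \<le> v" unfolding u_def by (rule Least_le) (use l cd ac in \<open>simp add: Lab_iff[OF y]\<close>)
    qed
    ultimately show ?thesis unfolding cd label_le_simp by linarith
  qed
  ultimately show ?thesis by blast
qed

text \<open>The edge to the top is labelled as if the last block were merged in colour 1 with a
  further block of minimum n + 1. The default 0 sits at \<open>None\<close>, from which no cover
  starts.\<close>

definition lam :: "weighted_partition option \<Rightarrow> weighted_partition option \<Rightarrow> nat" where
  "lam x z = (case x of None \<Rightarrow> 0 | Some \<alpha> \<Rightarrow>
     (case z of None \<Rightarrow> label_code (1, n + 1, 1) | Some \<gamma> \<Rightarrow> label_code (THE l. is_merge \<alpha> \<gamma> l)))"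

lemma lam_merge: "\<alpha> \<in> WP \<Longrightarrow> is_merge \<alpha> \<gamma> l \<Longrightarrow> lam (Some \<alpha>) (Some \<gamma>) = label_code l"
  unfolding lam_def using label_unique by (simp add: the_equality)

lemma lam_top: "lam (Some \<alpha>) None = label_code (1, n + 1, 1)"
  by (simp add: lam_def)

definition least_cover :: "weighted_partition option \<Rightarrow> weighted_partition option \<Rightarrow> weighted_partition option \<Rightarrow> bool" where
  "least_cover x y z \<longleftrightarrow> covers Ph x z \<and> (z, y) \<in> Ph \<and>
     (\<forall>z'. covers Ph x z' \<longrightarrow> (z', y) \<in> Ph \<longrightarrow> z' \<noteq> z \<longrightarrow> (lam x z, lam x z') \<in> label_rel - Id)"

lemma Lab_single: assumes "card \<alpha> = 1" "\<alpha> \<in> WP" shows "Lab \<alpha> y = {}"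
proof -
  have False if "is_merge \<alpha> \<gamma> l" for \<gamma> l
    using is_merge_facts(1,2)[OF assms(2) that] W_card_pos[of \<gamma>] assms(1) by simp
  then show ?thesis unfolding Lab_def by blast
qed

lemma Lab_nonempty:
  assumes y: "(Some \<alpha>, y) \<in> Ph" "Some \<alpha> \<noteq> y" and c: "y \<noteq> None \<or> card \<alpha> \<noteq> 1"
  shows "Lab \<alpha> y \<noteq> {}"
proof (cases y)
  case None
  then have a: "\<alpha> \<in> WP" using y by simp
  then have "\<not> card \<alpha> \<le> Suc 0" using W_card_pos[OF a] c None by simp
  then obtain p q where pq: "p \<in> \<alpha>" "q \<in> \<alpha>" "p \<noteq> q"
    using card_le_Suc0_iff_eq[OF W_finite(1)[OF a]] by blast
  obtain l where l: "is_merge \<alpha> (merge \<alpha> p q 1) l" using merge_is_merge[OF a pq, of 1] k by auto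
  then have "(Some (merge \<alpha> p q 1), y) \<in> Ph" using is_merge_facts(1)[OF a l] None by simp
  then have "l \<in> Lab \<alpha> y" using l unfolding Lab_def by blast
  then show ?thesis by blast
next
  case (Some \<beta>)
  then have ab: "(\<alpha>, \<beta>) \<in> Q" "\<alpha> \<noteq> \<beta>" using y by auto
  obtain p q u where pq: "p \<in> \<alpha>" "q \<in> \<alpha>" "u \<in> {1..k}" "p \<noteq> q" "(merge \<alpha> p q u, \<beta>) \<in> Q"
    using Q_step[OF ab] by blast
  obtain l where l: "is_merge \<alpha> (merge \<alpha> p q u) l" using merge_is_merge[OF Q_W(1)[OF ab(1)] pq(1,2,4,3)] by blast
  then have "l \<in> Lab \<alpha> y" using pq(5) Some unfolding Lab_def by (intro CollectI exI conjI) simp_all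
  then show ?thesis by blast
qed

lemma least_cover_ex:
  assumes xy: "(x, y) \<in> Ph" "x \<noteq> y"
  shows "\<exists>z. least_cover x y z"
proof -
  obtain \<alpha> where x: "x = Some \<alpha>" using xy by (cases x; cases y) auto
  have a: "\<alpha> \<in> WP" using xy x by (cases y) (auto dest: Q_W)
  show ?thesis
  proof (cases "y = None \<and> card \<alpha> = 1")
    case True
    have "z' = None" if c: "covers Ph x z'" for z'
      using c
    proof (cases rule: covers_cases)
      case (merge \<alpha>' \<gamma> l)
      then show ?thesis using is_merge_facts(1,2)[OF merge(1,4)] W_card_pos[of \<gamma>] True x by simp
    qed
    moreover have "covers Ph x None" using covers_None a True x by simp
    ultimately have "least_cover x y None" using True unfolding least_cover_def by auto
    then show ?thesis by blast
  next
    case False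
    have y: "(Some \<alpha>, y) \<in> Ph" "Some \<alpha> \<noteq> y" using xy x by auto
    obtain l where l: "l \<in> Lab \<alpha> y" "\<forall>l'\<in>Lab \<alpha> y. label_le l l'"
    proof -
      have "y \<noteq> None \<or> card \<alpha> \<noteq> 1" using False by (cases "y = None") simp_all
      from Lab_least[OF y(1) Lab_nonempty[OF y this]] show ?thesis using that by blast
    qed
    obtain \<gamma> where g: "is_merge \<alpha> \<gamma> l" "(Some \<gamma>, y) \<in> Ph" using l(1) unfolding Lab_def by blast
    have "(lam x (Some \<gamma>), lam x z') \<in> label_rel - Id"
      if z': "covers Ph x z'" "(z', y) \<in> Ph" "z' \<noteq> Some \<gamma>" for z'
      using z'(1)
    proof (cases rule: covers_cases)
      case (merge \<alpha>' \<gamma>' l')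
      then have m: "is_merge \<alpha> \<gamma>' l'" "z' = Some \<gamma>'" using x by auto
      have "label_le l l'" using l(2) m z'(2) unfolding Lab_def by blast
      moreover have "l \<noteq> l'" using merge_unique[OF a g(1)] m z'(3) by blast
      ultimately show ?thesis unfolding x m(2) lam_merge[OF a g(1)] lam_merge[OF a m(1)] label_rel_iff by blast
    next
      case (top \<alpha>')
      then have "y = None" using z'(2) by (cases y) auto
      then show ?thesis using False top x by simp
    qed
    moreover have "covers Ph x (Some \<gamma>)" using covers_Some a g(1) x by blast
    ultimately have "least_cover x y (Some \<gamma>)" using g(2) unfolding least_cover_def by blast
    then show ?thesis by blast
  qed
qed

definition M :: "weighted_partition option \<Rightarrow> weighted_partition option \<Rightarrow> weighted_partition option" where
  "M x y = (SOME z. least_cover x y z)"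

lemma M_least_cover: "(x, y) \<in> Ph \<Longrightarrow> x \<noteq> y \<Longrightarrow> least_cover x y (M x y)"
  unfolding M_def by (rule someI_ex) (rule least_cover_ex)

lemma covers_Ph: "covers Ph x z \<Longrightarrow> (x, z) \<in> Ph" "covers Ph x z \<Longrightarrow> x \<noteq> z"
  by (simp_all add: covers_def)

lemma least_cover_label:
  assumes lc: "least_cover (Some \<alpha>) y (Some \<gamma>)" and g: "is_merge \<alpha> \<gamma> l" and a: "\<alpha> \<in> WP" and l': "l' \<in> Lab \<alpha> y"
  shows "label_le l l'"
proof -
  obtain \<gamma>' where g': "is_merge \<alpha> \<gamma>' l'" "(Some \<gamma>', y) \<in> Ph" using l' unfolding Lab_def by blast
  show ?thesis
  proof (cases "\<gamma>' = \<gamma>")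
    case True
    then have "l' = l" using label_unique[OF a] g g' by blast
    then show ?thesis by (simp add: label_le_refl)
  next
    case False
    have "covers Ph (Some \<alpha>) (Some \<gamma>')" using covers_Some a g'(1) by blast
    then have "(lam (Some \<alpha>) (Some \<gamma>), lam (Some \<alpha>) (Some \<gamma>')) \<in> label_rel - Id"
      using lc g'(2) False unfolding least_cover_def by simp
    then show ?thesis unfolding lam_merge[OF a g] lam_merge[OF a g'(1)] label_rel_iff by blast
  qed
qed

lemma one_mns: assumes "\<alpha> \<in> WP" shows "1 \<in> mns \<alpha>" "b \<in> mns \<alpha> \<Longrightarrow> 1 \<le> b \<and> b \<le> n"
proof -
  have r: "1 \<le> Min (fst p) \<and> Min (fst p) \<le> n" if "p \<in> \<alpha>" for p
    using Min_mem[OF assms that] W_block(2)[OF assms that] by auto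
  then show "b \<in> mns \<alpha> \<Longrightarrow> 1 \<le> b \<and> b \<le> n" unfolding mns_def by blast
  obtain p where p: "p \<in> \<alpha>" "1 \<in> fst p" using W_cover[OF assms, of 1] n by auto
  have "Min (fst p) \<le> 1" using p W_block(3)[OF assms p(1)] by simp
  then have "Min (fst p) = 1" using r[OF p(1)] by simp
  then show "1 \<in> mns \<alpha>" using p(1) unfolding mns_def by force
qed

lemma mns_single: assumes "\<gamma> \<in> WP" "card \<gamma> = 1" shows "mns \<gamma> = {1}"
proof -
  obtain p where "\<gamma> = {p}" using assms(2) by (rule card_1_singletonE)
  then have "mns \<gamma> = {Min (fst p)}" by (simp add: mns_def)
  then show ?thesis using one_mns(1)[OF assms(1)] by auto
qed

text \<open>By \<open>Lab_merge_subset\<close> the next label was already a competitor when the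
  least one was chosen, and it is a different one. If the next edge leads to the top, the least
  label is that of a last merge, with a = 1, b \<le> n and colour 1.\<close>

lemma labels_increase:
  assumes xy: "(x, y) \<in> Ph" "x \<noteq> y" "M x y \<noteq> y"
  shows "(lam x (M x y), lam (M x y) (M (M x y) y)) \<in> label_rel - Id"
proof -
  note m = M_least_cover[OF xy(1,2)]
  then have c: "covers Ph x (M x y)" and zy: "(M x y, y) \<in> Ph" by (auto simp: least_cover_def)
  from c show ?thesis
  proof (cases rule: covers_cases)
    case (top \<alpha>)
    then show ?thesis using zy xy(3) by (cases y) auto
  next
    case (merge \<alpha> \<gamma> l)
    obtain a b u where l: "l = (a, b, u)" by (cases l) auto
    have gW: "\<gamma> \<in> WP" by (rule is_merge_facts(1)[OF merge(1,4)])
    have gy: "(Some \<gamma>, y) \<in> Ph" using zy merge by simp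
    have lc: "least_cover (Some \<alpha>) y (Some \<gamma>)" using m merge by simp
    note w = M_least_cover[OF zy xy(3)]
    then have cw: "covers Ph (M x y) (M (M x y) y)" and wy: "(M (M x y) y, y) \<in> Ph" by (auto simp: least_cover_def)
    from cw show ?thesis
    proof (cases rule: covers_cases)
      case (merge \<gamma>' \<delta> l')
      then have d: "is_merge \<gamma> \<delta> l'" using \<open>M x y = Some \<gamma>\<close> by simp
      then have "l' \<in> Lab \<gamma> y" using wy merge(3) unfolding Lab_def by auto
      then have "l' \<in> Lab \<alpha> y" "l' \<noteq> l"
        using Lab_merge_subset[OF \<open>\<alpha> \<in> WP\<close> \<open>is_merge \<alpha> \<gamma> l\<close> gy] by auto
      then have "label_le l l'" "l \<noteq> l'"
        using least_cover_label[OF lc \<open>is_merge \<alpha> \<gamma> l\<close> \<open>\<alpha> \<in> WP\<close>] by auto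
      then show ?thesis
        unfolding \<open>x = Some \<alpha>\<close> \<open>M x y = Some \<gamma>\<close>
        using lam_merge[OF \<open>\<alpha> \<in> WP\<close> \<open>is_merge \<alpha> \<gamma> l\<close>] lam_merge[OF gW d] merge(3) \<open>x = Some \<alpha>\<close> \<open>M x y = Some \<gamma>\<close>
        by (simp only: label_rel_iff simp_thms)
    next
      case (top \<gamma>')
      then have y: "y = None" and cg: "card \<gamma> = 1" using wy \<open>M x y = Some \<gamma>\<close> by (cases y; simp)+
      have ay: "(Some \<alpha>, None) \<in> Ph" using \<open>\<alpha> \<in> WP\<close> by simp
      have lL: "(a, b, u) \<in> Lab \<alpha> y" using \<open>is_merge \<alpha> \<gamma> l\<close> gy l unfolding Lab_def by blast
      then have ab: "a \<in> mns \<alpha>" "b \<in> mns \<alpha>" "a < b" unfolding y Lab_iff[OF ay] by auto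
      have "a \<in> mns \<gamma>" using mns_merge[OF \<open>\<alpha> \<in> WP\<close>, of \<gamma> a b u] \<open>is_merge \<alpha> \<gamma> l\<close> l ab by auto
      then have a1: "a = 1" using mns_single[OF gW cg] by simp
      \<comment> \<open>All colours are free below the top, so the least label cannot have a colour
        above 1.\<close>
      have "(a, b, 1) \<in> Lab \<alpha> y" using ab k unfolding y Lab_iff[OF ay] by (auto simp: joined_def free_def)
      then have "label_le l (a, b, 1)" by (rule least_cover_label[OF lc \<open>is_merge \<alpha> \<gamma> l\<close> \<open>\<alpha> \<in> WP\<close>])
      then have "u \<le> 1" by (simp add: l label_le_simp)
      moreover have "b \<le> n" using one_mns(2)[OF \<open>\<alpha> \<in> WP\<close> ab(2)] by simp
      ultimately have "label_le l (1, n + 1, 1)" "l \<noteq> (1, n + 1, 1)" using a1 by (auto simp: l label_le_simp)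
      then show ?thesis
        using lam_merge[OF \<open>\<alpha> \<in> WP\<close> \<open>is_merge \<alpha> \<gamma> l\<close>] lam_top[of \<gamma>] top(3) \<open>x = Some \<alpha>\<close> \<open>M x y = Some \<gamma>\<close>
        by (simp only: label_rel_iff simp_thms)
    qed
  qed
qed

text \<open>Let \<open>l\<close> be the label of z and \<open>l0\<close> the least label, assumed
  different. Increase forces every label available above z to be at least \<open>l\<close>. But part
  of \<open>l0\<close> survives the merge: its pair of minima, or, if exactly that pair was merged,
  its smaller colour. Each yields a label, or the top edge, not above \<open>l\<close>.\<close>

lemma increase_only_from_least:
  assumes xz: "covers Ph x z" and zy: "(z, y) \<in> Ph" "z \<noteq> y"
    and inc: "(lam x z, lam z (M z y)) \<in> label_rel - Id"
  shows "z = M x y"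
proof (rule ccontr)
  assume zM: "z \<noteq> M x y"
  note w = M_least_cover[OF zy]
  have xy: "(x, y) \<in> Ph" "x \<noteq> y"
    using Ph_trans covers_Ph[OF xz] zy Ph_antisym by blast+
  note m = M_least_cover[OF xy]
  from xz obtain \<alpha> \<gamma> l where a: "\<alpha> \<in> WP" and x: "x = Some \<alpha>" and z: "z = Some \<gamma>" and g: "is_merge \<alpha> \<gamma> l"
  proof (cases rule: covers_cases)
    case (top \<alpha>)
    then show ?thesis using zy by (cases y) auto
  qed
  obtain a b u where l: "l = (a, b, u)" by (cases l) auto
  have gW: "\<gamma> \<in> WP" by (rule is_merge_facts(1)[OF a g])
  have gy: "(Some \<gamma>, y) \<in> Ph" and ay: "(Some \<alpha>, y) \<in> Ph" using zy z xy x by auto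
  have lL: "(a, b, u) \<in> Lab \<alpha> y" using g gy l unfolding Lab_def by blast
  then have ab: "a \<in> mns \<alpha>" "b \<in> mns \<alpha>" "a < b" "joined y a b" "free \<alpha> y a u" unfolding Lab_iff[OF ay] by auto
  have mg: "mns \<gamma> = mns \<alpha> - {b}" using mns_merge[OF a] g l by blast
  obtain \<gamma>0 l0 where g0: "M x y = Some \<gamma>0" "is_merge \<alpha> \<gamma>0 l0"
  proof -
    have "covers Ph x (M x y)" using m by (simp add: least_cover_def)
    then show ?thesis
    proof (cases rule: covers_cases)
      case (merge \<alpha>' \<gamma>' l')
      then show ?thesis using that x by simp
    next
      case (top \<alpha>')
      then show ?thesis using is_merge_facts(2)[OF a g] W_card_pos[OF gW] x by simp
    qed
  qed
  obtain a0 b0 u0 where l0: "l0 = (a0, b0, u0)" by (cases l0) auto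
  have lc0: "least_cover (Some \<alpha>) y (Some \<gamma>0)" using m g0 x by simp
  have l0L: "(a0, b0, u0) \<in> Lab \<alpha> y"
    using lc0 g0(2) l0 unfolding least_cover_def Lab_def by blast
  then have ab0: "a0 \<in> mns \<alpha>" "b0 \<in> mns \<alpha>" "a0 < b0" "joined y a0 b0" "free \<alpha> y a0 u0" unfolding Lab_iff[OF ay] by auto
  have min0: "label_le (a0, b0, u0) l'" if "l' \<in> Lab \<alpha> y" for l'
    using least_cover_label[OF lc0 g0(2) a that] l0 by simp
  have lt0: "label_le (a0, b0, u0) (a, b, u)" by (rule min0[OF lL])
  have ne0: "(a0, b0, u0) \<noteq> (a, b, u)" using merge_unique[OF a g] g0 zM z l l0 by metis
  \<comment> \<open>The label following \<open>l\<close> is the least one available above z, so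
    transitivity reaches all of them. If the top edge follows, none is available.\<close>
  have up: "label_le (a, b, u) l'" if l': "l' \<in> Lab \<gamma> y" for l'
  proof -
    have "covers Ph z (M z y)" using w by (simp add: least_cover_def)
    then show ?thesis
    proof (cases rule: covers_cases)
      case (merge \<gamma>' \<delta> l1)
      then have d: "is_merge \<gamma> \<delta> l1" "M z y = Some \<delta>" using z by auto
      have "least_cover (Some \<gamma>) y (Some \<delta>)" using w z d by simp
      then have "label_le l1 l'" using least_cover_label[OF _ d(1) gW l'] by blast
      moreover have "label_le l l1"
      proof -
        have Mz: "M (Some \<gamma>) y = Some \<delta>" using d(2) z by simp
        show ?thesis
          using inc unfolding x z Mz lam_merge[OF a g] lam_merge[OF gW d(1)] label_rel_iff by simp
      qed
      ultimately show ?thesis using label_le_trans l by blast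
    next
      case (top \<gamma>')
      then show ?thesis using Lab_single[of \<gamma> y] gW l' z by simp
    qed
  qed
  have keep: "\<exists>v. (c, d, v) \<in> Lab \<gamma> y" if "c \<in> mns \<gamma>" "d \<in> mns \<gamma>" "c < d" "joined y c d" for c d
    using free_exists[OF gy that(1,2) _ that(4)] that Lab_iff[OF gy] by blast
  consider "a0 < a" | "a0 = a" "b0 < b" | "a0 = a" "b0 = b" "u0 < u"
    using lt0 ne0 unfolding label_le_simp by fastforce
  then show False
  proof cases
    case 1
    \<comment> \<open>If b0 = b, then a0 and a would be joined through b, and (a0, a, u0) would
      undercut (a0, b, u0) because a < b.\<close>
    have "b0 \<noteq> b"
    proof
      assume bb: "b0 = b"
      have "joined y a0 a" using joined_trans[OF ay ab0(4)] joined_sym[OF ab(4)] bb by simp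
      then have "(a0, a, u0) \<in> Lab \<alpha> y" using ab ab0 1 unfolding Lab_iff[OF ay] by blast
      then have "label_le (a0, b0, u0) (a0, a, u0)" by (rule min0)
      then show False using bb ab(3) by (simp add: label_le_simp)
    qed
    moreover have "a0 \<noteq> b" using 1 ab(3) by simp
    ultimately obtain v where "(a0, b0, v) \<in> Lab \<gamma> y" using keep[of a0 b0] ab0 mg by auto
    then show False using up 1 by (fastforce simp: label_le_simp)
  next
    case 2
    then have "a0 \<noteq> b" "b0 \<noteq> b" using ab(3) by auto
    then obtain v where "(a0, b0, v) \<in> Lab \<gamma> y" using keep[of a0 b0] ab0 mg by auto
    then show False using up 2 by (fastforce simp: label_le_simp)
  next
    case 3
    \<comment> \<open>The colour \<open>u0\<close> differs from the colour \<open>u\<close> just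
      used and is still free. Any label in colour \<open>u0\<close> on the block of
      \<open>a0\<close> fails to be above (a, b, u), however large its second entry: here
      componentwise comparison is essential.\<close>
    have fr: "free \<gamma> y a0 u0" using free_merge(2)[OF a _ gy ab0(5), of a b u] g l 3 by simp
    have am: "a0 \<in> mns \<gamma>" using mg ab0(1) 3 ab(3) by simp
    have contra: False if d: "d \<in> mns \<gamma>" "d \<noteq> a0" "joined y a0 d" for d
    proof (cases "a0 < d")
      case True
      then have "(a0, d, u0) \<in> Lab \<gamma> y" using fr am d unfolding Lab_iff[OF gy] by blast
      then show False using up 3 by (fastforce simp: label_le_simp)
    next
      case False
      then have "d < a0" using d(2) by simp
      then have "(d, a0, u0) \<in> Lab \<gamma> y"
        using free_joined[OF gy d(3) fr] am d(1) joined_sym[OF d(3)] unfolding Lab_iff[OF gy] by blast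
      then show False using up 3 \<open>d < a0\<close> by (fastforce simp: label_le_simp)
    qed
    show False
    proof (cases y)
      case (Some \<beta>)
      then show False using partner_exists[of \<gamma> \<beta> a0 u0] gy am fr contra by blast
    next
      case None
      show False
      proof (cases "card \<gamma> = 1")
        case True
        have "covers Ph z (M z y)" using w by (simp add: least_cover_def)
        then have "M z y = None"
        proof (cases rule: covers_cases)
          case (merge \<gamma>' \<delta> l1)
          then show ?thesis using is_merge_facts(1,2)[OF merge(1,4)] W_card_pos[of \<delta>] z True by simp
        qed
        \<comment> \<open>Only the top edge can follow. Its label has first entry 1 and colour 1, so
          being above \<open>l\<close> forces u \<le> 1, against 1 \<le> u0 < u.\<close>
        then have "label_le l (1, n + 1, 1)"
          using inc unfolding x z using lam_merge[OF a g] lam_top[of \<gamma>] by (simp only: label_rel_iff)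
        moreover have "1 \<le> a" using one_mns(2)[OF a ab(1)] by simp
        ultimately have "u \<le> 1" unfolding l label_le_simp by auto
        moreover have "1 \<le> u0" using ab0(5) by (simp add: free_def)
        ultimately show False using 3 by simp
      next
        case False
        then have "\<not> card \<gamma> \<le> Suc 0" using W_card_pos[OF gW] by simp
        then obtain p q where pq: "p \<in> \<gamma>" "q \<in> \<gamma>" "p \<noteq> q"
          using card_le_Suc0_iff_eq[OF W_finite(1)[OF gW]] by blast
        then have "Min (fst p) \<noteq> Min (fst q)" using Min_inj[OF gW] by blast
        then obtain d where "d \<in> mns \<gamma>" "d \<noteq> a0" using pq unfolding mns_def by blast
        then show False using contra None by (simp add: joined_def)
      qed
    qed
  qed
qed

theorem EL_labeling_Ph: "EL_labeling label_rel lam Ph"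
proof (rule EL_labeling_greedy[where rk = rk and M = M])
  show "lam x y \<in> Field label_rel" if "covers Ph x y" for x y
    using that by (cases rule: covers_cases) (auto simp: lam_def label_code_Field)
  show "covers Ph x (M x y)" "(M x y, y) \<in> Ph" if "(x, y) \<in> Ph" "x \<noteq> y" for x y
    using M_least_cover[OF that] by (simp_all add: least_cover_def)
  show "(lam x (M x y), lam x z) \<in> label_rel - Id" if z: "covers Ph x z" "(z, y) \<in> Ph" "z \<noteq> M x y" for x y z
  proof -
    have "(x, y) \<in> Ph" "x \<noteq> y" using Ph_trans covers_Ph[OF z(1)] z(2) Ph_antisym by blast+
    then show ?thesis using M_least_cover z unfolding least_cover_def by blast
  qed
qed (fact Partial_order_Ph Partial_order_label_rel | rule rk_covers rk_mono labels_increase increase_only_from_least; assumption)+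

section \<open>Finiteness, bounds and the resulting shelling\<close>

lemma finite_WP: "finite WP"
proof -
  let ?S = "{\<mu> :: nat \<Rightarrow>\<^sub>0 nat. \<forall>u. (u \<in> {1..k} \<longrightarrow> Poly_Mapping.lookup \<mu> u \<in> {..n}) \<and>
      (u \<notin> {1..k} \<longrightarrow> Poly_Mapping.lookup \<mu> u = 0)}"
  have "finite (Poly_Mapping.lookup ` ?S)"
    by (rule finite_subset[OF _ finite_set_of_finite_funs[of "{1..k}" "{..n}" 0]]) auto
  then have S: "finite ?S" by (rule finite_imageD) (simp add: inj_on_def poly_mapping_eqI)
  have "\<alpha> \<subseteq> Pow {1..n} \<times> ?S" if a: "\<alpha> \<in> WP" for \<alpha>
  proof
    fix p assume p: "p \<in> \<alpha>"
    note b = W_block[OF a p]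
    have "card (fst p) \<le> n" using card_mono[OF _ b(2)] by simp
    then have "wt p u \<le> n" if "u \<in> {1..k}" for u
      using member_le_sum[of u "{1..k}" "wt p"] that b(5) by simp
    moreover have "wt p u = 0" if "u \<notin> {1..k}" for u
      using that b(4) by (meson in_keys_iff subsetD)
    ultimately have "snd p \<in> ?S" by blast
    then show "p \<in> Pow {1..n} \<times> ?S" using b(2) by (simp add: mem_Times_iff)
  qed
  then have "WP \<subseteq> Pow (Pow {1..n} \<times> ?S)" by blast
  moreover have "finite (Pow (Pow {1..n} \<times> ?S))" using S by simp
  ultimately show ?thesis by (rule finite_subset)
qed

lemma finite_Field_Ph: "finite (Field Ph)"
  unfolding Field_Ph using finite_WP by simp

lemma bottom_W: "bottom_partition n \<in> WP"
  by (rule W_I) (auto simp: bottom_partition_def)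

lemma card_bottom: "card (bottom_partition n) = n"
  unfolding bottom_partition_def by (subst card_image) (auto simp: inj_on_def)

lemma bottom_least: assumes "\<alpha> \<in> WP" shows "(bottom_partition n, \<alpha>) \<in> Q"
proof -
  have "below (bottom_partition n) \<alpha>"
    unfolding below_def
  proof (intro conjI ballI allI)
    fix p assume "p \<in> bottom_partition n"
    then obtain i where "i \<in> {1..n}" "fst p = {i}" unfolding bottom_partition_def by auto
    then show "\<exists>q\<in>\<alpha>. fst p \<subseteq> fst q" using W_cover[OF assms, of i] by auto
  next
    fix q u assume "q \<in> \<alpha>"
    have "weight_sum (bottom_partition n) (fst q) u = 0"
      unfolding weight_sum_def bottom_partition_def by (intro sum.neutral) auto
    then show "weight_sum (bottom_partition n) (fst q) u \<le> wt q u" by simp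
  qed
  then show ?thesis using assms bottom_W by (simp add: R_iff)
qed

lemma bottom_least_Ph: "x \<in> Field Ph \<Longrightarrow> (Some (bottom_partition n), x) \<in> Ph"
  unfolding Field_Ph using bottom_least bottom_W by auto

lemma top_Ph: "x \<in> Field Ph \<Longrightarrow> (x, None) \<in> Ph"
  unfolding Field_Ph by auto

theorem EL_shellable_Ph: "EL_shellable Ph"
proof -
  have "finite_bounded_poset Ph"
    unfolding finite_bounded_poset_def
  proof (intro conjI)
    show "\<exists>b\<in>Field Ph. \<forall>x\<in>Field Ph. (b, x) \<in> Ph"
      using bottom_least_Ph bottom_W by (intro bexI[of _ "Some (bottom_partition n)"]) (auto simp: Field_Ph)
    show "\<exists>t\<in>Field Ph. \<forall>x\<in>Field Ph. (x, t) \<in> Ph"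
      using top_Ph by (intro bexI[of _ None]) (auto simp: Field_Ph)
  qed (fact Partial_order_Ph finite_Field_Ph)+
  then show ?thesis unfolding EL_shellable_def using EL_labeling_Ph by blast
qed

lemma shelling_Ph: "shelling (n + 1) (order_complex Ph)"
proof -
  interpret graded_EL Ph label_rel lam rk "Some (bottom_partition n)" None
  proof
    show "Some (bottom_partition n) \<in> Field Ph" using bottom_W by (simp add: Field_Ph)
  qed (fact Partial_order_Ph finite_Field_Ph EL_labeling_Ph | rule rk_covers bottom_least_Ph top_Ph; assumption)+
  have "rk None + 1 - rk (Some (bottom_partition n)) = n + 1"
    by (simp add: rk_def card_bottom)
  then show ?thesis using order_complex_shelling by simp
qed

lemma one_block_W:
  assumes "\<mu> \<in> WComp (n - 1)" "Poly_Mapping.keys \<mu> \<subseteq> {1..k}"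
  shows "one_block n \<mu> \<in> WP"
proof -
  have "partition_on {1..n} {{1..n}}" using n by (intro partition_onI) auto
  then show ?thesis using assms by (simp add: one_block_def weighted_partitions_def)
qed

lemma open_interval_wedge:
  assumes \<mu>: "\<mu> \<in> WComp (n - 1)" "Poly_Mapping.keys \<mu> \<subseteq> {1..k}"
  defines "I \<equiv> open_interval Q (bottom_partition n) (one_block n \<mu>)"
  shows "\<exists>m. geometric_realization (order_complex (Restr Q I)) homotopy_equivalent_space
    wedge_of_spheres (int n - 3) m"
proof -
  let ?b = "bottom_partition n" and ?t = "one_block n \<mu>"
  have tW: "?t \<in> WP" by (rule one_block_W[OF \<mu>])
  have ct: "card ?t = 1" by (simp add: one_block_def)
  have Imem: "\<alpha> \<in> I \<longleftrightarrow> (?b, \<alpha>) \<in> Q \<and> (\<alpha>, ?t) \<in> Q \<and> \<alpha> \<noteq> ?b \<and> \<alpha> \<noteq> ?t" for \<alpha>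
    by (simp add: I_def open_interval_def)
  have IW: "I \<subseteq> WP" using Imem Q_W by blast
  show ?thesis
  proof (cases "n = 1")
    case True
    \<comment> \<open>For n = 1 bottom and single block coincide, so the chain below would have two
      elements instead of three; the empty interval matches the empty wedge in dimension -2.\<close>
    have "I = {}"
    proof (rule ccontr)
      assume "I \<noteq> {}"
      then obtain \<alpha> where a: "\<alpha> \<in> I" by blast
      then have "card \<alpha> < card ?b" using Q_card[of ?b \<alpha>] Imem[of \<alpha>] by auto
      then show False using W_card_pos[of \<alpha>] IW a card_bottom True by auto
    qed
    then have "order_complex (Restr Q I) = {{}}" by (auto simp: order_complex_def Chains_def)
    then show ?thesis
      using True by (simp add: realization_empty wedge_of_spheres_def homeomorphic_imp_homotopy_equivalent_space homeomorphic_empty_space_eq)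
  next
    case False
    then have bt: "?b \<noteq> ?t" using card_bottom ct by metis
    let ?\<sigma> = "{Some ?b, Some ?t, None}"
    \<comment> \<open>A single block is maximal among the partitions, so whatever is comparable with
      it lies below it. This confines the link to the interval.\<close>
    have max: "(\<alpha>, ?t) \<in> Q" if "(?t, \<alpha>) \<in> Q" for \<alpha>
    proof (cases "\<alpha> = ?t")
      case True
      then show ?thesis using Q_refl[OF tW] by simp
    next
      case False
      then have "card \<alpha> < 1" using Q_card[OF that] ct by simp
      then show ?thesis using W_card_pos[OF Q_W(2)[OF that]] by simp
    qed
    have simp_K: "simplicial (order_complex Ph)" by (rule shelling_complex(1)[OF shelling_Ph])
    have OC: "\<tau> \<in> order_complex Ph \<longleftrightarrow> finite \<tau> \<and> (\<forall>x\<in>\<tau>. \<forall>y\<in>\<tau>. (x, y) \<in> Ph \<or> (y, x) \<in> Ph)" for \<tau>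
      by (auto simp: order_complex_def Chains_def)
    have \<sigma>: "?\<sigma> \<in> order_complex Ph"
      unfolding OC using bottom_least[OF tW] Q_refl[OF tW] Q_refl[OF bottom_W] bottom_W tW by simp
    have link: "link (order_complex Ph) ?\<sigma> = (`) Some ` order_complex (Restr Q I)"
      unfolding link_simplicial[OF simp_K]
    proof (intro equalityI subsetI)
      fix \<tau> assume "\<tau> \<in> {\<tau>. ?\<sigma> \<inter> \<tau> = {} \<and> ?\<sigma> \<union> \<tau> \<in> order_complex Ph}"
      then have dis: "?\<sigma> \<inter> \<tau> = {}" and fin: "finite \<tau>"
        and ch: "\<And>x y. x \<in> ?\<sigma> \<union> \<tau> \<Longrightarrow> y \<in> ?\<sigma> \<union> \<tau> \<Longrightarrow> (x, y) \<in> Ph \<or> (y, x) \<in> Ph"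
        unfolding OC by auto
      let ?C = "Some -` \<tau>"
      have "\<tau> = Some ` ?C"
      proof
        show "\<tau> \<subseteq> Some ` ?C"
        proof
          fix x assume x: "x \<in> \<tau>"
          then have "x \<noteq> None" using dis by (cases "x = None") simp_all
          then obtain \<alpha> where "x = Some \<alpha>" by (cases x) simp_all
          then show "x \<in> Some ` ?C" using x by simp
        qed
      qed auto
      moreover have "finite ?C" by (rule finite_vimageI[OF fin]) simp
      moreover have CI: "\<alpha> \<in> I" if "\<alpha> \<in> ?C" for \<alpha>
      proof -
        have a: "Some \<alpha> \<in> \<tau>" using that by simp
        have "(\<alpha>, ?t) \<in> Q \<or> (?t, \<alpha>) \<in> Q" using ch[of "Some \<alpha>" "Some ?t"] a by simp
        then have at: "(\<alpha>, ?t) \<in> Q" using max by blast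
        moreover have "(?b, \<alpha>) \<in> Q" by (rule bottom_least[OF Q_W(1)[OF at]])
        moreover have "\<alpha> \<noteq> ?b" "\<alpha> \<noteq> ?t" using dis a by auto
        ultimately show ?thesis by (simp add: Imem)
      qed
      moreover have "(\<alpha>, \<beta>) \<in> Q \<or> (\<beta>, \<alpha>) \<in> Q" if "\<alpha> \<in> ?C" "\<beta> \<in> ?C" for \<alpha> \<beta>
        using ch[of "Some \<alpha>" "Some \<beta>"] that by simp
      ultimately have "?C \<in> order_complex (Restr Q I)" "\<tau> = Some ` ?C"
        unfolding order_complex_def Chains_def by blast+
      then show "\<tau> \<in> (`) Some ` order_complex (Restr Q I)" by blast
    next
      fix \<tau> assume "\<tau> \<in> (`) Some ` order_complex (Restr Q I)"
      then obtain C where C: "\<tau> = Some ` C" "finite C"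
        and ch: "\<And>\<alpha> \<beta>. \<alpha> \<in> C \<Longrightarrow> \<beta> \<in> C \<Longrightarrow> ((\<alpha>, \<beta>) \<in> Q \<or> (\<beta>, \<alpha>) \<in> Q) \<and> \<alpha> \<in> I"
        unfolding order_complex_def Chains_def by blast
      have CI: "\<alpha> \<in> I" if "\<alpha> \<in> C" for \<alpha> using ch[OF that that] by blast
      have "?\<sigma> \<inter> \<tau> = {}" using CI Imem unfolding C(1) by auto
      moreover have "?\<sigma> \<union> \<tau> \<in> order_complex Ph"
        unfolding OC
      proof (intro conjI ballI)
        show "finite (?\<sigma> \<union> \<tau>)" using C by simp
        have cases: "z = None \<or> z = Some ?b \<or> z = Some ?t \<or> (\<exists>\<alpha>\<in>C. z = Some \<alpha>)" if "z \<in> ?\<sigma> \<union> \<tau>" for z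
          using that C(1) by auto
        have comp: "(x, None) \<in> Ph \<and> (Some ?b, x) \<in> Ph \<and> ((x, Some ?t) \<in> Ph \<or> (Some ?t, x) \<in> Ph)" if "x \<in> ?\<sigma> \<union> \<tau>" for x
        proof -
          have "x = None \<or> (\<exists>\<alpha>. x = Some \<alpha> \<and> (\<alpha>, ?t) \<in> Q)"
            using cases[OF that] CI Imem bottom_least[OF tW] Q_refl[OF tW] by blast
          then show ?thesis
          proof
            assume "x = None"
            then show ?thesis using bottom_W tW by simp
          next
            assume "\<exists>\<alpha>. x = Some \<alpha> \<and> (\<alpha>, ?t) \<in> Q"
            then obtain \<alpha> where a: "x = Some \<alpha>" "(\<alpha>, ?t) \<in> Q" by blast
            then show ?thesis using bottom_least[OF Q_W(1)[OF a(2)]] Q_W(1)[OF a(2)] by simp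
          qed
        qed
        fix x y assume x: "x \<in> ?\<sigma> \<union> \<tau>" and y: "y \<in> ?\<sigma> \<union> \<tau>"
        show "(x, y) \<in> Ph \<or> (y, x) \<in> Ph"
        proof (cases "x = None \<or> x = Some ?b \<or> x = Some ?t")
          case True
          then show ?thesis using comp[OF y] by metis
        next
          case xC: False
          show ?thesis
          proof (cases "y = None \<or> y = Some ?b \<or> y = Some ?t")
            case True
            then show ?thesis using comp[OF x] by metis
          next
            case False
            then obtain \<alpha> \<beta> where "\<alpha> \<in> C" "x = Some \<alpha>" "\<beta> \<in> C" "y = Some \<beta>"
              using xC cases[OF x] cases[OF y] by metis
            then show ?thesis using ch[of \<alpha> \<beta>] by simp
          qed
        qed
      qed
      ultimately show "\<tau> \<in> {\<tau>. ?\<sigma> \<inter> \<tau> = {} \<and> ?\<sigma> \<union> \<tau> \<in> order_complex Ph}" by blast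
    qed
    have "card ?\<sigma> = 3" using bt by simp
    then have "shelling (n + 1 - 3) ((`) Some ` order_complex (Restr Q I))"
      using shelling_link[OF shelling_Ph \<sigma>] unfolding link by simp
    from shelling_wedge_of_spheres[OF this] obtain m where
      m: "geometric_realization ((`) Some ` order_complex (Restr Q I)) homotopy_equivalent_space
        wedge_of_spheres (int (n + 1 - 3) - 1) m" by blast
    have rel: "geometric_realization ((`) Some ` order_complex (Restr Q I)) homotopy_equivalent_space
        geometric_realization (order_complex (Restr Q I))"
    proof (rule relabel_homotopy_equivalent)
      show "order_complex (Restr Q I) \<subseteq> Pow WP"
        using IW unfolding order_complex_def Chains_def by blast
    qed (simp_all add: finite_WP)
    \<comment> \<open>Now n \<ge> 2, so removing three of the n + 1 vertices of a facet is not
      truncated.\<close>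
    have d: "int (n + 1 - 3) - 1 = int n - 3" using False n by linarith
    show ?thesis
      using homotopy_eqv_trans[OF rel[unfolded homotopy_equivalent_space_sym[of "geometric_realization ((`) Some ` order_complex (Restr Q I))"]] m]
      unfolding d by blast
  qed
qed

end

theorem theorem1p4:
  fixes n k :: nat
  assumes "1 \<le> n" and "1 \<le> k"
  shows "EL_shellable (adjoin_top (weighted_partition_poset n k)) \<and>
    cohen_macaulay_poset (adjoin_top (weighted_partition_poset n k)) \<and>
    (\<forall>\<mu>\<in>WComp (n - 1). Poly_Mapping.keys \<mu> \<subseteq> {1..k} \<longrightarrow>
       (\<exists>m. geometric_realization
              (order_complex
                (Restr (weighted_partition_poset n k)
                  (open_interval (weighted_partition_poset n k)
                    (bottom_partition n) (one_block n \<mu>))))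
            homotopy_equivalent_space wedge_of_spheres (int n - 3) m))"
proof -
  interpret weighted_poset n k using assms by unfold_locales
  show ?thesis
    using EL_shellable_Ph shelling_cohen_macaulay[OF shelling_Ph] open_interval_wedge
    unfolding cohen_macaulay_poset_def by blast
qed

end
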